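(* Let $0<p<\infty$ and let $M$ be the Hardy–Littlewood maximal operator. (a) Let $w\in D_q\cap P$ with $0<q<p$. Then $M$ extends to a bounded operator from $BH^{p,\infty}_w$ to $L^p_w$. (b) Let $w\in A_{q,r}\cap P$ with $0<q<p$ and $1<r<\infty$. (i) If $1<s\le\infty$ and $rp/(r-1)\le s$, then $M$ extends to a bounded operator from $BH^{p,s}_w$ to $L^p_w$. (ii) If $\max\{rp/(r-1),p/q\}<s\le\infty$, then $M$ extends to a bounded operator from $BH^{p,s}_w$ to itself.
   Context: $Mf(x)=\sup_{Q\ni x}\frac1{|Q|}\int_Q|f(y)|\,dy$, supremum over all cubes $Q\subset\mathbf{R}^n$ containing $x$. A weight is a nonnegative locally integrable function on $\mathbf{R}^n$; $w(E)=\int_E w$, $L^p_w=L^p(\mathbf{R}^n,w\,dx)$. $\lambda Q$ is the cube concentric with $Q$ with edges $\lambda$ times as long. $\bar p=\min\{p,1\}$. $w\in D_q$ means there is $C$ with $w(\lambda Q)\le C\lambda^{nq}w(Q)$ for all cubes $Q$ and $\lambda>1$. $w\in RH_r$ means there is $C$ with $(\frac1{|Q|}\int_Qw^r)^{1/r}\le\frac C{|Q|}\int_Qw$ for all cubes $Q$. $A_{q,r}=D_q\cap RH_r$. $w\in P$ means there are cubes $Q_i$ ($i\ge1$) with pairwise disjoint interiors, $w(Q_i)>0$, $\mathbf{R}^n=\bigcup_iQ_i$. A $(p,s,w)$-block is a function $a$ supported in a cube $Q$ with $\|a\|_{L^s}\le|Q|^{1/s}w(Q)^{-1/p}$. $B^{p,s}_w$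 is the space of functions $f=\sum_k\lambda_kh_k$ with $h_k$ $(p,s,w)$-blocks, $\lambda_k$ real, $\sum_k|\lambda_k|^{\bar p}<\infty$, with quasi-norm $\|f\|_{B^{p,s}_w}=\inf(\sum_k|\lambda_k|^{\bar p})^{1/\bar p}$ over all such decompositions. Here $BH^{p,s}_w$ denotes $B^{p,s}_w$ with this quasi-norm (the series converge in $L^p_w$ and $w$-a.e. in the ranges considered). *)

theory Defs
  imports "HOL-Analysis.Analysis" "HOL-Probability.Essential_Supremum"
begin

text \<open>Closed cube with centre \<open>c\<close> and edge length \<open>l\<close>, edges parallel to the axes; its dilate
  \<open>\<lambda>Q\<close> is \<open>cube c (\<lambda> * l)\<close>.\<close>

definition cube :: "real^'n \<Rightarrow> real \<Rightarrow> (real^'n) set" where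
  "cube c l = cbox (\<chi> i. c $ i - l / 2) (\<chi> i. c $ i + l / 2)"

definition locally_integrable :: "(real^'n \<Rightarrow> real) \<Rightarrow> bool" where
  "locally_integrable f \<longleftrightarrow> (\<forall>K. compact K \<longrightarrow> f absolutely_integrable_on K)"

definition weight :: "(real^'n \<Rightarrow> real) \<Rightarrow> bool" where
  "weight w \<longleftrightarrow> (\<forall>x. 0 \<le> w x) \<and> locally_integrable w"

definition wmeas :: "(real^'n \<Rightarrow> real) \<Rightarrow> (real^'n) set \<Rightarrow> real" where
  "wmeas w E = (LINT x:E|lebesgue. w x)"

definition D_class :: "real \<Rightarrow> (real^'n \<Rightarrow> real) set" where
  "D_class q = {w. weight w \<and> (\<exists>C. \<forall>c l t. 0 < l \<and> 1 < t \<longrightarrow>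
     wmeas w (cube c (t * l)) \<le> C * t powr (real CARD('n) * q) * wmeas w (cube c l))}"

text \<open>Integrability of \<open>w\<^sup>r\<close> has to be demanded explicitly, since the integral of a
  non-integrable function is 0.\<close>

definition RH_class :: "real \<Rightarrow> (real^'n \<Rightarrow> real) set" where
  "RH_class r = {w. weight w \<and> (\<exists>C. \<forall>c l. 0 < l \<longrightarrow>
     (\<lambda>x. w x powr r) absolutely_integrable_on cube c l \<and>
     ((LINT x:cube c l|lebesgue. w x powr r) / measure lebesgue (cube c l)) powr (1 / r)
       \<le> C / measure lebesgue (cube c l) * (LINT x:cube c l|lebesgue. w x))}"

definition A_class :: "real \<Rightarrow> real \<Rightarrow> (real^'n \<Rightarrow> real) set" where
  "A_class q r = D_class q \<inter> RH_class r"

definition P_class :: "(real^'n \<Rightarrow> real) set" where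
  "P_class = {w. weight w \<and> (\<exists>(c :: nat \<Rightarrow> real^'n) (l :: nat \<Rightarrow> real).
     (\<forall>i. 0 < l i \<and> 0 < wmeas w (cube (c i) (l i))) \<and>
     (\<forall>i j. i \<noteq> j \<longrightarrow> interior (cube (c i) (l i)) \<inter> interior (cube (c j) (l j)) = {}) \<and>
     (\<Union>i. cube (c i) (l i)) = UNIV)}"

text \<open>The Lebesgue space \<open>L\<^sup>s(N)\<close> of real functions and its (quasi-)norm, for \<open>0 < s \<le> \<infinity>\<close>.
  The norm is meaningful only on members of the space.\<close>

definition Lp_space :: "'a measure \<Rightarrow> ennreal \<Rightarrow> ('a \<Rightarrow> real) set" where
  "Lp_space N s = {f. f \<in> borel_measurable N \<and>
     (if s = \<infinity> then esssup N (\<lambda>x. ennreal \<bar>f x\<bar>) < \<infinity>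
      else integrable N (\<lambda>x. \<bar>f x\<bar> powr enn2real s))}"

definition Lp_norm :: "'a measure \<Rightarrow> ennreal \<Rightarrow> ('a \<Rightarrow> real) \<Rightarrow> real" where
  "Lp_norm N s f =
     (if s = \<infinity> then enn2real (esssup N (\<lambda>x. ennreal \<bar>f x\<bar>))
      else (LINT x|N. \<bar>f x\<bar> powr enn2real s) powr (1 / enn2real s))"

definition weighted :: "(real^'n \<Rightarrow> real) \<Rightarrow> (real^'n) measure" where
  "weighted w = density lebesgue (\<lambda>x. ennreal (w x))"

text \<open>\<open>(p, s, w)\<close>-blocks. The exponent \<open>enn2real (1 / s)\<close> is 0 for \<open>s = \<infinity>\<close>. The value of
  \<open>powr\<close> at \<open>w(Q) = 0\<close> does not matter for \<open>w\<close> in \<open>D_class q \<inter> P_class\<close>: such a weight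
  has positive mass on every cube.\<close>

definition is_block :: "real \<Rightarrow> ennreal \<Rightarrow> (real^'n \<Rightarrow> real) \<Rightarrow> (real^'n \<Rightarrow> real) \<Rightarrow> bool" where
  "is_block p s w a \<longleftrightarrow> (\<exists>c l. 0 < l \<and> (\<forall>x. x \<notin> cube c l \<longrightarrow> a x = 0) \<and>
     a \<in> Lp_space lebesgue s \<and>
     Lp_norm lebesgue s a
       \<le> measure lebesgue (cube c l) powr enn2real (1 / s) * wmeas w (cube c l) powr (- 1 / p))"

text \<open>The sum of a block series is taken pointwise almost everywhere with respect to Lebesgue
  measure. The maximal function depends on the values of \<open>f\<close> on \<open>{w = 0}\<close>, so an identification
  of functions merely \<open>w\<close>-a.e. would not be compatible with it.\<close>

definition block_decomp ::
  "real \<Rightarrow> ennreal \<Rightarrow> (real^'n \<Rightarrow> real) \<Rightarrow> (real^'n \<Rightarrow> real)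
   \<Rightarrow> (nat \<Rightarrow> real) \<Rightarrow> (nat \<Rightarrow> real^'n \<Rightarrow> real) \<Rightarrow> bool" where
  "block_decomp p s w f lam h \<longleftrightarrow>
     (\<forall>k. is_block p s w (h k)) \<and> summable (\<lambda>k. \<bar>lam k\<bar> powr min p 1) \<and>
     (AE x in lebesgue. (\<lambda>k. lam k * h k x) sums f x)"

definition block_space :: "real \<Rightarrow> ennreal \<Rightarrow> (real^'n \<Rightarrow> real) \<Rightarrow> (real^'n \<Rightarrow> real) set" where
  "block_space p s w = {f. \<exists>lam h. block_decomp p s w f lam h}"

definition block_norm :: "real \<Rightarrow> ennreal \<Rightarrow> (real^'n \<Rightarrow> real) \<Rightarrow> (real^'n \<Rightarrow> real) \<Rightarrow> real" where
  "block_norm p s w f =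
     Inf {(\<Sum>k. \<bar>lam k\<bar> powr min p 1) powr (1 / min p 1) | lam h. block_decomp p s w f lam h}"

definition HL_maximal :: "(real^'n \<Rightarrow> real) \<Rightarrow> real^'n \<Rightarrow> ennreal" where
  "HL_maximal f x = (SUP (c, l) \<in> {(c, l). 0 < l \<and> x \<in> cube c l}.
     (\<integral>\<^sup>+ y \<in> cube c l. ennreal \<bar>f y\<bar> \<partial>lebesgue) / emeasure lebesgue (cube c l))"

text \<open>\<open>M\<close> as a bounded operator from \<open>X\<close> to a space \<open>Y\<close> of functions modulo \<open>N\<close>-null sets. The
  supremum defining \<open>M f\<close> makes sense in \<open>[0, \<infinity>]\<close> for all \<open>f\<close> in \<open>X\<close>, and the extension of
  \<open>M\<close> to all of \<open>X\<close> is the one given by this supremum; its being finite \<open>N\<close>-a.e. is part of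
  the claim. Boundedness of the (nonlinear) operator is the quasi-norm inequality.\<close>

definition maximal_bounded ::
  "(real^'n \<Rightarrow> real) set \<Rightarrow> ((real^'n \<Rightarrow> real) \<Rightarrow> real) \<Rightarrow>
   (real^'n) measure \<Rightarrow> (real^'n \<Rightarrow> real) set \<Rightarrow> ((real^'n \<Rightarrow> real) \<Rightarrow> real) \<Rightarrow> bool" where
  "maximal_bounded X normX N Y normY \<longleftrightarrow> (\<exists>C. \<forall>f\<in>X.
     (AE x in N. HL_maximal f x < \<infinity>) \<and>
     (\<lambda>x. enn2real (HL_maximal f x)) \<in> Y \<and>
     normY (\<lambda>x. enn2real (HL_maximal f x)) \<le> C * normX f)"

definition maximal_bounded_block_Lp :: "real \<Rightarrow> ennreal \<Rightarrow> (real^'n \<Rightarrow> real) \<Rightarrow> bool" where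
  "maximal_bounded_block_Lp p s w \<longleftrightarrow>
     maximal_bounded (block_space p s w) (block_norm p s w)
       (weighted w) (Lp_space (weighted w) (ennreal p)) (Lp_norm (weighted w) (ennreal p))"

definition maximal_bounded_block_block :: "real \<Rightarrow> ennreal \<Rightarrow> (real^'n \<Rightarrow> real) \<Rightarrow> bool" where
  "maximal_bounded_block_block p s w \<longleftrightarrow>
     maximal_bounded (block_space p s w) (block_norm p s w)
       lebesgue (block_space p s w) (block_norm p s w)"

end

theory Submission
  imports Defs
begin

text \<open>
  The reason for all three parts is one pointwise decomposition. Let \<open>h\<close> be a block on a cube
  \<open>Q\<close> with edge length \<open>l\<close>, and put \<open>\<alpha> = w(Q)\<close> to the power \<open>- 1 / p\<close>, so that the average of
  \<open>\<bar>h\<bar>\<close> over \<open>Q\<close> is at most a multiple of \<open>\<alpha>\<close>. Cut space into \<open>2Q\<close> and the shells between \<open>2\<^sup>jQ\<close> and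
  \<open>2\<^sup>j\<^sup>+\<^sup>1Q\<close>. On \<open>2Q\<close> the maximal theorem in \<open>L\<^sup>s\<close> controls \<open>M h\<close>. On the \<open>j\<close>-th shell a cube that
  meets \<open>Q\<close> has edge length comparable to \<open>2\<^sup>jl\<close> at least, so \<open>M h\<close> is at most a multiple of
  \<open>\<alpha> / 2\<^sup>j\<^sup>n\<close> there. By \<open>D_class q\<close>, passing from \<open>Q\<close> to \<open>2\<^sup>j\<^sup>+\<^sup>1Q\<close> lowers the admissible height of a
  block by at most a factor comparable to \<open>2\<close> to the power \<open>j n q / p\<close>. Since \<open>q < p\<close>, the
  function \<open>M h\<close> is therefore a sum of nonnegative blocks with coefficients \<open>A \<rho>\<^sup>j\<close>, where \<open>\<rho> < 1\<close> and
  where \<open>A\<close> and \<open>\<rho>\<close> do not depend on \<open>h\<close> (\<open>block_maximal_decomposition\<close>).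

  By countable sublinearity, \<open>M f\<close> is then dominated by a nonnegative block series whose
  coefficients have \<open>min p 1\<close>-power sum at most a constant times that of \<open>f\<close>
  (\<open>maximal_block_series\<close>). Two properties of single blocks finish the proof.

  \<^item> If all blocks have uniformly bounded norm in \<open>L\<^sup>p(w)\<close>, such a series has controlled norm in \<open>L\<^sup>p(w)\<close>,
    by subadditivity of the \<open>p\<close>-th power for \<open>p \<le> 1\<close> and by convexity for \<open>p > 1\<close>
    (\<open>maximal_bounded_block_LpI\<close>). For bounded blocks this uniform bound is immediate, and for
    \<open>s < \<infinity>\<close> it is Young's inequality together with the reverse Hoelder condition
    (\<open>block_Lp_bound\<close>).
  \<^item> If the integral of \<open>\<bar>h\<bar>\<close> over each bounded cube is bounded uniformly in \<open>h\<close>, the series converges almost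
    everywhere, and multiplying its terms by the ratio of \<open>M f\<close> to its sum turns it into a block
    decomposition of \<open>M f\<close> itself (\<open>maximal_bounded_block_blockI\<close>). Blocks on small cubes are
    under control by \<open>D_class q\<close> and \<open>q < p\<close>, blocks on large cubes because the reverse Hoelder
    condition forces \<open>w(Q)\<close> to grow with \<open>Q\<close> (\<open>block_local_L1_bound\<close>).

  Constants are irrelevant throughout, so the estimates for which one would invoke Hoelder's or
  Jensen's inequality are reduced to the elementary inequality \<open>t \<le> \<beta> + \<beta>\<^sup>1\<^sup>-\<^sup>\<sigma> t\<^sup>\<sigma>\<close> with a suitable threshold \<open>\<beta>\<close>.
\<close>

section \<open>Cubes\<close>

lemma mem_cube: "x \<in> cube c l \<longleftrightarrow> (\<forall>i. c $ i - l / 2 \<le> x $ i \<and> x $ i \<le> c $ i + l / 2)"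
  for x :: "real^'n"
  unfolding cube_def mem_box_cart by simp

lemma cube_sets [measurable, simp]: "cube c l \<in> sets lebesgue" "cube c l \<in> sets borel"
  unfolding cube_def by auto

lemma compact_cube [simp]: "compact (cube c l)"
  unfolding cube_def by (rule compact_cbox)

lemma measure_cube:
  fixes c :: "real^'n"
  assumes "0 \<le> l"
  shows "measure lebesgue (cube c l) = l ^ CARD('n)"
proof -
  have "cbox (\<chi> i. c $ i - l / 2) (\<chi> i. c $ i + l / 2) \<noteq> {}"
    using assms by (auto simp: interval_ne_empty_cart)
  then show ?thesis
    unfolding cube_def by (simp add: content_cbox_cart)
qed

lemma emeasure_cube:
  fixes c :: "real^'n"
  assumes "0 \<le> l"
  shows "emeasure lebesgue (cube c l) = ennreal (l ^ CARD('n))"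
proof -
  have "cube c l \<in> lmeasurable"
    unfolding cube_def by simp
  then show ?thesis
    using measure_cube[OF assms, of c] by (simp add: emeasure_eq_measure2)
qed

lemma cube_mono:
  fixes c :: "real^'n"
  assumes "\<And>i. c' $ i - l' / 2 \<le> c $ i - l / 2 \<and> c $ i + l / 2 \<le> c' $ i + l' / 2"
  shows "cube c l \<subseteq> cube c' l'"
  unfolding mem_cube subset_iff using assms by (meson order_trans)

lemma cube_meet_subset:
  fixes c :: "real^'n"
  assumes "cube c l \<inter> cube c' l' \<noteq> {}" "2 * l + l' \<le> t"
  shows "cube c l \<subseteq> cube c' t"
proof -
  obtain z where z: "z \<in> cube c l" "z \<in> cube c' l'" using assms by auto
  show ?thesis
  proof (rule cube_mono)
    fix i show "c' $ i - t / 2 \<le> c $ i - l / 2 \<and> c $ i + l / 2 \<le> c' $ i + t / 2"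
      using z[unfolded mem_cube, THEN spec, of i] assms(2) by linarith
  qed
qed

lemma cube_subset_cball:
  fixes c :: "real^'n"
  shows "cube c l \<subseteq> cball c (real CARD('n) * l / 2)"
proof
  fix x assume x: "x \<in> cube c l"
  have "norm (x - c) \<le> (\<Sum>i\<in>UNIV. \<bar>(x - c) $ i\<bar>)" by (rule norm_le_l1_cart)
  also have "\<dots> \<le> (\<Sum>i\<in>(UNIV :: 'n set). l / 2)"
  proof (rule sum_mono)
    fix i show "\<bar>(x - c) $ i\<bar> \<le> l / 2"
      using x[unfolded mem_cube, rule_format, of i] unfolding vector_minus_component abs_le_iff by linarith
  qed
  finally show "x \<in> cball c (real CARD('n) * l / 2)" by (simp add: dist_norm norm_minus_commute)
qed

lemma mem_cube_of_norm_le: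
  fixes x c :: "real^'n"
  assumes "2 * norm (x - c) \<le> l"
  shows "x \<in> cube c l"
proof -
  have "c $ i - l / 2 \<le> x $ i \<and> x $ i \<le> c $ i + l / 2" for i
    using component_le_norm_cart[of "x - c" i] assms unfolding vector_minus_component by arith
  then show ?thesis unfolding mem_cube by blast
qed

lemma cball_subset_cube: "cball c r \<subseteq> cube c (2 * r)" for c :: "real^'n"
  by (auto intro!: mem_cube_of_norm_le simp: dist_norm norm_minus_commute)

section \<open>The maximal function\<close>

lemma HL_maximal_alt:
  "HL_maximal f x = (SUP (c, l) \<in> {(c, l). 0 < l \<and> x \<in> cube c l}.
     (\<integral>\<^sup>+ y \<in> cube c l. ennreal \<bar>f y\<bar> \<partial>lebesgue) / ennreal (l ^ CARD('n)))"
  for f :: "real^'n \<Rightarrow> real"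
  unfolding HL_maximal_def by (intro SUP_cong refl) (clarsimp simp only: emeasure_cube less_imp_le)

text \<open>Clearing the denominator keeps all arithmetic with \<open>\<infinity>\<close> out of the later arguments.\<close>

lemma less_HL_maximal_iff:
  fixes f :: "real^'n \<Rightarrow> real"
  assumes t: "0 \<le> t"
  shows "ennreal t < HL_maximal f x \<longleftrightarrow>
    (\<exists>c l. 0 < l \<and> x \<in> cube c l \<and>
       ennreal (t * l ^ CARD('n)) < (\<integral>\<^sup>+ y \<in> cube c l. ennreal \<bar>f y\<bar> \<partial>lebesgue))"
proof -
  have "ennreal t < I / ennreal (l ^ CARD('n)) \<longleftrightarrow> ennreal (t * l ^ CARD('n)) < I"
    if "0 < l" for I l
  proof -
    have "0 < l ^ CARD('n)" using that by simp
    then have "I / ennreal (l ^ CARD('n)) \<le> ennreal t \<longleftrightarrow> I \<le> ennreal t * ennreal (l ^ CARD('n))"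
      by (cases I) (auto simp: divide_ennreal ennreal_mult[symmetric] t ennreal_top_divide
        pos_divide_le_eq top_unique)
    then show ?thesis using that t by (simp add: ennreal_mult not_le[symmetric])
  qed
  then show ?thesis
    unfolding HL_maximal_alt less_SUP_iff by fastforce
qed

lemma HL_maximal_leI:
  fixes f :: "real^'n \<Rightarrow> real"
  assumes "\<And>c l. 0 < l \<Longrightarrow> x \<in> cube c l \<Longrightarrow>
    (\<integral>\<^sup>+ y \<in> cube c l. ennreal \<bar>f y\<bar> \<partial>lebesgue) \<le> ennreal (l ^ CARD('n)) * B"
  shows "HL_maximal f x \<le> B"
  unfolding HL_maximal_alt
proof (rule SUP_least, clarify)
  fix c :: "real^'n" and l :: real assume "0 < l" "x \<in> cube c l"
  with assms[OF this] show "(\<integral>\<^sup>+ y \<in> cube c l. ennreal \<bar>f y\<bar> \<partial>lebesgue) / ennreal (l ^ CARD('n)) \<le> B"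
    by (intro divide_le_posI_ennreal) (auto simp: mult.commute)
qed

text \<open>A closed cube with large average can be enlarged slightly without spoiling the strict
  inequality, and the enlarged cube contains a neighbourhood of the given point. This is why \<open>M f\<close> is
  measurable although the supremum runs over uncountably many closed cubes.\<close>

lemma open_superlevel_HL_maximal:
  fixes f :: "real^'n \<Rightarrow> real"
  assumes t: "0 \<le> t"
  shows "open {x. ennreal t < HL_maximal f x}"
proof (rule openI)
  fix x assume "x \<in> {x. ennreal t < HL_maximal f x}"
  then obtain c l where cl: "0 < l" "x \<in> cube c l"
    "ennreal (t * l ^ CARD('n)) < (\<integral>\<^sup>+ y \<in> cube c l. ennreal \<bar>f y\<bar> \<partial>lebesgue)"
    by (auto simp: less_HL_maximal_iff[OF t])
  let ?I = "\<lambda>l. \<integral>\<^sup>+ y \<in> cube c l. ennreal \<bar>f y\<bar> \<partial>lebesgue"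
  have "((\<lambda>l'. ennreal (t * l' ^ CARD('n))) \<longlongrightarrow> ennreal (t * l ^ CARD('n))) (at_right l)"
    by (intro tendsto_intros)
  then have "eventually (\<lambda>l'. ennreal (t * l' ^ CARD('n)) < ?I l) (at_right l)"
    using cl(3) by (rule order_tendstoD)
  then obtain b where b: "b > l" "\<And>l'. l < l' \<Longrightarrow> l' < b \<Longrightarrow> ennreal (t * l' ^ CARD('n)) < ?I l"
    by (auto simp: eventually_at_right_field)
  define l' where "l' = (l + b) / 2"
  have l': "l < l'" "l' < b" using b(1) by (auto simp: l'_def)
  have sub: "cube c l \<subseteq> cube c l'"
    using l' by (intro cube_mono) auto
  have "?I l \<le> ?I l'"
    using sub by (intro nn_integral_mono) (auto simp: indicator_def)
  then have I: "ennreal (t * l' ^ CARD('n)) < ?I l'"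
    using b(2)[OF l'] by (rule order.strict_trans2[rotated])
  have "ball x ((l' - l) / 2) \<subseteq> {x. ennreal t < HL_maximal f x}"
  proof
    fix y assume "y \<in> ball x ((l' - l) / 2)"
    then have n: "norm (x - y) < (l' - l) / 2" by (simp add: dist_norm)
    have "c $ i - l' / 2 \<le> y $ i \<and> y $ i \<le> c $ i + l' / 2" for i
    proof -
      have "x $ i - y $ i < (l' - l) / 2 \<and> y $ i - x $ i < (l' - l) / 2"
        using component_le_norm_cart[of "x - y" i] n unfolding vector_minus_component by arith
      then show ?thesis
        using cl(2)[unfolded mem_cube, rule_format, of i] by (auto simp: diff_divide_distrib)
    qed
    then have "y \<in> cube c l'" by (simp add: mem_cube)
    then show "y \<in> {x. ennreal t < HL_maximal f x}"
      using I cl(1) l' by (auto simp: less_HL_maximal_iff[OF t] intro!: exI[of _ c] exI[of _ l'])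
  qed
  then show "\<exists>e>0. ball x e \<subseteq> {x. ennreal t < HL_maximal f x}"
    using l'(1) by (intro exI[of _ "(l' - l) / 2"]) auto
qed

lemma borel_measurable_HL_maximal:
  "HL_maximal f \<in> borel_measurable borel" for f :: "real^'n \<Rightarrow> real"
proof (rule borel_measurableI_greater)
  fix y :: ennreal
  show "{x \<in> space borel. y < HL_maximal f x} \<in> sets borel"
    by (cases y) (auto simp: borel_open[OF open_superlevel_HL_maximal])
qed

lemma borel_measurable_HL_maximal_lebesgue [measurable]:
  "HL_maximal f \<in> borel_measurable lebesgue" for f :: "real^'n \<Rightarrow> real"
  using borel_measurable_HL_maximal[of f]
  by (intro measurable_completion) (simp add: measurable_lborel1)

lemma average_le_HL_maximal:
  fixes f :: "real^'n \<Rightarrow> real"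
  assumes "0 < l" "x \<in> cube c l"
  shows "(\<integral>\<^sup>+ y \<in> cube c l. ennreal \<bar>f y\<bar> \<partial>lebesgue) \<le> ennreal (l ^ CARD('n)) * HL_maximal f x"
proof -
  have "(\<integral>\<^sup>+ y \<in> cube c l. ennreal \<bar>f y\<bar> \<partial>lebesgue) / ennreal (l ^ CARD('n)) \<le> HL_maximal f x"
    unfolding HL_maximal_alt using assms by (intro SUP_upper2[of "(c, l)"]) auto
  then have "ennreal (l ^ CARD('n)) * ((\<integral>\<^sup>+ y \<in> cube c l. ennreal \<bar>f y\<bar> \<partial>lebesgue) / ennreal (l ^ CARD('n)))
     \<le> ennreal (l ^ CARD('n)) * HL_maximal f x"
    by (rule mult_left_mono) simp
  then show ?thesis
    using assms(1) by (simp add: ennreal_times_divide ennreal_mult_divide_eq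
      mult.commute[of "ennreal (l ^ CARD('n))" "nn_integral _ _"])
qed

text \<open>Monotone convergence gives countable sublinearity. The domination of \<open>f\<close> is assumed almost
  everywhere because block series converge only in this sense.\<close>

lemma HL_maximal_suminf_le:
  fixes h :: "nat \<Rightarrow> real^'n \<Rightarrow> real"
  assumes [measurable]: "\<And>k. h k \<in> borel_measurable lebesgue"
    and f: "AE x in lebesgue. ennreal \<bar>f x\<bar> \<le> (\<Sum>k. ennreal \<bar>lam k\<bar> * ennreal \<bar>h k x\<bar>)"
  shows "HL_maximal f x \<le> (\<Sum>k. ennreal \<bar>lam k\<bar> * HL_maximal (h k) x)"
proof (rule HL_maximal_leI)
  fix c :: "real^'n" and l :: real assume cl: "0 < l" "x \<in> cube c l"
  have "(\<integral>\<^sup>+ y \<in> cube c l. ennreal \<bar>f y\<bar> \<partial>lebesgue)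
      \<le> (\<integral>\<^sup>+ y. (\<Sum>k. ennreal \<bar>lam k\<bar> * (ennreal \<bar>h k y\<bar> * indicator (cube c l) y)) \<partial>lebesgue)"
    by (rule nn_integral_mono_AE) (use f in eventually_elim, auto simp: indicator_def)
  also have "\<dots> = (\<Sum>k. \<integral>\<^sup>+ y. ennreal \<bar>lam k\<bar> * (ennreal \<bar>h k y\<bar> * indicator (cube c l) y) \<partial>lebesgue)"
    by (rule nn_integral_suminf) measurable
  also have "\<dots> = (\<Sum>k. ennreal \<bar>lam k\<bar> * (\<integral>\<^sup>+ y \<in> cube c l. ennreal \<bar>h k y\<bar> \<partial>lebesgue))"
    by (intro suminf_cong nn_integral_cmult) measurable
  also have "\<dots> \<le> (\<Sum>k. ennreal \<bar>lam k\<bar> * (ennreal (l ^ CARD('n)) * HL_maximal (h k) x))"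
    by (intro suminf_le mult_left_mono average_le_HL_maximal cl) auto
  also have "\<dots> = ennreal (l ^ CARD('n)) * (\<Sum>k. ennreal \<bar>lam k\<bar> * HL_maximal (h k) x)"
    by (simp only: mult.left_commute[of "ennreal \<bar>lam _\<bar>"] ennreal_suminf_cmult)
  finally show "(\<integral>\<^sup>+ y \<in> cube c l. ennreal \<bar>f y\<bar> \<partial>lebesgue) \<le> ennreal (l ^ CARD('n)) * (\<Sum>k. ennreal \<bar>lam k\<bar> * HL_maximal (h k) x)" .
qed


section \<open>Weak and strong type estimates\<close>

text \<open>Each point of the superlevel set lies in a cube with large average. Enclosing these cubes in
  balls, the Vitali covering lemma selects countably many disjoint balls whose fivefold dilates still
  cover. The dilates are put back into cubes, of edge length \<open>5 n l\<close>, and the selected cubes are disjoint,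
  so their integrals add up to at most the full integral.\<close>

lemma HL_maximal_weak_type:
  fixes f :: "real^'n \<Rightarrow> real"
  assumes f [measurable]: "f \<in> borel_measurable lebesgue" and t: "0 < t"
  shows "emeasure lebesgue {x. ennreal t < HL_maximal f x}
    \<le> ennreal ((5 * real CARD('n)) ^ CARD('n) / t) * (\<integral>\<^sup>+ x. ennreal \<bar>f x\<bar> \<partial>lebesgue)"
proof (cases "\<integral>\<^sup>+ x. ennreal \<bar>f x\<bar> \<partial>lebesgue")
  case top
  have "0 < (5 * real CARD('n)) ^ CARD('n) / t" using t by simp
  then have "ennreal ((5 * real CARD('n)) ^ CARD('n) / t) \<noteq> 0"
    by (simp only: ennreal_eq_0_iff not_le)
  then have "ennreal ((5 * real CARD('n)) ^ CARD('n) / t) * top = top"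
    by (rule ennreal_top_mult_left)
  then show ?thesis unfolding top by (simp only: top_greatest)
next
  case (real I)
  define E where "E = {x. ennreal t < HL_maximal f x}"
  define P where "P = (\<lambda>x c l. 0 < l \<and> x \<in> cube c l \<and>
      ennreal (t * l ^ CARD('n)) < (\<integral>\<^sup>+ y \<in> cube c l. ennreal \<bar>f y\<bar> \<partial>lebesgue))"
  have "\<exists>c l. P x c l" if "x \<in> E" for x
    using that t unfolding E_def P_def by (simp only: mem_Collect_eq less_HL_maximal_iff less_imp_le)
  then obtain c l where P: "\<And>x. x \<in> E \<Longrightarrow> P x (c x) (l x)"
    by metis
  have cl: "0 < l x" "x \<in> cube (c x) (l x)"
    "ennreal (t * l x ^ CARD('n)) < (\<integral>\<^sup>+ y \<in> cube (c x) (l x). ennreal \<bar>f y\<bar> \<partial>lebesgue)"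
    if "x \<in> E" for x
    using P[OF that] unfolding P_def by simp_all
  define r where "r = (\<lambda>x. real CARD('n) * l x / 2)"
  \<comment> \<open>The covering lemma needs bounded radii: a cube with average above \<open>t\<close> has volume below \<open>I / t\<close>.\<close>
  have rB: "0 < r x \<and> r x \<le> real CARD('n) * max 1 (I / t) / 2" if "x \<in> E" for x
  proof -
    have "(\<integral>\<^sup>+ y \<in> cube (c x) (l x). ennreal \<bar>f y\<bar> \<partial>lebesgue) \<le> (\<integral>\<^sup>+ y. ennreal \<bar>f y\<bar> \<partial>lebesgue)"
      by (intro nn_integral_mono) (auto simp: indicator_def)
    with cl(3)[OF that] have "ennreal (t * l x ^ CARD('n)) < ennreal I"
      unfolding real(2) by (rule order.strict_trans2)
    then have "l x ^ CARD('n) < I / t"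
      using t cl(1)[OF that] by (simp add: ennreal_less_iff pos_less_divide_eq mult.commute)
    moreover have "l x \<le> 1 \<or> l x \<le> l x ^ CARD('n)"
      using self_le_power[of "l x" "CARD('n)"] by (cases "1 \<le> l x") auto
    ultimately have "l x \<le> max 1 (I / t)" by linarith
    then show ?thesis using cl(1)[OF that] unfolding r_def
      by (intro conjI divide_right_mono mult_left_mono) auto
  qed
  have cover: "E \<subseteq> (\<Union>x\<in>E. cball (c x) (r x))"
  proof
    fix x assume x: "x \<in> E"
    have "x \<in> cball (c x) (r x)"
      using cl(2)[OF x] cube_subset_cball[of "c x" "l x"] unfolding r_def by (rule set_mp[rotated])
    with x show "x \<in> (\<Union>x\<in>E. cball (c x) (r x))" by (rule UN_I)
  qed
  obtain C where C: "countable C" "C \<subseteq> E"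
    "pairwise (\<lambda>i j. disjnt (cball (c i) (r i)) (cball (c j) (r j))) C"
    "E \<subseteq> (\<Union>i\<in>C. cball (c i) (5 * r i))"
    by (rule Vitali_covering_lemma_cballs[OF cover rB])
  define Q where "Q = (\<lambda>i. cube (c i) (l i))"
  define X where "X = (\<lambda>i. cube (c i) (5 * real CARD('n) * l i))"
  have [measurable]: "Q i \<in> sets lebesgue" "X i \<in> sets lebesgue" for i by (auto simp: Q_def X_def)
  have [measurable]: "E \<in> sets lebesgue"
    unfolding E_def using open_superlevel_HL_maximal[of t f] t by auto
  have EX: "E \<subseteq> (\<Union>i\<in>C. X i)"
  proof -
    have "2 * (5 * r i) = 5 * real CARD('n) * l i" for i by (simp add: r_def)
    then have "cball (c i) (5 * r i) \<subseteq> X i" for i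
      using cball_subset_cube[of "c i" "5 * r i"] unfolding X_def by (simp only:)
    then have "(\<Union>i\<in>C. cball (c i) (5 * r i)) \<subseteq> (\<Union>i\<in>C. X i)" by (intro UN_mono) auto
    with C(4) show ?thesis by (rule order_trans)
  qed
  have disj: "disjoint_family_on Q C"
    unfolding disjoint_family_on_def
  proof (intro ballI impI)
    fix i j assume "i \<in> C" "j \<in> C" "i \<noteq> j"
    then have "disjnt (cball (c i) (r i)) (cball (c j) (r j))" using C(3) by (auto simp: pairwise_def)
    then show "Q i \<inter> Q j = {}"
      using cube_subset_cball[of "c i" "l i"] cube_subset_cball[of "c j" "l j"]
      unfolding Q_def r_def disjnt_def by blast
  qed
  \<comment> \<open>Countable subadditivity over the index set \<open>C\<close>, written as an interchange of integrals.\<close>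
  have "emeasure lebesgue E = (\<integral>\<^sup>+ x. indicator E x \<partial>lebesgue)" by simp
  also have "\<dots> \<le> (\<integral>\<^sup>+ x. \<integral>\<^sup>+ i. indicator (X i) x \<partial>count_space C \<partial>lebesgue)"
  proof (rule nn_integral_mono)
    fix x
    show "indicator E x \<le> (\<integral>\<^sup>+ i. indicator (X i) x \<partial>count_space C)"
    proof (cases "x \<in> E")
      case True
      then obtain i where i: "i \<in> C" "x \<in> X i" using EX by auto
      have "indicator (X i) x \<le> (\<integral>\<^sup>+ i. (indicator (X i) x :: ennreal) \<partial>count_space C)"
        by (rule nn_integral_ge_point[OF i(1)])
      then show ?thesis using i True by simp
    qed auto
  qed
  also have "\<dots> = (\<integral>\<^sup>+ i. \<integral>\<^sup>+ x. indicator (X i) x \<partial>lebesgue \<partial>count_space C)"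
    by (rule nn_integral_count_space_nn_integral) (use C(1) in auto)
  also have "\<dots> = (\<integral>\<^sup>+ i. emeasure lebesgue (X i) \<partial>count_space C)"
    by simp
  also have "\<dots> \<le> (\<integral>\<^sup>+ i. ennreal ((5 * real CARD('n)) ^ CARD('n) / t)
      * (\<integral>\<^sup>+ y \<in> Q i. ennreal \<bar>f y\<bar> \<partial>lebesgue) \<partial>count_space C)"
  proof (rule nn_integral_mono)
    fix i assume "i \<in> space (count_space C)"
    then have i: "i \<in> E" using C(2) by auto
    have l: "0 < l i" using cl(1)[OF i] .
    have "emeasure lebesgue (X i) = ennreal ((5 * real CARD('n)) ^ CARD('n) / t * (t * l i ^ CARD('n)))"
      unfolding X_def using l t by (subst emeasure_cube) (auto simp: power_mult_distrib)
    also have "\<dots> = ennreal ((5 * real CARD('n)) ^ CARD('n) / t) * ennreal (t * l i ^ CARD('n))"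
      using l t by (intro ennreal_mult) auto
    also have "\<dots> \<le> ennreal ((5 * real CARD('n)) ^ CARD('n) / t) * (\<integral>\<^sup>+ y \<in> Q i. ennreal \<bar>f y\<bar> \<partial>lebesgue)"
      using cl(3)[OF i] unfolding Q_def by (intro mult_left_mono) (auto intro: less_imp_le)
    finally show "emeasure lebesgue (X i) \<le> \<dots>" .
  qed
  also have "\<dots> = ennreal ((5 * real CARD('n)) ^ CARD('n) / t)
      * (\<integral>\<^sup>+ i. (\<integral>\<^sup>+ y \<in> Q i. ennreal \<bar>f y\<bar> \<partial>lebesgue) \<partial>count_space C)"
    by (rule nn_integral_cmult) auto
  also have "(\<integral>\<^sup>+ i. (\<integral>\<^sup>+ y \<in> Q i. ennreal \<bar>f y\<bar> \<partial>lebesgue) \<partial>count_space C)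
      = (\<integral>\<^sup>+ i. emeasure (density lebesgue (\<lambda>y. ennreal \<bar>f y\<bar>)) (Q i) \<partial>count_space C)"
    by (intro nn_integral_cong) (simp add: emeasure_density)
  also have "\<dots> = emeasure (density lebesgue (\<lambda>y. ennreal \<bar>f y\<bar>)) (\<Union>i\<in>C. Q i)"
    by (rule emeasure_UN_countable[symmetric]) (use C(1) disj in auto)
  also have "\<dots> \<le> emeasure (density lebesgue (\<lambda>y. ennreal \<bar>f y\<bar>)) UNIV"
    by (rule emeasure_mono) auto
  also have "\<dots> = (\<integral>\<^sup>+ y. ennreal \<bar>f y\<bar> \<partial>lebesgue)"
    by (simp add: emeasure_density)
  finally show ?thesis by (simp add: E_def mult_left_mono)
qed

text \<open>The part of \<open>f\<close> below height \<open>t\<close> contributes at most \<open>t\<close> to any average, so only the part above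
  \<open>t\<close> can push \<open>M f\<close> from \<open>t\<close> to \<open>2 t\<close>.\<close>

lemma HL_maximal_weak_type_truncated:
  fixes f :: "real^'n \<Rightarrow> real"
  assumes f [measurable]: "f \<in> borel_measurable lebesgue" and t: "0 < t"
  shows "emeasure lebesgue {x. ennreal (2 * t) < HL_maximal f x}
    \<le> ennreal ((5 * real CARD('n)) ^ CARD('n) / t) *
       (\<integral>\<^sup>+ x. ennreal (if t < \<bar>f x\<bar> then \<bar>f x\<bar> else 0) \<partial>lebesgue)"
proof -
  define g where "g = (\<lambda>x. if t < \<bar>f x\<bar> then f x else 0)"
  have [measurable]: "g \<in> borel_measurable lebesgue" unfolding g_def by measurable
  have "{x. ennreal (2 * t) < HL_maximal f x} \<subseteq> {x. ennreal t < HL_maximal g x}"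
  proof clarify
    fix x assume "ennreal (2 * t) < HL_maximal f x"
    then obtain c l where cl: "0 < l" "x \<in> cube c l"
      "ennreal (2 * t * l ^ CARD('n)) < (\<integral>\<^sup>+ y \<in> cube c l. ennreal \<bar>f y\<bar> \<partial>lebesgue)"
      using t by (subst (asm) less_HL_maximal_iff) auto
    have "ennreal (t * l ^ CARD('n)) < (\<integral>\<^sup>+ y \<in> cube c l. ennreal \<bar>g y\<bar> \<partial>lebesgue)"
    proof (rule ccontr)
      assume "\<not> ?thesis"
      then have g: "(\<integral>\<^sup>+ y \<in> cube c l. ennreal \<bar>g y\<bar> \<partial>lebesgue) \<le> ennreal (t * l ^ CARD('n))" by simp
      have "(\<integral>\<^sup>+ y \<in> cube c l. ennreal \<bar>f y\<bar> \<partial>lebesgue)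
          \<le> (\<integral>\<^sup>+ y. ennreal \<bar>g y\<bar> * indicator (cube c l) y + ennreal t * indicator (cube c l) y \<partial>lebesgue)"
        by (intro nn_integral_mono) (auto simp: g_def indicator_def intro: ennreal_leI)
      also have "\<dots> = (\<integral>\<^sup>+ y \<in> cube c l. ennreal \<bar>g y\<bar> \<partial>lebesgue) + ennreal t * emeasure lebesgue (cube c l)"
        by (subst nn_integral_add) (auto simp: nn_integral_cmult_indicator)
      also have "\<dots> \<le> ennreal (t * l ^ CARD('n)) + ennreal (t * l ^ CARD('n))"
        using cl(1) t by (intro add_mono g) (subst emeasure_cube, auto simp: ennreal_mult)
      also have "\<dots> = ennreal (2 * t * l ^ CARD('n))"
        using cl(1) t by (subst ennreal_plus[symmetric]) (auto simp: field_simps)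
      finally show False using cl(3) by simp
    qed
    then show "ennreal t < HL_maximal g x"
      using cl(1,2) t by (subst less_HL_maximal_iff) auto
  qed
  moreover have "{x. ennreal t < HL_maximal g x} \<in> sets lebesgue"
    using open_superlevel_HL_maximal[of t g] t by auto
  ultimately have "emeasure lebesgue {x. ennreal (2 * t) < HL_maximal f x}
      \<le> emeasure lebesgue {x. ennreal t < HL_maximal g x}"
    by (intro emeasure_mono)
  also have "\<dots> \<le> ennreal ((5 * real CARD('n)) ^ CARD('n) / t) * (\<integral>\<^sup>+ x. ennreal \<bar>g x\<bar> \<partial>lebesgue)"
    by (rule HL_maximal_weak_type) (use t in auto)
  also have "(\<lambda>x. ennreal \<bar>g x\<bar>) = (\<lambda>x. ennreal (if t < \<bar>f x\<bar> then \<bar>f x\<bar> else 0))"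
    by (auto simp: g_def)
  finally show ?thesis .
qed

lemma HL_maximal_finite_AE:
  fixes f :: "real^'n \<Rightarrow> real"
  assumes f [measurable]: "f \<in> borel_measurable lebesgue"
    and fin: "(\<integral>\<^sup>+ x. ennreal \<bar>f x\<bar> \<partial>lebesgue) < \<infinity>"
  shows "AE x in lebesgue. HL_maximal f x < \<infinity>"
proof -
  define N where "N = {x. HL_maximal f x = \<infinity>}"
  obtain I where I: "0 \<le> I" "(\<integral>\<^sup>+ x. ennreal \<bar>f x\<bar> \<partial>lebesgue) = ennreal I"
    using fin by (cases "\<integral>\<^sup>+ x. ennreal \<bar>f x\<bar> \<partial>lebesgue") auto
  define A where "A = (5 * real CARD('n)) ^ CARD('n)"
  have A: "0 < A" by (simp add: A_def)
  have N [measurable]: "N \<in> sets lebesgue"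
  proof -
    have "N = HL_maximal f -` {\<infinity>} \<inter> space lebesgue" by (auto simp: N_def)
    also have "\<dots> \<in> sets lebesgue"
      by (rule measurable_sets[OF borel_measurable_HL_maximal_lebesgue]) simp
    finally show ?thesis .
  qed
  have le: "emeasure lebesgue N \<le> ennreal (A * I / real (Suc k))" for k
  proof -
    have "emeasure lebesgue N \<le> emeasure lebesgue {x. ennreal (real (Suc k)) < HL_maximal f x}"
      using open_superlevel_HL_maximal[of "real (Suc k)" f]
      by (intro emeasure_mono) (auto simp: N_def)
    also have "\<dots> \<le> ennreal (A / real (Suc k)) * ennreal I"
      unfolding A_def I(2)[symmetric] by (rule HL_maximal_weak_type) auto
    also have "\<dots> = ennreal (A * I / real (Suc k))"
      using A I(1) by (subst ennreal_mult[symmetric]) auto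
    finally show ?thesis .
  qed
  have "(\<lambda>k. A * I * inverse (real (Suc k))) \<longlonglongrightarrow> A * I * 0"
    by (intro tendsto_intros LIMSEQ_inverse_real_of_nat)
  then have "(\<lambda>k. ennreal (A * I / real (Suc k))) \<longlonglongrightarrow> ennreal 0"
    by (intro tendsto_ennrealI) (simp add: field_simps)
  then have "emeasure lebesgue N \<le> ennreal 0"
    by (rule LIMSEQ_le_const) (use le in auto)
  then have "N \<in> null_sets lebesgue" by auto
  then show ?thesis
    by (rule AE_I') (auto simp: N_def not_less top_unique)
qed

text \<open>A geometric sum is comparable to its largest term, here one that is still below \<open>v\<close> to the
  power \<open>e\<close>.\<close>

lemma sum_truncated_geometric_le:
  fixes e \<alpha> v :: real
  assumes e: "0 < e" and \<alpha>: "0 < \<alpha>" and v: "0 \<le> v"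
  shows "(\<Sum>k<N. if \<alpha> * 2 ^ k < v then (\<alpha> * 2 ^ k) powr e else 0)
    \<le> 2 powr e / (2 powr e - 1) * v powr e"
proof (induction N)
  case 0
  have "1 < 2 powr e" using e by simp
  then show ?case by simp
next
  case (Suc N)
  define \<rho> where "\<rho> = (2::real) powr e"
  have \<rho>: "1 < \<rho>" using e by (simp add: \<rho>_def)
  show ?case
  proof (cases "\<alpha> * 2 ^ N < v")
    case False
    then show ?thesis using Suc by simp
  next
    case True
    have b: "(\<alpha> * 2 ^ k) powr e = \<alpha> powr e * \<rho> ^ k" for k
      unfolding \<rho>_def using \<alpha>
      by (simp add: powr_mult powr_realpow[symmetric] powr_powr mult.commute)
    have "(\<Sum>k<Suc N. if \<alpha> * 2 ^ k < v then (\<alpha> * 2 ^ k) powr e else 0)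
        \<le> (\<Sum>k<Suc N. \<alpha> powr e * \<rho> ^ k)"
      unfolding b using \<rho> by (intro sum_mono) simp
    also have "\<dots> = \<alpha> powr e * ((\<rho> ^ Suc N - 1) / (\<rho> - 1))"
      using \<rho> by (simp only: sum_distrib_left[symmetric] geometric_sum)
    also have "\<dots> \<le> \<alpha> powr e * (\<rho> ^ Suc N / (\<rho> - 1))"
      using \<rho> by (intro mult_left_mono divide_right_mono) auto
    also have "\<dots> = \<rho> / (\<rho> - 1) * (\<alpha> * 2 ^ N) powr e"
      unfolding b by simp
    also have "\<dots> \<le> \<rho> / (\<rho> - 1) * v powr e"
      using \<rho> True \<alpha> e by (intro mult_left_mono powr_mono2) auto
    finally show ?thesis unfolding \<rho>_def .
  qed
qed

text \<open>A discrete layer-cake formula. The levels start at \<open>\<alpha>\<close>, at the price of the first summand;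
  this loses nothing on a set of finite measure and leaves a series over the natural numbers.\<close>

lemma dyadic_layer_bound:
  fixes s \<alpha> m :: real
  assumes s: "0 < s" and \<alpha>: "0 < \<alpha>" and m: "0 \<le> m"
  shows "ennreal (m powr s) \<le> ennreal ((2 * \<alpha>) powr s)
    + (\<Sum>k. ennreal ((4 * (\<alpha> * 2 ^ k)) powr s) * of_bool (2 * (\<alpha> * 2 ^ k) < m))"
proof (cases "m \<le> 2 * \<alpha>")
  case True
  then have "m powr s \<le> (2 * \<alpha>) powr s" using m s by (intro powr_mono2) auto
  then show ?thesis by (intro add_increasing2 ennreal_leI) auto
next
  case False
  have "\<exists>j. m \<le> 2 * (\<alpha> * 2 ^ j)"
  proof -
    obtain j where "m / (2 * \<alpha>) < 2 ^ j" using real_arch_pow[of 2 "m / (2 * \<alpha>)"] by auto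
    then show ?thesis using \<alpha> by (intro exI[of _ j]) (auto simp: field_simps)
  qed
  then have L: "m \<le> 2 * (\<alpha> * 2 ^ (LEAST j. m \<le> 2 * (\<alpha> * 2 ^ j)))" by (rule LeastI_ex)
  moreover obtain k where k: "(LEAST j. m \<le> 2 * (\<alpha> * 2 ^ j)) = Suc k"
  proof (cases "LEAST j. m \<le> 2 * (\<alpha> * 2 ^ j)")
    case 0
    then show ?thesis using L False by simp
  qed
  ultimately have up: "m \<le> 4 * (\<alpha> * 2 ^ k)" by simp
  have lo: "2 * (\<alpha> * 2 ^ k) < m"
    using not_less_Least[of k "\<lambda>j. m \<le> 2 * (\<alpha> * 2 ^ j)"] k by auto
  let ?T = "\<lambda>k. ennreal ((4 * (\<alpha> * 2 ^ k)) powr s) * of_bool (2 * (\<alpha> * 2 ^ k) < m)"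
  have "ennreal (m powr s) \<le> ?T k"
    using lo up m s by (auto intro!: ennreal_leI powr_mono2)
  also have "?T k = sum ?T {k}" by simp
  also have "\<dots> \<le> (\<Sum>k. ?T k)" by (intro sum_le_suminf) auto
  finally show ?thesis by (intro add_increasing) auto
qed

text \<open>The weak type constant times the constant of \<open>sum_truncated_geometric_le\<close> for the exponent
  \<open>s - 1\<close>; it blows up as \<open>s\<close> tends to 1.\<close>

definition maximal_const :: "nat \<Rightarrow> real \<Rightarrow> real" where
  "maximal_const n s = 4 powr s * (5 * real n) ^ n * (2 powr (s - 1) / (2 powr (s - 1) - 1))"

lemma maximal_const_nonneg: "1 < s \<Longrightarrow> 0 \<le> maximal_const n s"
  unfolding maximal_const_def
  by (intro mult_nonneg_nonneg divide_nonneg_nonneg) (auto simp: ge_one_powr_ge_zero)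

text \<open>The Marcinkiewicz interpolation argument between the weak type estimate and the trivial bound
  in \<open>L\<^sup>\<infinity>\<close>: the truncated weak type estimate is summed over the dyadic levels, and interchanging sum
  and integral leaves a truncated geometric series at each point.\<close>

lemma HL_maximal_strong_type_local:
  fixes f :: "real^'n \<Rightarrow> real"
  assumes f [measurable]: "f \<in> borel_measurable lebesgue" and s: "1 < s" and \<alpha>: "0 < \<alpha>"
    and A [measurable]: "A \<in> sets lebesgue"
  shows "(\<integral>\<^sup>+ x \<in> A. ennreal (enn2real (HL_maximal f x) powr s) \<partial>lebesgue)
    \<le> ennreal ((2 * \<alpha>) powr s) * emeasure lebesgue A
      + ennreal (maximal_const CARD('n) s) * (\<integral>\<^sup>+ x. ennreal (\<bar>f x\<bar> powr s) \<partial>lebesgue)"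
proof -
  define n where "n = CARD('n)"
  define S where "S = (\<lambda>k. {x. ennreal (2 * (\<alpha> * 2 ^ k)) < HL_maximal f x})"
  have S [measurable]: "S k \<in> sets lebesgue" for k
    unfolding S_def using open_superlevel_HL_maximal[of "2 * (\<alpha> * 2 ^ k)" f] \<alpha> by auto
  define c where "c = (\<lambda>k. (4 * (\<alpha> * 2 ^ k)) powr s)"
  define \<phi> where "\<phi> = (\<lambda>k x. if \<alpha> * 2 ^ k < \<bar>f x\<bar> then \<bar>f x\<bar> else 0)"
  have [measurable]: "\<phi> k \<in> borel_measurable lebesgue" for k unfolding \<phi>_def by measurable
  have pt: "ennreal (enn2real (HL_maximal f x) powr s) * indicator A x
      \<le> ennreal ((2 * \<alpha>) powr s) * indicator A x + (\<Sum>k. ennreal (c k) * indicator (S k) x)" for x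
  proof -
    have "ennreal (enn2real (HL_maximal f x) powr s) \<le> ennreal ((2 * \<alpha>) powr s)
       + (\<Sum>k. ennreal ((4 * (\<alpha> * 2 ^ k)) powr s) * of_bool (2 * (\<alpha> * 2 ^ k) < enn2real (HL_maximal f x)))"
      using s \<alpha> by (intro dyadic_layer_bound) auto
    also have "\<dots> \<le> ennreal ((2 * \<alpha>) powr s) + (\<Sum>k. ennreal (c k) * indicator (S k) x)"
    proof (intro add_left_mono suminf_le)
      fix k
      have "x \<in> S k" if "2 * (\<alpha> * 2 ^ k) < enn2real (HL_maximal f x)"
        using that \<alpha> unfolding S_def
        by (cases "HL_maximal f x") (auto simp: ennreal_less_iff)
      then show "ennreal ((4 * (\<alpha> * 2 ^ k)) powr s) * of_bool (2 * (\<alpha> * 2 ^ k) < enn2real (HL_maximal f x))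
          \<le> ennreal (c k) * indicator (S k) x"
        by (auto simp: c_def)
    qed auto
    finally show ?thesis by (auto simp: indicator_def)
  qed
  have "(\<integral>\<^sup>+ x \<in> A. ennreal (enn2real (HL_maximal f x) powr s) \<partial>lebesgue)
      \<le> (\<integral>\<^sup>+ x. ennreal ((2 * \<alpha>) powr s) * indicator A x + (\<Sum>k. ennreal (c k) * indicator (S k) x) \<partial>lebesgue)"
    by (intro nn_integral_mono pt)
  also have "\<dots> = ennreal ((2 * \<alpha>) powr s) * emeasure lebesgue A
      + (\<Sum>k. ennreal (c k) * emeasure lebesgue (S k))"
    by (subst nn_integral_add) (auto simp: nn_integral_suminf nn_integral_cmult_indicator)
  also have "(\<Sum>k. ennreal (c k) * emeasure lebesgue (S k))
      \<le> (\<Sum>k. \<integral>\<^sup>+ x. ennreal (c k * ((5 * real n) ^ n / (\<alpha> * 2 ^ k))) * ennreal (\<phi> k x) \<partial>lebesgue)"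
  proof (intro suminf_le)
    fix k
    have "emeasure lebesgue (S k) \<le> ennreal ((5 * real n) ^ n / (\<alpha> * 2 ^ k)) * (\<integral>\<^sup>+ x. ennreal (\<phi> k x) \<partial>lebesgue)"
      unfolding S_def \<phi>_def n_def by (rule HL_maximal_weak_type_truncated) (use \<alpha> in auto)
    then have "ennreal (c k) * emeasure lebesgue (S k)
       \<le> ennreal (c k) * (ennreal ((5 * real n) ^ n / (\<alpha> * 2 ^ k)) * (\<integral>\<^sup>+ x. ennreal (\<phi> k x) \<partial>lebesgue))"
      by (rule mult_left_mono) auto
    also have "\<dots> = ennreal (c k * ((5 * real n) ^ n / (\<alpha> * 2 ^ k))) * (\<integral>\<^sup>+ x. ennreal (\<phi> k x) \<partial>lebesgue)"
      using \<alpha> by (subst ennreal_mult) (auto simp: c_def mult.assoc)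
    also have "\<dots> = (\<integral>\<^sup>+ x. ennreal (c k * ((5 * real n) ^ n / (\<alpha> * 2 ^ k))) * ennreal (\<phi> k x) \<partial>lebesgue)"
      by (rule nn_integral_cmult[symmetric]) measurable
    finally show "ennreal (c k) * emeasure lebesgue (S k) \<le> \<dots>" .
  qed auto
  also have "\<dots> = (\<integral>\<^sup>+ x. (\<Sum>k. ennreal (c k * ((5 * real n) ^ n / (\<alpha> * 2 ^ k))) * ennreal (\<phi> k x)) \<partial>lebesgue)"
    by (rule nn_integral_suminf[symmetric]) measurable
  also have "\<dots> \<le> (\<integral>\<^sup>+ x. ennreal (maximal_const n s) * ennreal (\<bar>f x\<bar> powr s) \<partial>lebesgue)"
  proof (intro nn_integral_mono)
    fix x
    let ?v = "\<bar>f x\<bar>"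
    \<comment> \<open>Each term is \<open>\<bar>f x\<bar>\<close> times a term of the geometric series with exponent \<open>s - 1\<close>.\<close>
    have trm: "c k * ((5 * real n) ^ n / (\<alpha> * 2 ^ k)) * \<phi> k x
        = 4 powr s * (5 * real n) ^ n * ?v * (if \<alpha> * 2 ^ k < ?v then (\<alpha> * 2 ^ k) powr (s - 1) else 0)" for k
    proof -
      have "c k = 4 powr s * (\<alpha> * 2 ^ k) powr s"
        unfolding c_def by (rule powr_mult)
      also have "(\<alpha> * 2 ^ k) powr s = (\<alpha> * 2 ^ k) powr (s - 1) * (\<alpha> * 2 ^ k)"
        using \<alpha> powr_mult_base[of "\<alpha> * 2 ^ k" "s - 1"] by (simp add: mult.commute)
      finally have "c k = 4 powr s * ((\<alpha> * 2 ^ k) powr (s - 1) * (\<alpha> * 2 ^ k))" .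
      then show ?thesis using \<alpha> by (simp add: \<phi>_def)
    qed
    have "(\<Sum>k. ennreal (c k * ((5 * real n) ^ n / (\<alpha> * 2 ^ k))) * ennreal (\<phi> k x))
        = (\<Sum>k. ennreal (c k * ((5 * real n) ^ n / (\<alpha> * 2 ^ k)) * \<phi> k x))"
      using \<alpha> by (intro suminf_cong ennreal_mult[symmetric]) (auto simp: c_def \<phi>_def)
    also have "\<dots> \<le> ennreal (maximal_const n s * ?v powr s)"
    proof (rule suminf_le_const)
      fix N
      have "(\<Sum>k<N. ennreal (c k * ((5 * real n) ^ n / (\<alpha> * 2 ^ k)) * \<phi> k x))
          = ennreal (\<Sum>k<N. c k * ((5 * real n) ^ n / (\<alpha> * 2 ^ k)) * \<phi> k x)"
        using \<alpha> by (intro sum_ennreal) (auto simp: c_def \<phi>_def)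
      also have "\<dots> \<le> ennreal (maximal_const n s * ?v powr s)"
      proof (rule ennreal_leI)
        have "(\<Sum>k<N. c k * ((5 * real n) ^ n / (\<alpha> * 2 ^ k)) * \<phi> k x)
          = 4 powr s * (5 * real n) ^ n * ?v * (\<Sum>k<N. if \<alpha> * 2 ^ k < ?v then (\<alpha> * 2 ^ k) powr (s - 1) else 0)"
          unfolding trm by (simp only: sum_distrib_left)
        also have "\<dots> \<le> 4 powr s * (5 * real n) ^ n * ?v *
            (2 powr (s - 1) / (2 powr (s - 1) - 1) * ?v powr (s - 1))"
          using s \<alpha> by (intro mult_left_mono sum_truncated_geometric_le) auto
        also have "\<dots> = maximal_const n s * (?v * ?v powr (s - 1))"
          unfolding maximal_const_def by (simp only: mult_ac)
        also have "?v * ?v powr (s - 1) = ?v powr s"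
          by (subst powr_mult_base) auto
        finally show "(\<Sum>k<N. c k * ((5 * real n) ^ n / (\<alpha> * 2 ^ k)) * \<phi> k x)
          \<le> maximal_const n s * ?v powr s" .
      qed
      finally show "(\<Sum>k<N. ennreal (c k * ((5 * real n) ^ n / (\<alpha> * 2 ^ k)) * \<phi> k x))
        \<le> ennreal (maximal_const n s * ?v powr s)" .
    qed auto
    also have "\<dots> = ennreal (maximal_const n s) * ennreal (\<bar>f x\<bar> powr s)"
      using maximal_const_nonneg[OF s] by (intro ennreal_mult) auto
    finally show "(\<Sum>k. ennreal (c k * ((5 * real n) ^ n / (\<alpha> * 2 ^ k))) * ennreal (\<phi> k x))
      \<le> ennreal (maximal_const n s) * ennreal (\<bar>f x\<bar> powr s)" .
  qed
  also have "\<dots> = ennreal (maximal_const n s) * (\<integral>\<^sup>+ x. ennreal (\<bar>f x\<bar> powr s) \<partial>lebesgue)"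
    by (rule nn_integral_cmult) measurable
  finally show ?thesis by (simp add: n_def add_left_mono)
qed


section \<open>Weights\<close>

lemma weight_cube_set_integrable:
  "weight w \<Longrightarrow> set_integrable lebesgue (cube c l) w"
  unfolding weight_def locally_integrable_def by simp

text \<open>A weight is the pointwise limit of its restrictions to an exhausting sequence of cubes.\<close>

lemma weight_measurable:
  fixes w :: "real^'n \<Rightarrow> real"
  assumes "weight w"
  shows "w \<in> borel_measurable lebesgue"
proof -
  have U: "(\<Union>k. cube 0 (real k)) = (UNIV :: (real^'n) set)"
  proof -
    have "x \<in> (\<Union>k. cube 0 (real k))" for x :: "real^'n"
    proof -
      obtain k where k: "2 * norm x \<le> real k" using real_arch_simple by blast
      then have "x \<in> cube 0 (real k)" by (intro mem_cube_of_norm_le) simp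
      then show ?thesis by blast
    qed
    then show ?thesis by blast
  qed
  have "set_borel_measurable lebesgue (cube 0 (real k)) w" for k
    using weight_cube_set_integrable[OF assms, of 0 "real k"]
    unfolding set_integrable_def set_borel_measurable_def by (rule borel_measurable_integrable)
  then have m: "(\<lambda>x. indicator (cube 0 (real k)) x *\<^sub>R w x) \<in> borel_measurable lebesgue" for k
    unfolding set_borel_measurable_def .
  show ?thesis
  proof (rule borel_measurable_LIMSEQ_real)
    show "(\<lambda>x. indicator (cube 0 (real k)) x *\<^sub>R w x) \<in> borel_measurable lebesgue" for k by (rule m)
    fix x :: "real^'n"
    obtain k where k: "x \<in> cube 0 (real k)" using U by blast
    have "x \<in> cube 0 (real j)" if "k \<le> j" for j
      using k cube_mono[of 0 "real j" 0 "real k"] that by (auto simp: subset_iff)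
    then have "eventually (\<lambda>j. indicator (cube 0 (real j)) x *\<^sub>R w x = w x) sequentially"
      unfolding eventually_sequentially by (intro exI[of _ k]) (simp add: indicator_def)
    then show "(\<lambda>j. indicator (cube 0 (real j)) x *\<^sub>R w x) \<longlonglongrightarrow> w x"
      by (rule tendsto_eventually)
  qed
qed

lemma nn_integral_weight_cube:
  assumes "weight w"
  shows "(\<integral>\<^sup>+ x \<in> cube c l. ennreal (w x) \<partial>lebesgue) = ennreal (wmeas w (cube c l))"
proof -
  have i: "integrable lebesgue (\<lambda>x. indicator (cube c l) x *\<^sub>R w x)"
    using weight_cube_set_integrable[OF assms, of c l] unfolding set_integrable_def .
  have "(\<integral>\<^sup>+ x. ennreal (indicator (cube c l) x *\<^sub>R w x) \<partial>lebesgue) = ennreal (wmeas w (cube c l))"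
    unfolding wmeas_def set_lebesgue_integral_def
    by (rule nn_integral_eq_integral[OF i]) (use assms in \<open>auto simp: weight_def indicator_def\<close>)
  moreover have "(\<lambda>x. ennreal (indicator (cube c l) x *\<^sub>R w x)) = (\<lambda>x. ennreal (w x) * indicator (cube c l) x)"
    by (auto simp: indicator_def)
  ultimately show ?thesis by (simp only:)
qed

lemma wmeas_nonneg: "weight w \<Longrightarrow> 0 \<le> wmeas w E"
  unfolding wmeas_def weight_def set_lebesgue_integral_def by (rule Bochner_Integration.integral_nonneg) auto

lemma wmeas_mono:
  assumes w: "weight w" and sub: "cube c l \<subseteq> cube c' l'"
  shows "wmeas w (cube c l) \<le> wmeas w (cube c' l')"
proof -
  have "ennreal (wmeas w (cube c l)) \<le> ennreal (wmeas w (cube c' l'))"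
    unfolding nn_integral_weight_cube[OF w, symmetric]
    using sub by (intro nn_integral_mono) (auto simp: indicator_def)
  then show ?thesis using wmeas_nonneg[OF w] by simp
qed

text \<open>Replacing \<open>C\<close> by \<open>max 1 C\<close> is harmless because \<open>w\<close> is nonnegative; it makes divisions by \<open>C\<close> safe.\<close>

lemma D_class_bound:
  fixes w :: "real^'n \<Rightarrow> real"
  assumes "w \<in> D_class q"
  obtains C where "1 \<le> C" "\<And>c l t. 0 < l \<Longrightarrow> 1 < t \<Longrightarrow>
     wmeas w (cube c (t * l)) \<le> C * t powr (real CARD('n) * q) * wmeas w (cube c l)"
proof -
  have w: "weight w" using assms by (simp add: D_class_def)
  obtain C where C: "\<And>c l t. 0 < l \<Longrightarrow> 1 < t \<Longrightarrow>
     wmeas w (cube c (t * l)) \<le> C * t powr (real CARD('n) * q) * wmeas w (cube c l)"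
    using assms by (auto simp: D_class_def)
  show ?thesis
  proof (rule that[of "max 1 C"])
    fix c :: "real^'n" and l t :: real assume "0 < l" "1 < t"
    note C[OF this, of c]
    also have "C * t powr (real CARD('n) * q) * wmeas w (cube c l)
        \<le> max 1 C * t powr (real CARD('n) * q) * wmeas w (cube c l)"
      by (intro mult_right_mono wmeas_nonneg w) auto
    finally show "wmeas w (cube c (t * l)) \<le> max 1 C * t powr (real CARD('n) * q) * wmeas w (cube c l)" .
  qed simp
qed

text \<open>Some dilate of any given cube contains one of the cubes of positive mass that \<open>P_class\<close>
  provides, and doubling carries the positivity back to the given cube.\<close>

lemma wmeas_cube_pos:
  fixes w :: "real^'n \<Rightarrow> real"
  assumes D: "w \<in> D_class q" and P: "w \<in> P_class" and l: "0 < l"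
  shows "0 < wmeas w (cube c l)"
proof -
  have w: "weight w" using D by (simp add: D_class_def)
  obtain c0 l0 where c0: "0 < l0" "0 < wmeas w (cube c0 l0)"
    using P unfolding P_class_def by blast
  obtain C where C: "1 \<le> C" "\<And>c l t. 0 < l \<Longrightarrow> 1 < t \<Longrightarrow>
     wmeas w (cube c (t * l)) \<le> C * t powr (real CARD('n) * q) * wmeas w (cube c l)"
    using D_class_bound[OF D] by blast
  define T where "T = max (2 * l) (2 * norm (c0 - c) + l0)"
  have T: "2 * norm (c0 - c) + l0 \<le> T" by (simp add: T_def)
  have "cube c0 l0 \<subseteq> cube c T"
  proof (rule cube_mono)
    fix i show "c $ i - T / 2 \<le> c0 $ i - l0 / 2 \<and> c0 $ i + l0 / 2 \<le> c $ i + T / 2"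
      using component_le_norm_cart[of "c0 - c" i] T unfolding vector_minus_component by arith
  qed
  then have "wmeas w (cube c0 l0) \<le> wmeas w (cube c T)" by (rule wmeas_mono[OF w])
  also have "\<dots> = wmeas w (cube c (T / l * l))" using l by simp
  also have "\<dots> \<le> C * (T / l) powr (real CARD('n) * q) * wmeas w (cube c l)"
    using l by (intro C(2)) (auto simp: T_def pos_less_divide_eq less_max_iff_disj)
  finally have "0 < C * (T / l) powr (real CARD('n) * q) * wmeas w (cube c l)" using c0(2) by simp
  moreover have "0 \<le> C * (T / l) powr (real CARD('n) * q)" using C(1) by (intro mult_nonneg_nonneg) auto
  ultimately show ?thesis using zero_less_mult_pos wmeas_nonneg[OF w, of "cube c l"]
    by (metis less_eq_real_def mult_zero_right)
qed

section \<open>Blocks\<close>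

text \<open>Functions on \<open>cube c l\<close> whose mean of order \<open>s\<close> is at most \<open>\<alpha>\<close>. Blocks are the case where \<open>\<alpha>\<close>
  is given by the weight. Keeping \<open>\<alpha>\<close> free separates the estimates for the maximal function, where no
  weight occurs, from the comparison of heights on different cubes. For \<open>s < \<infinity>\<close> the condition is
  stated with the nonnegative integral, so that integrability is implied by the bound.\<close>

definition Ls_bounded :: "ennreal \<Rightarrow> real^'n \<Rightarrow> real \<Rightarrow> real \<Rightarrow> (real^'n \<Rightarrow> real) \<Rightarrow> bool" where
  "Ls_bounded s c l \<alpha> a \<longleftrightarrow> a \<in> borel_measurable lebesgue \<and> (\<forall>x. x \<notin> cube c l \<longrightarrow> a x = 0) \<and>
     (if s = \<infinity> then AE x in lebesgue. \<bar>a x\<bar> \<le> \<alpha>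
      else (\<integral>\<^sup>+ x. ennreal (\<bar>a x\<bar> powr enn2real s) \<partial>lebesgue) \<le> ennreal (l ^ CARD('n) * \<alpha> powr enn2real s))"

lemma Ls_bounded_measurable: "Ls_bounded s c l \<alpha> a \<Longrightarrow> a \<in> borel_measurable lebesgue"
  and Ls_bounded_outside: "Ls_bounded s c l \<alpha> a \<Longrightarrow> x \<notin> cube c l \<Longrightarrow> a x = 0"
  unfolding Ls_bounded_def by blast+

lemma powr_inverse_le_iff:
  fixes X Y \<sigma> :: real
  assumes "0 \<le> X" "0 \<le> Y" "0 < \<sigma>"
  shows "X powr (1 / \<sigma>) \<le> Y \<longleftrightarrow> X \<le> Y powr \<sigma>"
proof
  assume "X powr (1 / \<sigma>) \<le> Y"
  then have "(X powr (1 / \<sigma>)) powr \<sigma> \<le> Y powr \<sigma>" using assms by (intro powr_mono2) auto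
  then show "X \<le> Y powr \<sigma>" using assms by (simp add: powr_powr)
next
  assume "X \<le> Y powr \<sigma>"
  then have "X powr (1 / \<sigma>) \<le> (Y powr \<sigma>) powr (1 / \<sigma>)" using assms by (intro powr_mono2) auto
  then show "X powr (1 / \<sigma>) \<le> Y" using assms by (simp add: powr_powr)
qed

lemma Ls_bounded_iff_Lp_norm:
  fixes a :: "real^'n \<Rightarrow> real"
  assumes s: "1 < s" and l: "0 < l" and \<alpha>: "0 < \<alpha>"
  shows "Ls_bounded s c l \<alpha> a \<longleftrightarrow> (\<forall>x. x \<notin> cube c l \<longrightarrow> a x = 0) \<and> a \<in> Lp_space lebesgue s \<and>
     Lp_norm lebesgue s a \<le> measure lebesgue (cube c l) powr enn2real (1 / s) * \<alpha>"
proof (cases "a \<in> borel_measurable lebesgue")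
  case False
  then show ?thesis by (simp add: Ls_bounded_def Lp_space_def)
next
  case True
  note [measurable] = True
  have ln: "0 < l ^ CARD('n)" using l by simp
  have meas: "measure lebesgue (cube c l) = l ^ CARD('n)" using l by (intro measure_cube) auto
  show ?thesis
  proof (cases s)
    case top
    let ?e = "esssup lebesgue (\<lambda>x. ennreal \<bar>a x\<bar>)"
    have "(AE x in lebesgue. \<bar>a x\<bar> \<le> \<alpha>) \<longleftrightarrow> ?e \<le> ennreal \<alpha>"
    proof
      assume "AE x in lebesgue. \<bar>a x\<bar> \<le> \<alpha>"
      then have "AE x in lebesgue. ennreal \<bar>a x\<bar> \<le> ennreal \<alpha>" by eventually_elim (rule ennreal_leI)
      then show "?e \<le> ennreal \<alpha>" by (intro esssup_I) measurable
    next
      assume e: "?e \<le> ennreal \<alpha>"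
      show "AE x in lebesgue. \<bar>a x\<bar> \<le> \<alpha>"
        using esssup_AE[where f = "\<lambda>x. ennreal \<bar>a x\<bar>" and M = lebesgue]
      proof eventually_elim
        case (elim x)
        then have "ennreal \<bar>a x\<bar> \<le> ennreal \<alpha>" using e by (rule order_trans)
        then show ?case using \<alpha> by simp
      qed
    qed
    also have "\<dots> \<longleftrightarrow> ?e < \<infinity> \<and> enn2real ?e \<le> \<alpha>"
      using \<alpha> by (cases ?e) (auto simp: top_unique)
    finally show ?thesis
      unfolding Ls_bounded_def Lp_space_def Lp_norm_def meas top using True l by simp
  next
    case (real \<sigma>)
    have \<sigma>: "1 < \<sigma>" using s real by simp
    have r: "enn2real s = \<sigma>" using real by simp
    have r1: "enn2real (1 / s) = 1 / \<sigma>"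
    proof -
      have "1 / s = ennreal (1 / \<sigma>)" using divide_ennreal[of 1 \<sigma>] \<sigma> real by simp
      then show ?thesis using \<sigma> by simp
    qed
    have sinf: "s \<noteq> \<infinity>" using real by simp
    let ?g = "\<lambda>x. \<bar>a x\<bar> powr \<sigma>"
    have B: "0 \<le> l ^ CARD('n) * \<alpha> powr \<sigma>" using ln by simp
    have eq: "((l ^ CARD('n)) powr (1 / \<sigma>) * \<alpha>) powr \<sigma> = l ^ CARD('n) * \<alpha> powr \<sigma>"
      using \<sigma> ln by (subst powr_mult) (simp add: powr_powr)
    have "(\<integral>\<^sup>+ x. ennreal (?g x) \<partial>lebesgue) \<le> ennreal (l ^ CARD('n) * \<alpha> powr \<sigma>) \<longleftrightarrow>
      integrable lebesgue ?g \<and> (LINT x|lebesgue. ?g x) \<le> l ^ CARD('n) * \<alpha> powr \<sigma>"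
    proof
      assume b: "(\<integral>\<^sup>+ x. ennreal (?g x) \<partial>lebesgue) \<le> ennreal (l ^ CARD('n) * \<alpha> powr \<sigma>)"
      have i: "integrable lebesgue ?g"
      proof (rule integrableI_bounded)
        show "(\<integral>\<^sup>+ x. ennreal (norm (?g x)) \<partial>lebesgue) < \<infinity>" using b by (simp add: le_less_trans)
      qed measurable
      then have "(\<integral>\<^sup>+ x. ennreal (?g x) \<partial>lebesgue) = ennreal (LINT x|lebesgue. ?g x)"
        by (rule nn_integral_eq_integral) auto
      then show "integrable lebesgue ?g \<and> (LINT x|lebesgue. ?g x) \<le> l ^ CARD('n) * \<alpha> powr \<sigma>"
        using b i B by simp
    next
      assume b: "integrable lebesgue ?g \<and> (LINT x|lebesgue. ?g x) \<le> l ^ CARD('n) * \<alpha> powr \<sigma>"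
      then have "(\<integral>\<^sup>+ x. ennreal (?g x) \<partial>lebesgue) = ennreal (LINT x|lebesgue. ?g x)"
        by (intro nn_integral_eq_integral) auto
      then show "(\<integral>\<^sup>+ x. ennreal (?g x) \<partial>lebesgue) \<le> ennreal (l ^ CARD('n) * \<alpha> powr \<sigma>)"
        using b by (simp add: ennreal_leI)
    qed
    also have "(LINT x|lebesgue. ?g x) \<le> l ^ CARD('n) * \<alpha> powr \<sigma> \<longleftrightarrow>
       (LINT x|lebesgue. ?g x) powr (1 / \<sigma>) \<le> (l ^ CARD('n)) powr (1 / \<sigma>) * \<alpha>"
      unfolding eq[symmetric] using \<sigma> \<alpha> by (intro powr_inverse_le_iff[symmetric]) auto
    finally show ?thesis
      unfolding Ls_bounded_def Lp_space_def Lp_norm_def meas r r1 using True sinf by simp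
  qed
qed

lemma is_block_iff_Ls_bounded:
  fixes w :: "real^'n \<Rightarrow> real"
  assumes "1 < s" and pos: "\<And>c l. 0 < l \<Longrightarrow> 0 < wmeas w (cube c l)"
  shows "is_block p s w a \<longleftrightarrow> (\<exists>c l. 0 < l \<and> Ls_bounded s c l (wmeas w (cube c l) powr (- 1 / p)) a)"
proof -
  have "0 < wmeas w (cube c l) powr (- 1 / p)" if "0 < l" for c l using pos[OF that, of c] by simp
  then show ?thesis
    unfolding is_block_def using assms(1)
    by (intro ex_cong1 conj_cong refl) (simp only: Ls_bounded_iff_Lp_norm)
qed

lemma Ls_bounded_mono:
  assumes a: "Ls_bounded s c l \<alpha> a" and b: "b \<in> borel_measurable lebesgue"
    and le: "\<And>x. \<bar>b x\<bar> \<le> \<bar>a x\<bar>" and \<alpha>: "0 \<le> \<alpha>" "\<alpha> \<le> \<beta>" and l: "0 \<le> l"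
  shows "Ls_bounded s c l \<beta> b"
  unfolding Ls_bounded_def
proof (intro conjI b allI impI)
  show "b x = 0" if "x \<notin> cube c l" for x
    using le[of x] Ls_bounded_outside[OF a that] by simp
  show "if s = \<infinity> then AE x in lebesgue. \<bar>b x\<bar> \<le> \<beta>
    else (\<integral>\<^sup>+ x. ennreal (\<bar>b x\<bar> powr enn2real s) \<partial>lebesgue) \<le> ennreal (l ^ CARD('a) * \<beta> powr enn2real s)"
  proof (cases "s = \<infinity>")
    case True
    have "AE x in lebesgue. \<bar>a x\<bar> \<le> \<alpha>" using a True by (simp add: Ls_bounded_def)
    then have "AE x in lebesgue. \<bar>b x\<bar> \<le> \<beta>"
    proof eventually_elim
      case (elim x)
      then show ?case using le[of x] \<alpha> by linarith
    qed
    then show ?thesis using True by simp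
  next
    case False
    have "(\<integral>\<^sup>+ x. ennreal (\<bar>b x\<bar> powr enn2real s) \<partial>lebesgue) \<le> (\<integral>\<^sup>+ x. ennreal (\<bar>a x\<bar> powr enn2real s) \<partial>lebesgue)"
      by (intro nn_integral_mono ennreal_leI powr_mono2 le) auto
    also have "\<dots> \<le> ennreal (l ^ CARD('a) * \<alpha> powr enn2real s)"
      using a False by (simp add: Ls_bounded_def)
    also have "\<dots> \<le> ennreal (l ^ CARD('a) * \<beta> powr enn2real s)"
      using \<alpha> l by (intro ennreal_leI mult_left_mono powr_mono2) auto
    finally show ?thesis using False by simp
  qed
qed

lemma Ls_bounded_scale:
  assumes a: "Ls_bounded s c l (\<mu> * \<alpha>) a" and \<mu>: "0 < \<mu>" and \<alpha>: "0 \<le> \<alpha>" and l: "0 \<le> l"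
  shows "Ls_bounded s c l \<alpha> (\<lambda>x. a x / \<mu>)"
  unfolding Ls_bounded_def
proof (intro conjI allI impI)
  note [measurable] = Ls_bounded_measurable[OF a]
  show "(\<lambda>x. a x / \<mu>) \<in> borel_measurable lebesgue" by measurable
  show "a x / \<mu> = 0" if "x \<notin> cube c l" for x
    using Ls_bounded_outside[OF a that] by simp
  show "if s = \<infinity> then AE x in lebesgue. \<bar>a x / \<mu>\<bar> \<le> \<alpha>
    else (\<integral>\<^sup>+ x. ennreal (\<bar>a x / \<mu>\<bar> powr enn2real s) \<partial>lebesgue) \<le> ennreal (l ^ CARD('a) * \<alpha> powr enn2real s)"
  proof (cases "s = \<infinity>")
    case True
    have "AE x in lebesgue. \<bar>a x\<bar> \<le> \<mu> * \<alpha>" using a True by (simp add: Ls_bounded_def)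
    then have "AE x in lebesgue. \<bar>a x / \<mu>\<bar> \<le> \<alpha>"
      by eventually_elim (use \<mu> in \<open>simp add: field_simps\<close>)
    then show ?thesis using True by simp
  next
    case False
    define \<sigma> where "\<sigma> = enn2real s"
    have "(\<integral>\<^sup>+ x. ennreal (\<bar>a x / \<mu>\<bar> powr \<sigma>) \<partial>lebesgue)
        = (\<integral>\<^sup>+ x. ennreal (1 / \<mu> powr \<sigma>) * ennreal (\<bar>a x\<bar> powr \<sigma>) \<partial>lebesgue)"
      using \<mu> by (intro nn_integral_cong) (simp add: abs_divide powr_divide ennreal_mult[symmetric])
    also have "\<dots> = ennreal (1 / \<mu> powr \<sigma>) * (\<integral>\<^sup>+ x. ennreal (\<bar>a x\<bar> powr \<sigma>) \<partial>lebesgue)"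
      by (rule nn_integral_cmult) measurable
    also have "\<dots> \<le> ennreal (1 / \<mu> powr \<sigma>) * ennreal (l ^ CARD('a) * (\<mu> * \<alpha>) powr \<sigma>)"
      using a False by (intro mult_left_mono) (auto simp: Ls_bounded_def \<sigma>_def)
    also have "\<dots> = ennreal (1 / \<mu> powr \<sigma> * (l ^ CARD('a) * (\<mu> * \<alpha>) powr \<sigma>))"
      using l by (intro ennreal_mult[symmetric]) auto
    also have "1 / \<mu> powr \<sigma> * (l ^ CARD('a) * (\<mu> * \<alpha>) powr \<sigma>) = l ^ CARD('a) * \<alpha> powr \<sigma>"
      using \<mu> by (simp add: powr_mult)
    finally show ?thesis using False by (simp add: \<sigma>_def)
  qed
qed

lemma nn_integral_const_on_cube:
  fixes c :: "real^'n"
  assumes "0 \<le> l" "0 \<le> B"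
  shows "(\<integral>\<^sup>+ x. ennreal B * indicator (cube c l) x \<partial>lebesgue) = ennreal (l ^ CARD('n) * B)"
proof -
  have "(\<integral>\<^sup>+ x. ennreal B * indicator (cube c l) x \<partial>lebesgue) = ennreal B * emeasure lebesgue (cube c l)"
    by (rule nn_integral_cmult_indicator) simp
  then show ?thesis
    unfolding emeasure_cube[OF assms(1)] using assms by (simp only: ennreal_mult mult.commute zero_le_power)
qed

text \<open>A bound by a constant on the cube gives the bound of order \<open>s\<close> for every \<open>s\<close>. In particular the
  pieces of a maximal function far from the cube are blocks for all exponents at once.\<close>

lemma Ls_bounded_of_bounded:
  assumes b: "b \<in> borel_measurable lebesgue" and out: "\<And>x. x \<notin> cube c l \<Longrightarrow> b x = 0"
    and le: "AE x in lebesgue. \<bar>b x\<bar> \<le> B" and B: "0 \<le> B" and l: "0 \<le> l"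
  shows "Ls_bounded s c l B b"
  unfolding Ls_bounded_def
proof (intro conjI b allI impI)
  show "b x = 0" if "x \<notin> cube c l" for x by (rule out[OF that])
  show "if s = \<infinity> then AE x in lebesgue. \<bar>b x\<bar> \<le> B
    else (\<integral>\<^sup>+ x. ennreal (\<bar>b x\<bar> powr enn2real s) \<partial>lebesgue) \<le> ennreal (l ^ CARD('a) * B powr enn2real s)"
  proof (cases "s = \<infinity>")
    case False
    have "AE x in lebesgue. ennreal (\<bar>b x\<bar> powr enn2real s) \<le> ennreal (B powr enn2real s) * indicator (cube c l) x"
      using le
    proof eventually_elim
      case (elim x)
      show ?case
      proof (cases "x \<in> cube c l")
        case True
        then show ?thesis using elim by (auto intro!: ennreal_leI powr_mono2)
      qed (simp add: out)
    qed
    then have "(\<integral>\<^sup>+ x. ennreal (\<bar>b x\<bar> powr enn2real s) \<partial>lebesgue)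
        \<le> (\<integral>\<^sup>+ x. ennreal (B powr enn2real s) * indicator (cube c l) x \<partial>lebesgue)"
      by (rule nn_integral_mono_AE)
    also have "\<dots> = ennreal (l ^ CARD('a) * B powr enn2real s)"
      using l by (intro nn_integral_const_on_cube) auto
    finally show ?thesis using False by simp
  qed (use le in simp)
qed

lemma Ls_bounded_top_imp:
  assumes "Ls_bounded \<infinity> c l \<alpha> a" "0 \<le> \<alpha>" "0 \<le> l"
  shows "Ls_bounded s c l \<alpha> a"
  using assms by (intro Ls_bounded_of_bounded) (auto simp: Ls_bounded_def)

text \<open>Either \<open>t\<close> is below the threshold \<open>\<beta>\<close>, or one may trade factors of \<open>t\<close> for factors of \<open>\<beta>\<close>.
  Integrated with a well-chosen \<open>\<beta>\<close>, this replaces Hoelder's and Jensen's inequalities up to constants.\<close>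

lemma le_add_powr_mult_powr:
  fixes t \<beta> \<sigma> :: real
  assumes "0 \<le> t" "0 < \<beta>" "1 \<le> \<sigma>"
  shows "t \<le> \<beta> + \<beta> powr (1 - \<sigma>) * t powr \<sigma>"
proof (cases "t \<le> \<beta>")
  case True
  then show ?thesis by (simp add: add_increasing2)
next
  case False
  have "t = t powr (1 - \<sigma>) * t powr \<sigma>" using False assms by (simp add: powr_add[symmetric])
  also have "\<dots> \<le> \<beta> powr (1 - \<sigma>) * t powr \<sigma>"
    using False assms by (intro mult_right_mono powr_mono2') auto
  finally show ?thesis using assms by linarith
qed

text \<open>The threshold \<open>\<beta> = \<alpha>\<close> in \<open>le_add_powr_mult_powr\<close> balances the two terms; the case \<open>s = \<infinity>\<close>
  reduces to the exponent 2.\<close>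

lemma Ls_bounded_nn_integral_le:
  fixes a :: "real^'n \<Rightarrow> real"
  assumes a: "Ls_bounded s c l \<alpha> a" and s: "1 < s" and l: "0 < l" and \<alpha>: "0 < \<alpha>"
  shows "(\<integral>\<^sup>+ x. ennreal \<bar>a x\<bar> \<partial>lebesgue) \<le> ennreal (2 * l ^ CARD('n) * \<alpha>)"
proof -
  note [measurable] = Ls_bounded_measurable[OF a]
  have fin: ?thesis if fin: "1 < \<sigma>" and a: "Ls_bounded (ennreal \<sigma>) c l \<alpha> a" for \<sigma>
  proof -
    have "(\<integral>\<^sup>+ x. ennreal \<bar>a x\<bar> \<partial>lebesgue)
      \<le> (\<integral>\<^sup>+ x. ennreal \<alpha> * indicator (cube c l) x + ennreal (\<alpha> powr (1 - \<sigma>)) * ennreal (\<bar>a x\<bar> powr \<sigma>) \<partial>lebesgue)"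
    proof (intro nn_integral_mono)
      fix x
      show "ennreal \<bar>a x\<bar> \<le> ennreal \<alpha> * indicator (cube c l) x + ennreal (\<alpha> powr (1 - \<sigma>)) * ennreal (\<bar>a x\<bar> powr \<sigma>)"
      proof (cases "x \<in> cube c l")
        case True
        have "ennreal \<bar>a x\<bar> \<le> ennreal (\<alpha> + \<alpha> powr (1 - \<sigma>) * \<bar>a x\<bar> powr \<sigma>)"
          using \<alpha> fin by (intro ennreal_leI le_add_powr_mult_powr) auto
        then show ?thesis using True \<alpha> by (simp add: ennreal_mult)
      qed (simp add: Ls_bounded_outside[OF a])
    qed
    also have "\<dots> = (\<integral>\<^sup>+ x. ennreal \<alpha> * indicator (cube c l) x \<partial>lebesgue)
        + (\<integral>\<^sup>+ x. ennreal (\<alpha> powr (1 - \<sigma>)) * ennreal (\<bar>a x\<bar> powr \<sigma>) \<partial>lebesgue)"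
      by (rule nn_integral_add) measurable
    also have "(\<integral>\<^sup>+ x. ennreal \<alpha> * indicator (cube c l) x \<partial>lebesgue) = ennreal (l ^ CARD('n) * \<alpha>)"
      using l \<alpha> by (intro nn_integral_const_on_cube) auto
    also have "(\<integral>\<^sup>+ x. ennreal (\<alpha> powr (1 - \<sigma>)) * ennreal (\<bar>a x\<bar> powr \<sigma>) \<partial>lebesgue)
        = ennreal (\<alpha> powr (1 - \<sigma>)) * (\<integral>\<^sup>+ x. ennreal (\<bar>a x\<bar> powr \<sigma>) \<partial>lebesgue)"
      by (rule nn_integral_cmult) measurable
    also have "ennreal (l ^ CARD('n) * \<alpha>) + ennreal (\<alpha> powr (1 - \<sigma>)) * (\<integral>\<^sup>+ x. ennreal (\<bar>a x\<bar> powr \<sigma>) \<partial>lebesgue)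
        \<le> ennreal (l ^ CARD('n) * \<alpha>) + ennreal (\<alpha> powr (1 - \<sigma>)) * ennreal (l ^ CARD('n) * \<alpha> powr \<sigma>)"
      using a fin by (intro add_left_mono mult_left_mono) (auto simp: Ls_bounded_def)
    also have "\<dots> = ennreal (l ^ CARD('n) * \<alpha> + \<alpha> powr (1 - \<sigma>) * (l ^ CARD('n) * \<alpha> powr \<sigma>))"
      using l \<alpha> by (simp add: ennreal_mult)
    also have "\<alpha> powr (1 - \<sigma>) * (l ^ CARD('n) * \<alpha> powr \<sigma>) = l ^ CARD('n) * \<alpha>"
      using \<alpha> by (simp add: powr_add[symmetric])
    finally show ?thesis by (simp add: mult_ac)
  qed
  show ?thesis
  proof (cases s)
    case (real \<sigma>)
    then show ?thesis using s a by (intro fin[of \<sigma>]) auto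
  next
    case top
    have "Ls_bounded (ennreal 2) c l \<alpha> a"
      by (rule Ls_bounded_top_imp) (use a l \<alpha> top in auto)
    then show ?thesis by (rule fin[rotated]) simp
  qed
qed


section \<open>The maximal function of a block\<close>

text \<open>Taking successive differences of the dilates makes the \<open>0\<close>-th piece the full cube \<open>2Q\<close> and
  the others the annuli between consecutive dyadic dilates.\<close>

definition shell :: "real^'n \<Rightarrow> real \<Rightarrow> nat \<Rightarrow> (real^'n) set" where
  "shell c l = disjointed (\<lambda>j. cube c (2 ^ Suc j * l))"

lemma shell_subset: "shell c l j \<subseteq> cube c (2 ^ Suc j * l)"
  unfolding shell_def by (rule disjointed_subset)

lemma shell_sets [measurable]: "shell c l j \<in> sets lebesgue"
proof -
  have "range (disjointed (\<lambda>j. cube c (2 ^ Suc j * l))) \<subseteq> sets lebesgue"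
    by (rule sets.range_disjointed_sets) auto
  then show ?thesis unfolding shell_def by blast
qed

lemma shell_0: "shell c l 0 = cube c (2 * l)"
  unfolding shell_def by simp

lemma shell_Suc_outside: "x \<in> shell c l (Suc j) \<Longrightarrow> x \<notin> cube c (2 ^ Suc j * l)"
  unfolding shell_def disjointed_def by (auto dest: bspec[of _ _ j])

lemma suminf_indicator_shell:
  fixes c :: "real^'n"
  assumes l: "0 < l"
  shows "(\<Sum>j. indicator (shell c l j) x :: ennreal) = 1"
proof -
  obtain j where j: "2 * norm (x - c) / l \<le> 2 ^ Suc j"
  proof -
    obtain k where "2 * norm (x - c) / l < 2 ^ k" using real_arch_pow[of 2 "2 * norm (x - c) / l"] by auto
    also have "(2::real) ^ k \<le> 2 ^ Suc k" by simp
    finally show ?thesis using that by (meson less_imp_le)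
  qed
  then have n: "2 * norm (x - c) \<le> 2 ^ Suc j * l" using l by (simp add: pos_divide_le_eq)
  then have "x \<in> cube c (2 ^ Suc j * l)" by (rule mem_cube_of_norm_le)
  then have "x \<in> (\<Union>j. shell c l j)" unfolding shell_def UN_disjointed_eq by blast
  moreover have "(\<Sum>j. indicator (shell c l j) x :: ennreal) = indicator (\<Union>j. shell c l j) x"
    unfolding shell_def by (rule suminf_indicator[OF disjoint_family_disjointed])
  ultimately show ?thesis by simp
qed

text \<open>A cube through a point outside \<open>LQ\<close>, where \<open>L \<ge> 2\<close>, that also meets \<open>Q\<close> has edge length at
  least \<open>L / 4\<close> times that of \<open>Q\<close>, and a cube that does not meet \<open>Q\<close> has average \<open>0\<close>.\<close>

lemma HL_maximal_far:
  fixes a :: "real^'n \<Rightarrow> real"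
  assumes out: "\<And>y. y \<notin> cube c l \<Longrightarrow> a y = 0" and l: "0 < l"
    and I: "(\<integral>\<^sup>+ y. ennreal \<bar>a y\<bar> \<partial>lebesgue) \<le> ennreal I" "0 \<le> I"
    and x: "x \<notin> cube c (2 ^ Suc j * l)"
  shows "HL_maximal a x \<le> ennreal (4 ^ CARD('n) * I / (2 ^ Suc j * l) ^ CARD('n))"
proof (rule HL_maximal_leI)
  fix c' :: "real^'n" and l' :: real assume l': "0 < l'" and x': "x \<in> cube c' l'"
  define L where "L = 2 ^ Suc j * l"
  have L: "2 * l \<le> L" "0 < L" using l by (auto simp: L_def)
  show "(\<integral>\<^sup>+ y \<in> cube c' l'. ennreal \<bar>a y\<bar> \<partial>lebesgue)
     \<le> ennreal (l' ^ CARD('n)) * ennreal (4 ^ CARD('n) * I / (2 ^ Suc j * l) ^ CARD('n))"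
  proof (cases "cube c' l' \<inter> cube c l = {}")
    case True
    then have "(\<integral>\<^sup>+ y \<in> cube c' l'. ennreal \<bar>a y\<bar> \<partial>lebesgue) = (\<integral>\<^sup>+ y. 0 \<partial>(lebesgue :: (real^'n) measure))"
      using out by (intro nn_integral_cong) (auto simp: indicator_def)
    then show ?thesis by simp
  next
    case False
    then obtain y where y: "y \<in> cube c' l'" "y \<in> cube c l" by blast
    obtain i where i: "\<not> (c $ i - L / 2 \<le> x $ i \<and> x $ i \<le> c $ i + L / 2)"
      using x unfolding L_def[symmetric] mem_cube by blast
    have "L / 4 \<le> l'"
      using i y[unfolded mem_cube, THEN spec, of i] x'[unfolded mem_cube, THEN spec, of i] L by linarith
    then have "(L / 4) ^ CARD('n) \<le> l' ^ CARD('n)" using L by (intro power_mono) auto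
    then have le: "1 \<le> l' ^ CARD('n) * (4 ^ CARD('n) / L ^ CARD('n))"
      using L by (simp add: power_divide field_simps)
    have "(\<integral>\<^sup>+ y \<in> cube c' l'. ennreal \<bar>a y\<bar> \<partial>lebesgue) \<le> (\<integral>\<^sup>+ y. ennreal \<bar>a y\<bar> \<partial>lebesgue)"
      by (intro nn_integral_mono) (auto simp: indicator_def)
    also note I(1)
    also have "ennreal I \<le> ennreal (l' ^ CARD('n) * (4 ^ CARD('n) / L ^ CARD('n)) * I)"
      using mult_right_mono[OF le I(2)] by (intro ennreal_leI) simp
    also have "\<dots> = ennreal (l' ^ CARD('n) * (4 ^ CARD('n) * I / L ^ CARD('n)))"
      by (simp add: mult_ac)
    also have "\<dots> = ennreal (l' ^ CARD('n)) * ennreal (4 ^ CARD('n) * I / L ^ CARD('n))"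
      using l' L I(2) by (intro ennreal_mult) auto
    finally show ?thesis unfolding L_def .
  qed
qed

lemma HL_maximal_le_bound:
  fixes a :: "real^'n \<Rightarrow> real"
  assumes le: "AE x in lebesgue. \<bar>a x\<bar> \<le> B" and B: "0 \<le> B"
  shows "HL_maximal a x \<le> ennreal B"
proof (rule HL_maximal_leI)
  fix c :: "real^'n" and l :: real assume l: "0 < l"
  have "(\<integral>\<^sup>+ y \<in> cube c l. ennreal \<bar>a y\<bar> \<partial>lebesgue) \<le> (\<integral>\<^sup>+ y. ennreal B * indicator (cube c l) y \<partial>lebesgue)"
    by (rule nn_integral_mono_AE) (use le in eventually_elim, auto simp: indicator_def intro: ennreal_leI)
  also have "\<dots> = ennreal (l ^ CARD('n) * B)" using l B by (intro nn_integral_const_on_cube) auto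
  also have "\<dots> = ennreal (l ^ CARD('n)) * ennreal B" using l B by (intro ennreal_mult) auto
  finally show "(\<integral>\<^sup>+ y \<in> cube c l. ennreal \<bar>a y\<bar> \<partial>lebesgue) \<le> ennreal (l ^ CARD('n)) * ennreal B" .
qed

lemma enn2real_HL_measurable [measurable]:
  "(\<lambda>x. enn2real (HL_maximal a x)) \<in> borel_measurable lebesgue" for a :: "real^'n \<Rightarrow> real"
  by (rule measurable_compose[OF borel_measurable_HL_maximal_lebesgue]) simp

text \<open>The maximal theorem on \<open>2Q\<close>, with levels starting at \<open>\<alpha>\<close>. The constant \<open>B\<close> depends only on
  \<open>s\<close> and the dimension.\<close>

lemma Ls_bounded_maximal_near:
  fixes s :: ennreal
  assumes s: "1 < s"
  obtains B where "0 \<le> B" "\<And>(c :: real^'n) l \<alpha> a. 0 < l \<Longrightarrow> 0 < \<alpha> \<Longrightarrow> Ls_bounded s c l \<alpha> a \<Longrightarrow>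
    Ls_bounded s c (2 * l) (B * \<alpha>) (\<lambda>x. indicator (cube c (2 * l)) x * enn2real (HL_maximal a x))"
proof (cases s)
  case top
  show ?thesis
  proof (rule that[of 1])
    fix c :: "real^'n" and l \<alpha> :: real and a
    assume l: "0 < l" and \<alpha>: "0 < \<alpha>" and a: "Ls_bounded s c l \<alpha> a"
    have le: "AE x in lebesgue. \<bar>a x\<bar> \<le> \<alpha>" using a top by (simp add: Ls_bounded_def)
    have "enn2real (HL_maximal a x) \<le> \<alpha>" for x
      using HL_maximal_le_bound[OF le] \<alpha> by (intro enn2real_leI) auto
    then show "Ls_bounded s c (2 * l) (1 * \<alpha>) (\<lambda>x. indicator (cube c (2 * l)) x * enn2real (HL_maximal a x))"
      using l \<alpha> by (intro Ls_bounded_of_bounded AE_I2) (auto simp: indicator_def)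
  qed simp
next
  case (real \<sigma>)
  have \<sigma>: "1 < \<sigma>" "enn2real s = \<sigma>" "s \<noteq> \<infinity>" using s real by auto
  define K where "K = maximal_const CARD('n) \<sigma>"
  have K: "0 \<le> K" unfolding K_def by (rule maximal_const_nonneg[OF \<sigma>(1)])
  define B where "B = (2 powr \<sigma> + K) powr (1 / \<sigma>)"
  have B: "B powr \<sigma> = 2 powr \<sigma> + K"
    unfolding B_def using \<sigma> K by (simp add: powr_powr add_nonneg_nonneg)
  show ?thesis
  proof (rule that[of B])
    show "0 \<le> B" by (simp add: B_def)
    fix c :: "real^'n" and l \<alpha> :: real and a
    assume l: "0 < l" and \<alpha>: "0 < \<alpha>" and a: "Ls_bounded s c l \<alpha> a"
    note [measurable] = Ls_bounded_measurable[OF a]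
    let ?b = "\<lambda>x. indicator (cube c (2 * l)) x * enn2real (HL_maximal a x)"
    have "(\<integral>\<^sup>+ x. ennreal (\<bar>?b x\<bar> powr \<sigma>) \<partial>lebesgue)
       = (\<integral>\<^sup>+ x \<in> cube c (2 * l). ennreal (enn2real (HL_maximal a x) powr \<sigma>) \<partial>lebesgue)"
      by (intro nn_integral_cong) (auto simp: indicator_def)
    also have "\<dots> \<le> ennreal ((2 * \<alpha>) powr \<sigma>) * emeasure lebesgue (cube c (2 * l))
      + ennreal K * (\<integral>\<^sup>+ x. ennreal (\<bar>a x\<bar> powr \<sigma>) \<partial>lebesgue)"
      unfolding K_def by (rule HL_maximal_strong_type_local) (use \<sigma> \<alpha> in auto)
    also have "\<dots> \<le> ennreal ((2 * \<alpha>) powr \<sigma>) * ennreal ((2 * l) ^ CARD('n))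
      + ennreal K * ennreal ((2 * l) ^ CARD('n) * \<alpha> powr \<sigma>)"
    proof (intro add_mono mult_left_mono)
      show "emeasure lebesgue (cube c (2 * l)) \<le> ennreal ((2 * l) ^ CARD('n))"
        using l by (subst emeasure_cube) auto
      have "(\<integral>\<^sup>+ x. ennreal (\<bar>a x\<bar> powr \<sigma>) \<partial>lebesgue) \<le> ennreal (l ^ CARD('n) * \<alpha> powr \<sigma>)"
        using a \<sigma> by (simp add: Ls_bounded_def)
      also have "\<dots> \<le> ennreal ((2 * l) ^ CARD('n) * \<alpha> powr \<sigma>)"
        using l by (intro ennreal_leI mult_right_mono power_mono) auto
      finally show "(\<integral>\<^sup>+ x. ennreal (\<bar>a x\<bar> powr \<sigma>) \<partial>lebesgue) \<le> \<dots>" .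
    qed auto
    also have "\<dots> = ennreal ((2 * \<alpha>) powr \<sigma> * (2 * l) ^ CARD('n) + K * ((2 * l) ^ CARD('n) * \<alpha> powr \<sigma>))"
      using l K by (simp only: ennreal_mult'[symmetric] powr_ge_zero)
        (intro ennreal_plus[symmetric] mult_nonneg_nonneg, auto)
    also have "(2 * \<alpha>) powr \<sigma> * (2 * l) ^ CARD('n) + K * ((2 * l) ^ CARD('n) * \<alpha> powr \<sigma>)
        = (2 * l) ^ CARD('n) * (B * \<alpha>) powr \<sigma>"
      by (simp only: powr_mult B ring_distribs mult_ac)
    finally have int: "(\<integral>\<^sup>+ x. ennreal (\<bar>?b x\<bar> powr \<sigma>) \<partial>lebesgue) \<le> ennreal ((2 * l) ^ CARD('n) * (B * \<alpha>) powr \<sigma>)" .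
    have "?b \<in> borel_measurable lebesgue" by measurable
    with int show "Ls_bounded s c (2 * l) (B * \<alpha>) ?b"
      unfolding Ls_bounded_def \<sigma>(2) using \<sigma>(3) by simp
  qed
qed

text \<open>The decay in \<open>j\<close> has exponent \<open>n\<close>, the one of \<open>M\<close> applied to an integrable function at
  infinity; it is this decay that competes with the growth of \<open>w\<close>.\<close>

lemma Ls_bounded_maximal_shell:
  fixes s :: ennreal
  assumes s: "1 < s"
  obtains A where "0 < A" "\<And>(c :: real^'n) l \<alpha> a j. 0 < l \<Longrightarrow> 0 < \<alpha> \<Longrightarrow> Ls_bounded s c l \<alpha> a \<Longrightarrow>
    Ls_bounded s c (2 ^ Suc j * l) (A * \<alpha> / (2 ^ j) ^ CARD('n))
      (\<lambda>x. indicator (shell c l j) x * enn2real (HL_maximal a x))"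
proof -
  obtain B where B: "0 \<le> B" "\<And>(c :: real^'n) l \<alpha> a. 0 < l \<Longrightarrow> 0 < \<alpha> \<Longrightarrow> Ls_bounded s c l \<alpha> a \<Longrightarrow>
    Ls_bounded s c (2 * l) (B * \<alpha>) (\<lambda>x. indicator (cube c (2 * l)) x * enn2real (HL_maximal a x))"
    using Ls_bounded_maximal_near[OF s, where 'n = 'n] by blast
  define A where "A = max B (2 * 4 ^ CARD('n))"
  show ?thesis
  proof (rule that[of A])
    show "0 < A" by (simp add: A_def less_max_iff_disj)
    fix c :: "real^'n" and l \<alpha> :: real and a and j :: nat
    assume l: "0 < l" and \<alpha>: "0 < \<alpha>" and a: "Ls_bounded s c l \<alpha> a"
    let ?b = "\<lambda>x. indicator (shell c l j) x * enn2real (HL_maximal a x)"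
    have m: "?b \<in> borel_measurable lebesgue" by measurable
    show "Ls_bounded s c (2 ^ Suc j * l) (A * \<alpha> / (2 ^ j) ^ CARD('n)) ?b"
    proof (cases j)
      case 0
      have "Ls_bounded s c (2 * l) (B * \<alpha>) ?b"
        using B(2)[OF l \<alpha> a] unfolding 0 shell_0 .
      then have "Ls_bounded s c (2 * l) (A * \<alpha>) ?b"
        by (rule Ls_bounded_mono[OF _ m]) (use \<alpha> l B(1) in \<open>auto simp: A_def intro: mult_right_mono\<close>)
      then show ?thesis using 0 by simp
    next
      case (Suc k)
      define D where "D = 2 * 4 ^ CARD('n) * \<alpha> / (2 ^ j) ^ CARD('n)"
      have DA: "D \<le> A * \<alpha> / (2 ^ j) ^ CARD('n)"
        unfolding D_def A_def using \<alpha> by (intro divide_right_mono mult_right_mono) auto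
      have D0: "0 \<le> D" unfolding D_def using \<alpha> by simp
      have "HL_maximal a x \<le> ennreal D" if "x \<in> shell c l j" for x
      proof -
        have "x \<notin> cube c (2 ^ Suc k * l)" using shell_Suc_outside that unfolding Suc by blast
        then have "HL_maximal a x \<le> ennreal (4 ^ CARD('n) * (2 * l ^ CARD('n) * \<alpha>) / (2 ^ Suc k * l) ^ CARD('n))"
          using Ls_bounded_outside[OF a] l \<alpha> by (intro HL_maximal_far Ls_bounded_nn_integral_le[OF a s]) auto
        also have "4 ^ CARD('n) * (2 * l ^ CARD('n) * \<alpha>) / (2 ^ Suc k * l) ^ CARD('n) = D"
          unfolding D_def Suc using l by (simp add: power_mult_distrib)
        finally show ?thesis .
      qed
      then have "enn2real (HL_maximal a x) \<le> D" if "x \<in> shell c l j" for x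
        using that D0 by (intro enn2real_leI) auto
      then have "\<bar>?b x\<bar> \<le> D" for x using D0 by (auto simp: indicator_def)
      then have "Ls_bounded s c (2 ^ Suc j * l) D ?b"
        using m D0 l shell_subset[of c l j]
        by (intro Ls_bounded_of_bounded AE_I2) (auto simp: indicator_def subset_iff)
      then show ?thesis
        by (rule Ls_bounded_mono[OF _ m]) (use D0 DA l in auto)
    qed
  qed
qed


lemma is_block_measurable: "is_block p s w a \<Longrightarrow> a \<in> borel_measurable lebesgue"
  unfolding is_block_def Lp_space_def by auto

text \<open>On the \<open>j\<close>-th dilate the admissible height of a block is lower than on \<open>Q\<close> by a factor of at most
  \<open>2\<^sup>\<kappa>\<^sup>j\<close>, up to a constant, with \<open>\<kappa> = n q / p\<close>, while \<open>M h\<close> decays like \<open>2\<close> to the power \<open>- j n\<close>.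
  So \<open>\<rho>\<close> is \<open>2\<close> to the power \<open>\<kappa> - n\<close>, which is less than 1 precisely because \<open>q < p\<close>.\<close>

lemma block_maximal_decomposition:
  fixes w :: "real^'n \<Rightarrow> real"
  assumes s: "1 < s" and q: "0 < q" "q < p" and D: "w \<in> D_class q" and P: "w \<in> P_class"
  obtains A \<rho> where "0 < A" "0 < \<rho>" "\<rho> < 1"
    "\<And>h. is_block p s w h \<Longrightarrow> \<exists>G. (\<forall>j. is_block p s w (G j)) \<and> (\<forall>j x. 0 \<le> G j x) \<and>
      (AE x in lebesgue. HL_maximal h x = (\<Sum>j. ennreal (A * \<rho> ^ j) * ennreal (G j x)))"
proof -
  note pos = wmeas_cube_pos[OF D P]
  have block_iff: "is_block p s w a \<longleftrightarrow>
      (\<exists>c l. 0 < l \<and> Ls_bounded s c l (wmeas w (cube c l) powr (- 1 / p)) a)" for a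
    by (rule is_block_iff_Ls_bounded[OF s]) (rule pos)
  have p: "0 < p" using q by simp
  obtain C where C: "1 \<le> C" "\<And>c l t. 0 < l \<Longrightarrow> 1 < t \<Longrightarrow>
     wmeas w (cube c (t * l)) \<le> C * t powr (real CARD('n) * q) * wmeas w (cube c l)"
    using D_class_bound[OF D] by blast
  obtain A0 where A0: "0 < A0" "\<And>(c :: real^'n) l \<alpha> a j. 0 < l \<Longrightarrow> 0 < \<alpha> \<Longrightarrow> Ls_bounded s c l \<alpha> a \<Longrightarrow>
    Ls_bounded s c (2 ^ Suc j * l) (A0 * \<alpha> / (2 ^ j) ^ CARD('n))
      (\<lambda>x. indicator (shell c l j) x * enn2real (HL_maximal a x))"
    using Ls_bounded_maximal_shell[OF s, where 'n = 'n] by blast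
  define \<kappa> where "\<kappa> = real CARD('n) * q / p"
  define \<rho> where "\<rho> = 2 powr \<kappa> / 2 ^ CARD('n)"
  define A where "A = A0 * C powr (1 / p) * 2 powr \<kappa>"
  have A: "0 < A" using A0(1) C(1) by (simp add: A_def)
  have \<rho>0: "0 < \<rho>" by (simp add: \<rho>_def)
  have \<rho>1: "\<rho> < 1"
  proof -
    have "\<kappa> < real CARD('n)" unfolding \<kappa>_def using q p by (simp add: pos_divide_less_eq)
    then have "2 powr \<kappa> < 2 powr real CARD('n)" by (intro powr_less_mono) auto
    then show ?thesis by (simp add: \<rho>_def powr_realpow)
  qed
  show ?thesis
  proof (rule that[OF A \<rho>0 \<rho>1])
    fix h assume "is_block p s w h"
    then obtain c l where l: "0 < l" and h: "Ls_bounded s c l (wmeas w (cube c l) powr (- 1 / p)) h"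
      unfolding block_iff by blast
    note [measurable] = Ls_bounded_measurable[OF h]
    define \<alpha> where "\<alpha> = wmeas w (cube c l) powr (- 1 / p)"
    have \<alpha>: "0 < \<alpha>" using pos[OF l, of c] by (simp add: \<alpha>_def)
    note h = h[folded \<alpha>_def]
    define G where "G = (\<lambda>j x. indicator (shell c l j) x * enn2real (HL_maximal h x) / (A * \<rho> ^ j))"
    have block: "is_block p s w (G j)" for j
    proof -
      define W where "W = wmeas w (cube c (2 ^ Suc j * l))"
      define E where "E = C * (2 ^ Suc j) powr (real CARD('n) * q)"
      have W: "0 < W" unfolding W_def using l by (intro pos) simp
      have E: "0 < E" using C(1) by (simp add: E_def)
      have "W \<le> E * wmeas w (cube c l)"
        unfolding W_def E_def using l one_less_power[of "2::real" "Suc j"] by (intro C(2)) auto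
      then have "W / E \<le> wmeas w (cube c l)" using E by (simp add: pos_divide_le_eq mult.commute)
      then have "\<alpha> \<le> (W / E) powr (- 1 / p)"
        unfolding \<alpha>_def using W E p by (intro powr_mono2') auto
      also have "\<dots> = E powr (1 / p) * W powr (- 1 / p)"
        using powr_minus_divide[of E "1 / p"] unfolding powr_divide by simp
      also have "E powr (1 / p) = C powr (1 / p) * 2 powr \<kappa> * (2 powr \<kappa>) ^ j"
      proof -
        have "(((2::real) ^ Suc j) powr (real CARD('n) * q)) powr (1 / p) = (2 ^ Suc j) powr \<kappa>"
          by (simp only: powr_powr \<kappa>_def times_divide_eq_right mult_1_right)
        also have "\<dots> = (2 powr real (Suc j)) powr \<kappa>" by (simp only: powr_realpow[symmetric] zero_less_numeral)
        also have "\<dots> = (2 powr \<kappa>) powr real (Suc j)" by (simp only: powr_powr mult.commute)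
        also have "\<dots> = (2 powr \<kappa>) ^ Suc j" by (rule powr_realpow) simp
        finally show ?thesis unfolding E_def powr_mult by simp
      qed
      finally have \<alpha>le: "\<alpha> \<le> C powr (1 / p) * 2 powr \<kappa> * (2 powr \<kappa>) ^ j * W powr (- 1 / p)" .
      have "A0 * \<alpha> / (2 ^ j) ^ CARD('n)
          \<le> A0 * (C powr (1 / p) * 2 powr \<kappa> * (2 powr \<kappa>) ^ j * W powr (- 1 / p)) / (2 ^ j) ^ CARD('n)"
        using A0(1) by (intro divide_right_mono mult_left_mono \<alpha>le) auto
      also have "A0 * (C powr (1 / p) * 2 powr \<kappa> * (2 powr \<kappa>) ^ j * W powr (- 1 / p)) / (2 ^ j) ^ CARD('n)
          = A * \<rho> ^ j * W powr (- 1 / p)"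
      proof -
        have "(2 ^ j) ^ CARD('n) = ((2::real) ^ CARD('n)) ^ j"
          by (simp only: power_mult[symmetric] mult.commute)
        then show ?thesis unfolding A_def \<rho>_def by (simp add: power_divide)
      qed
      finally have le: "A0 * \<alpha> / (2 ^ j) ^ CARD('n) \<le> A * \<rho> ^ j * W powr (- 1 / p)" .
      let ?b = "\<lambda>x. indicator (shell c l j) x * enn2real (HL_maximal h x)"
      have m: "?b \<in> borel_measurable lebesgue" by measurable
      have "Ls_bounded s c (2 ^ Suc j * l) (A * \<rho> ^ j * W powr (- 1 / p)) ?b"
        by (rule Ls_bounded_mono[OF A0(2)[OF l \<alpha> h] m]) (use le A0(1) \<alpha> l in auto)
      then have "Ls_bounded s c (2 ^ Suc j * l) (W powr (- 1 / p)) (G j)"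
        unfolding G_def by (rule Ls_bounded_scale) (use A \<rho>0 l in auto)
      moreover have "0 < 2 ^ Suc j * l" using l by simp
      ultimately show ?thesis
        unfolding block_iff W_def by blast
    qed
    have nonneg: "0 \<le> G j x" for j x
      unfolding G_def using A \<rho>0 by auto
    have "(\<integral>\<^sup>+ x. ennreal \<bar>h x\<bar> \<partial>lebesgue) < \<infinity>"
      using Ls_bounded_nn_integral_le[OF h s l \<alpha>] by (simp add: le_less_trans)
    then have "AE x in lebesgue. HL_maximal h x < \<infinity>"
      by (intro HL_maximal_finite_AE) measurable
    then have "AE x in lebesgue. HL_maximal h x = (\<Sum>j. ennreal (A * \<rho> ^ j) * ennreal (G j x))"
    proof eventually_elim
      case (elim x)
      have "ennreal (A * \<rho> ^ j) * ennreal (G j x) = HL_maximal h x * indicator (shell c l j) x" for j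
      proof -
        have "ennreal (A * \<rho> ^ j) * ennreal (G j x) = ennreal (A * \<rho> ^ j * G j x)"
          using A \<rho>0 nonneg by (intro ennreal_mult[symmetric]) auto
        also have "A * \<rho> ^ j * G j x = indicator (shell c l j) x * enn2real (HL_maximal h x)"
          using A \<rho>0 by (simp add: G_def)
        also have "ennreal \<dots> = HL_maximal h x * indicator (shell c l j) x"
          using elim by (auto simp: indicator_def)
        finally show ?thesis .
      qed
      then have "(\<Sum>j. ennreal (A * \<rho> ^ j) * ennreal (G j x)) = HL_maximal h x * (\<Sum>j. indicator (shell c l j) x)"
        by (simp only: ennreal_suminf_cmult)
      then show ?case by (simp add: suminf_indicator_shell[OF l])
    qed
    with block nonneg
    show "\<exists>G. (\<forall>j. is_block p s w (G j)) \<and> (\<forall>j x. 0 \<le> G j x) \<and>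
      (AE x in lebesgue. HL_maximal h x = (\<Sum>j. ennreal (A * \<rho> ^ j) * ennreal (G j x)))" by blast
  qed
qed

section \<open>The maximal function of a block series\<close>

lemma sums_imp_abs_le_suminf_ennreal:
  fixes g :: "nat \<Rightarrow> real"
  assumes "g sums y"
  shows "ennreal \<bar>y\<bar> \<le> (\<Sum>k. ennreal \<bar>g k\<bar>)"
proof (cases "(\<Sum>k. ennreal \<bar>g k\<bar>) = top")
  case False
  then have s: "summable (\<lambda>k. \<bar>g k\<bar>)" by (intro summable_suminf_not_top) auto
  have "\<bar>y\<bar> \<le> (\<Sum>k. \<bar>g k\<bar>)" using summable_rabs[OF s] sums_unique[OF assms] by simp
  then show ?thesis using s by (simp add: suminf_ennreal2 ennreal_leI)
qed simp

text \<open>\<open>F\<close> is dominated by a series of nonnegative blocks whose coefficients have \<open>min p 1\<close>-power sum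
  \<open>T\<close>. The sum is taken in \<open>[0, \<infinity>]\<close>: that it is finite almost everywhere is a separate matter, which
  depends on the target space.\<close>

definition block_majorant ::
  "real \<Rightarrow> ennreal \<Rightarrow> (real^'n \<Rightarrow> real) \<Rightarrow> (real^'n \<Rightarrow> ennreal) \<Rightarrow> real \<Rightarrow> bool" where
  "block_majorant p s w F T \<longleftrightarrow>
    (\<exists>\<nu> G. (\<forall>m. is_block p s w (G m)) \<and> (\<forall>m x. 0 \<le> G m x) \<and> (\<forall>m. 0 \<le> \<nu> m) \<and>
      summable (\<lambda>m. \<nu> m powr min p 1) \<and> (\<Sum>m. \<nu> m powr min p 1) = T \<and>
      (AE x in lebesgue. F x \<le> (\<Sum>m. ennreal (\<nu> m) * ennreal (G m x))))"

text \<open>The decompositions of the \<open>M (h k)\<close> are merged into a single series along the pairing of the natural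
  numbers. Its coefficients are products \<open>\<bar>lam k\<bar> * (A * \<rho> ^ j)\<close>, so their power sum factorises.\<close>

lemma maximal_block_series:
  fixes w :: "real^'n \<Rightarrow> real"
  assumes s: "1 < s" and q: "0 < q" "q < p" and D: "w \<in> D_class q" and P: "w \<in> P_class"
  obtains K where "0 \<le> K" "\<And>f lam h. block_decomp p s w f lam h \<Longrightarrow>
    block_majorant p s w (HL_maximal f) (K * (\<Sum>k. \<bar>lam k\<bar> powr min p 1))"
proof -
  define r where "r = min p 1"
  have r: "0 < r" using q by (simp add: r_def)
  obtain A \<rho> where A: "0 < A" "0 < \<rho>" "\<rho> < 1"
    "\<And>h. is_block p s w h \<Longrightarrow> \<exists>G. (\<forall>j. is_block p s w (G j)) \<and> (\<forall>j x. 0 \<le> G j x) \<and>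
      (AE x in lebesgue. HL_maximal h x = (\<Sum>j. ennreal (A * \<rho> ^ j) * ennreal (G j x)))"
    using block_maximal_decomposition[OF assms] by blast
  define \<theta> where "\<theta> = \<rho> powr r"
  have \<theta>: "0 < \<theta>" "\<theta> < 1" using A r powr_less_mono2[of r \<rho> 1] by (auto simp: \<theta>_def)
  have pw: "(A * \<rho> ^ j) powr r = A powr r * \<theta> ^ j" for j
    unfolding powr_mult \<theta>_def using A
    by (simp add: powr_realpow[symmetric] powr_powr mult.commute)
  define K where "K = A powr r * (1 / (1 - \<theta>))"
  have Ksum: "(\<Sum>j. ennreal ((A * \<rho> ^ j) powr r)) = ennreal K"
  proof (rule suminf_ennreal_eq)
    show "(\<lambda>j. (A * \<rho> ^ j) powr r) sums K"
      unfolding pw K_def using \<theta> by (intro sums_mult geometric_sums) simp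
  qed simp
  have K: "0 \<le> K" using \<theta> by (simp add: K_def)
  show ?thesis
  proof (rule that[OF K])
    fix f lam h assume "block_decomp p s w f lam h"
    then have bh: "\<And>k. is_block p s w (h k)" and sum: "summable (\<lambda>k. \<bar>lam k\<bar> powr r)"
      and f: "AE x in lebesgue. (\<lambda>k. lam k * h k x) sums f x"
      by (auto simp: block_decomp_def r_def)
    have "\<forall>k. \<exists>G. (\<forall>j. is_block p s w (G j)) \<and> (\<forall>j x. 0 \<le> G j x) \<and>
        (AE x in lebesgue. HL_maximal (h k) x = (\<Sum>j. ennreal (A * \<rho> ^ j) * ennreal (G j x)))"
      by (intro allI A(4) bh)
    from choice[OF this] obtain G where G': "\<forall>k. (\<forall>j. is_block p s w (G k j)) \<and> (\<forall>j x. 0 \<le> G k j x) \<and>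
        (AE x in lebesgue. HL_maximal (h k) x = (\<Sum>j. ennreal (A * \<rho> ^ j) * ennreal (G k j x)))" ..
    have G: "is_block p s w (G k j)" "0 \<le> G k j x"
      "AE x in lebesgue. HL_maximal (h k) x = (\<Sum>j. ennreal (A * \<rho> ^ j) * ennreal (G k j x))" for k j x
      using G'[rule_format, of k] by simp_all
    define \<nu> where "\<nu> = (\<lambda>m. case prod_decode m of (k, j) \<Rightarrow> \<bar>lam k\<bar> * (A * \<rho> ^ j))"
    define H where "H = (\<lambda>m. case prod_decode m of (k, j) \<Rightarrow> G k j)"
    have \<nu>0: "0 \<le> \<nu> m" for m using A by (auto simp: \<nu>_def split: prod.split)
    have "(\<Sum>m. ennreal (\<nu> m powr r)) = (\<Sum>k. ennreal (\<bar>lam k\<bar> powr r) * ennreal K)"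
    proof -
      define F where "F = (\<lambda>(k, j). ennreal ((\<bar>lam k\<bar> * (A * \<rho> ^ j)) powr r))"
      have "(\<Sum>m. F (prod_decode m)) = (\<Sum>k. ennreal (\<bar>lam k\<bar> powr r) * ennreal K)"
      proof (rule suminf_ennreal_2dimen)
        fix k
        have "F (k, j) = ennreal (\<bar>lam k\<bar> powr r) * ennreal ((A * \<rho> ^ j) powr r)" for j
          unfolding F_def by (simp only: prod.case powr_mult[of "\<bar>lam k\<bar>"]) (simp add: ennreal_mult)
        then show "ennreal (\<bar>lam k\<bar> powr r) * ennreal K = (\<Sum>j. F (k, j))"
          by (simp only: ennreal_suminf_cmult Ksum)
      qed
      moreover have "F (prod_decode m) = ennreal (\<nu> m powr r)" for m
        by (simp add: F_def \<nu>_def split: prod.split)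
      ultimately show ?thesis by simp
    qed
    also have "\<dots> = ennreal (\<Sum>k. \<bar>lam k\<bar> powr r) * ennreal K"
      using sum by (simp only: ennreal_suminf_multc) (simp add: suminf_ennreal2)
    also have "\<dots> = ennreal (K * (\<Sum>k. \<bar>lam k\<bar> powr r))"
      using K sum by (subst ennreal_mult[symmetric]) (auto simp: mult.commute intro: suminf_nonneg)
    finally have S: "(\<Sum>m. ennreal (\<nu> m powr r)) = ennreal (K * (\<Sum>k. \<bar>lam k\<bar> powr r))" .
    then have sumnu: "summable (\<lambda>m. \<nu> m powr r)"
      by (intro summable_suminf_not_top) auto
    have "0 \<le> K * (\<Sum>k. \<bar>lam k\<bar> powr r)" using K sum by (intro mult_nonneg_nonneg suminf_nonneg) auto
    then have Snu: "(\<Sum>m. \<nu> m powr r) = K * (\<Sum>k. \<bar>lam k\<bar> powr r)"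
      using S sumnu suminf_nonneg[OF sumnu] by (simp add: suminf_ennreal2)
    have f': "AE x in lebesgue. ennreal \<bar>f x\<bar> \<le> (\<Sum>k. ennreal \<bar>lam k\<bar> * ennreal \<bar>h k x\<bar>)"
      using f
    proof eventually_elim
      case (elim x)
      from sums_imp_abs_le_suminf_ennreal[OF this] show ?case by (simp add: abs_mult ennreal_mult)
    qed
    have Mf: "HL_maximal f x \<le> (\<Sum>k. ennreal \<bar>lam k\<bar> * HL_maximal (h k) x)" for x
      by (rule HL_maximal_suminf_le[OF _ f']) (rule is_block_measurable[OF bh])
    have "AE x in lebesgue. \<forall>k. HL_maximal (h k) x = (\<Sum>j. ennreal (A * \<rho> ^ j) * ennreal (G k j x))"
      unfolding AE_all_countable using G(3) by blast
    then have "AE x in lebesgue. HL_maximal f x \<le> (\<Sum>m. ennreal (\<nu> m) * ennreal (H m x))"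
    proof eventually_elim
      case (elim x)
      define F where "F = (\<lambda>(k, j). ennreal (\<bar>lam k\<bar> * (A * \<rho> ^ j)) * ennreal (G k j x))"
      have "(\<Sum>m. F (prod_decode m)) = (\<Sum>k. ennreal \<bar>lam k\<bar> * HL_maximal (h k) x)"
      proof (rule suminf_ennreal_2dimen)
        fix k
        have "F (k, j) = ennreal \<bar>lam k\<bar> * (ennreal (A * \<rho> ^ j) * ennreal (G k j x))" for j
          unfolding F_def using A by (simp add: ennreal_mult mult.assoc)
        then show "ennreal \<bar>lam k\<bar> * HL_maximal (h k) x = (\<Sum>j. F (k, j))"
          using elim by (simp only: ennreal_suminf_cmult)
      qed
      moreover have "F (prod_decode m) = ennreal (\<nu> m) * ennreal (H m x)" for m
        by (simp add: F_def \<nu>_def H_def split: prod.split)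
      ultimately show ?case using Mf[of x] by simp
    qed
    moreover have "is_block p s w (H m)" "0 \<le> H m x" for m x
      using G(1,2) by (auto simp: H_def split: prod.split)
    ultimately show "block_majorant p s w (HL_maximal f) (K * (\<Sum>k. \<bar>lam k\<bar> powr min p 1))"
      unfolding block_majorant_def r_def[symmetric] using \<nu>0 sumnu Snu
      by (intro exI[of _ \<nu>] exI[of _ H]) blast
  qed
qed

lemma le_block_normI:
  assumes f: "f \<in> block_space p s w" and C: "0 \<le> C"
    and le: "\<And>lam h. block_decomp p s w f lam h \<Longrightarrow>
      y \<le> C * (\<Sum>k. \<bar>lam k\<bar> powr min p 1) powr (1 / min p 1)"
  shows "y \<le> C * block_norm p s w f"
proof (cases "C = 0")
  case True
  then show ?thesis using f le by (auto simp: block_space_def)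
next
  case False
  have "y / C \<le> block_norm p s w f"
    unfolding block_norm_def
  proof (rule cInf_greatest)
    show "{(\<Sum>k. \<bar>lam k\<bar> powr min p 1) powr (1 / min p 1) |lam h. block_decomp p s w f lam h} \<noteq> {}"
      using f by (auto simp: block_space_def)
    fix z assume "z \<in> {(\<Sum>k. \<bar>lam k\<bar> powr min p 1) powr (1 / min p 1) |lam h. block_decomp p s w f lam h}"
    then show "y / C \<le> z" using le C False by (auto simp: pos_divide_le_eq mult.commute)
  qed
  then show ?thesis using C False by (simp add: pos_divide_le_eq mult.commute)
qed


section \<open>Block series in weighted Lebesgue spaces\<close>

text \<open>Each \<open>x m\<close> is at most the total sum \<open>S\<close>, so \<open>x m * S powr (p - 1) \<le> x m powr p\<close> when \<open>p \<le> 1\<close>.\<close>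

lemma powr_sum_le_sum_powr:
  fixes x :: "nat \<Rightarrow> real"
  assumes p: "0 < p" "p \<le> 1" and x: "\<And>m. 0 \<le> x m"
  shows "(\<Sum>m<N. x m) powr p \<le> (\<Sum>m<N. x m powr p)"
proof -
  define S where "S = (\<Sum>m<N. x m)"
  have S0: "0 \<le> S" unfolding S_def using x by (intro sum_nonneg) auto
  show ?thesis
  proof (cases "S = 0")
    case True
    then show ?thesis unfolding S_def[symmetric] by (simp add: sum_nonneg)
  next
    case False
    have "S powr p = S * S powr (p - 1)" using S0 by (simp add: powr_mult_base)
    also have "\<dots> = (\<Sum>m<N. x m * S powr (p - 1))"
      unfolding S_def by (rule sum_distrib_right)
    also have "\<dots> \<le> (\<Sum>m<N. x m powr p)"
    proof (rule sum_mono)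
      fix m assume m: "m \<in> {..<N}"
      have le: "x m \<le> S" unfolding S_def using x m by (intro member_le_sum) auto
      show "x m * S powr (p - 1) \<le> x m powr p"
      proof (cases "x m = 0")
        case False
        then have "0 < x m" using x[of m] by simp
        then have "S powr (p - 1) \<le> x m powr (p - 1)" using le p by (intro powr_mono2') auto
        then have "x m * S powr (p - 1) \<le> x m * x m powr (p - 1)" using x by (intro mult_left_mono)
        also have "\<dots> = x m powr p" using x by (simp add: powr_mult_base)
        finally show ?thesis .
      qed simp
    qed
    finally show ?thesis unfolding S_def .
  qed
qed

text \<open>Jensen's inequality for the weights \<open>\<nu>\<close>, up to the factor \<open>2\<^sup>p\<close>. In \<open>le_add_powr_mult_powr\<close> the
  threshold \<open>\<beta> = S / (2 V)\<close> lets the first term absorb only half of the sum \<open>S\<close>.\<close>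

lemma powr_sum_le_weighted_sum_powr:
  fixes \<nu> g :: "nat \<Rightarrow> real"
  assumes p: "1 \<le> p" and \<nu>: "\<And>m. 0 \<le> \<nu> m" and g: "\<And>m. 0 \<le> g m" and V: "(\<Sum>m<N. \<nu> m) \<le> V" "0 < V"
  shows "(\<Sum>m<N. \<nu> m * g m) powr p \<le> (\<Sum>m<N. (2 powr p * V powr (p - 1) * \<nu> m) * g m powr p)"
proof -
  define S where "S = (\<Sum>m<N. \<nu> m * g m)"
  define T where "T = (\<Sum>m<N. \<nu> m * g m powr p)"
  have S0: "0 \<le> S" unfolding S_def using \<nu> g by (intro sum_nonneg) auto
  have T0: "0 \<le> T" unfolding T_def using \<nu> by (intro sum_nonneg mult_nonneg_nonneg) auto
  have rhs: "(\<Sum>m<N. (2 powr p * V powr (p - 1) * \<nu> m) * g m powr p) = 2 powr p * V powr (p - 1) * T"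
    unfolding T_def sum_distrib_left by (simp only: mult.assoc)
  show ?thesis
  proof (cases "S = 0")
    case True
    then show ?thesis unfolding rhs S_def[symmetric] using T0 by simp
  next
    case False
    define \<beta> where "\<beta> = S / (2 * V)"
    have \<beta>: "0 < \<beta>" using False S0 V by (simp add: \<beta>_def)
    have "S \<le> (\<Sum>m<N. \<nu> m * (\<beta> + \<beta> powr (1 - p) * g m powr p))"
      unfolding S_def using \<nu> g \<beta> p by (intro sum_mono mult_left_mono le_add_powr_mult_powr) auto
    also have "\<dots> = (\<Sum>m<N. \<nu> m) * \<beta> + \<beta> powr (1 - p) * T"
      unfolding T_def by (simp add: ring_distribs sum.distrib sum_distrib_left sum_distrib_right mult_ac)
    also have "\<dots> \<le> V * \<beta> + \<beta> powr (1 - p) * T"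
      using V(1) \<beta> by (intro add_right_mono mult_right_mono) auto
    also have "V * \<beta> = S / 2" using V by (simp add: \<beta>_def)
    finally have "S / 2 \<le> \<beta> powr (1 - p) * T" by simp
    then have "\<beta> powr (p - 1) * (S / 2) \<le> \<beta> powr (p - 1) * (\<beta> powr (1 - p) * T)"
      by (rule mult_left_mono) simp
    also have "\<dots> = T" using \<beta> by (simp add: mult.assoc[symmetric] powr_add[symmetric])
    finally have "\<beta> powr (p - 1) * (S / 2) \<le> T" .
    then have "V powr (p - 1) * (\<beta> powr (p - 1) * (S / 2)) \<le> V powr (p - 1) * T"
      by (rule mult_left_mono) simp
    also have "V powr (p - 1) * (\<beta> powr (p - 1) * (S / 2)) = (V * \<beta>) powr (p - 1) * (S / 2)"
      by (simp add: powr_mult)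
    also have "\<dots> = (S / 2) powr p"
    proof -
      have "V * \<beta> = S / 2" using V by (simp add: \<beta>_def)
      then show ?thesis
        using powr_mult_base[of "S / 2" "p - 1"] S0 by (simp only: mult.commute) simp
    qed
    finally have "2 powr p * (S / 2) powr p \<le> 2 powr p * (V powr (p - 1) * T)"
      by (rule mult_left_mono) simp
    moreover have "2 powr p * (S / 2) powr p = S powr p"
      by (simp add: powr_mult[symmetric])
    ultimately show ?thesis unfolding rhs S_def by (simp add: mult.assoc)
  qed
qed

text \<open>This puts the two ranges of \<open>p\<close> into one form, so that the integration below need not
  distinguish them: the \<open>p\<close>-th power of the series is dominated by a series in the \<open>p\<close>-th powers.\<close>

lemma powr_series_coefficients:
  fixes \<nu> :: "nat \<Rightarrow> real"
  assumes p: "0 < p" and \<nu>: "\<And>m. 0 \<le> \<nu> m" and sum: "summable (\<lambda>m. \<nu> m powr min p 1)"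
  obtains c where "\<And>m. 0 \<le> c m"
    "\<And>N. (\<Sum>m<N. c m) \<le> 2 powr p * (\<Sum>m. \<nu> m powr min p 1) powr (p / min p 1)"
    "\<And>g N. (\<And>m. 0 \<le> g m) \<Longrightarrow> (\<Sum>m<N. \<nu> m * g m) powr p \<le> (\<Sum>m<N. c m * g m powr p)"
proof (cases "p \<le> 1")
  case True
  show ?thesis
  proof (rule that[of "\<lambda>m. \<nu> m powr p"])
    fix N
    have V: "0 \<le> (\<Sum>m. \<nu> m powr p)" using sum True by (intro suminf_nonneg) auto
    have "(\<Sum>m<N. \<nu> m powr p) \<le> (\<Sum>m. \<nu> m powr p)"
      using sum True by (intro sum_le_suminf) auto
    also have "\<dots> \<le> 2 powr p * (\<Sum>m. \<nu> m powr p)"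
      using V p by (simp add: mult_le_cancel_right1 ge_one_powr_ge_zero)
    finally show "(\<Sum>m<N. \<nu> m powr p) \<le> 2 powr p * (\<Sum>m. \<nu> m powr min p 1) powr (p / min p 1)"
      using True p V by simp
  next
    fix g :: "nat \<Rightarrow> real" and N assume g: "\<And>m. 0 \<le> g m"
    have "(\<Sum>m<N. \<nu> m * g m) powr p \<le> (\<Sum>m<N. (\<nu> m * g m) powr p)"
      using p True \<nu> g by (intro powr_sum_le_sum_powr) auto
    then show "(\<Sum>m<N. \<nu> m * g m) powr p \<le> (\<Sum>m<N. \<nu> m powr p * g m powr p)"
      by (simp only: powr_mult)
  qed simp
next
  case False
  define V where "V = (\<Sum>m. \<nu> m)"
  have s: "summable \<nu>" using sum False \<nu> by simp
  have V0: "0 \<le> V" unfolding V_def using s \<nu> by (intro suminf_nonneg) auto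
  have VN: "(\<Sum>m<N. \<nu> m) \<le> V" for N
    unfolding V_def using s \<nu> by (intro sum_le_suminf) auto
  have VV: "(\<Sum>m. \<nu> m powr min p 1) powr (p / min p 1) = V powr p"
    using False \<nu> by (simp add: V_def)
  show ?thesis
  proof (rule that[of "\<lambda>m. 2 powr p * V powr (p - 1) * \<nu> m"])
    show "0 \<le> 2 powr p * V powr (p - 1) * \<nu> m" for m using \<nu> by (intro mult_nonneg_nonneg) auto
    fix N
    have "(\<Sum>m<N. 2 powr p * V powr (p - 1) * \<nu> m) = 2 powr p * V powr (p - 1) * (\<Sum>m<N. \<nu> m)"
      by (simp only: sum_distrib_left)
    also have "\<dots> \<le> 2 powr p * V powr (p - 1) * V"
      by (intro mult_left_mono VN) auto
    also have "\<dots> = 2 powr p * V powr p"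
      using V0 powr_mult_base[of V "p - 1"] by (simp add: mult_ac)
    finally show "(\<Sum>m<N. 2 powr p * V powr (p - 1) * \<nu> m)
      \<le> 2 powr p * (\<Sum>m. \<nu> m powr min p 1) powr (p / min p 1)" unfolding VV .
  next
    fix g :: "nat \<Rightarrow> real" and N assume g: "\<And>m. 0 \<le> g m"
    show "(\<Sum>m<N. \<nu> m * g m) powr p \<le> (\<Sum>m<N. (2 powr p * V powr (p - 1) * \<nu> m) * g m powr p)"
    proof (cases "V = 0")
      case True
      have "\<nu> m = 0" for m
        using sum_le_suminf[OF s, of "{m}"] \<nu> True unfolding V_def by (auto simp: order_antisym)
      then show ?thesis by simp
    next
      case False
      then show ?thesis
        using \<open>\<not> p \<le> 1\<close> \<nu> g VN V0 by (intro powr_sum_le_weighted_sum_powr) auto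
    qed
  qed
qed

text \<open>The partial sums are bounded in \<open>L\<^sup>p\<close> uniformly, so monotone convergence makes the supremum of
  their \<open>p\<close>-th powers integrable, hence finite almost everywhere, and this controls the series itself.\<close>

lemma series_Lp_bound:
  fixes G :: "nat \<Rightarrow> 'a \<Rightarrow> real"
  assumes p: "0 < p" and \<nu>: "\<And>m. 0 \<le> \<nu> m" and sum: "summable (\<lambda>m. \<nu> m powr min p 1)"
    and G [measurable]: "\<And>m. G m \<in> borel_measurable M" and G0: "\<And>m x. 0 \<le> G m x"
    and B: "\<And>m. (\<integral>\<^sup>+ x. ennreal (G m x powr p) \<partial>M) \<le> ennreal B" "0 \<le> B"
  defines "U \<equiv> \<lambda>x. \<Sum>m. ennreal (\<nu> m) * ennreal (G m x)"
  shows "AE x in M. U x < \<infinity>"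
    and "(\<integral>\<^sup>+ x. ennreal (enn2real (U x) powr p) \<partial>M)
      \<le> ennreal (2 powr p * (\<Sum>m. \<nu> m powr min p 1) powr (p / min p 1) * B)"
proof -
  define R where "R = 2 powr p * (\<Sum>m. \<nu> m powr min p 1) powr (p / min p 1)"
  obtain c where c: "\<And>m. 0 \<le> c m" "\<And>N. (\<Sum>m<N. c m) \<le> R"
    "\<And>g N. (\<And>m. 0 \<le> g m) \<Longrightarrow> (\<Sum>m<N. \<nu> m * g m) powr p \<le> (\<Sum>m<N. c m * g m powr p)"
    using powr_series_coefficients[of p \<nu>, OF p \<nu> sum] unfolding R_def by blast
  define S where "S = (\<lambda>N x. \<Sum>m<N. \<nu> m * G m x)"
  have S0: "0 \<le> S N x" for N x unfolding S_def using \<nu> G0 by (intro sum_nonneg) auto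
  have [measurable]: "S N \<in> borel_measurable M" for N unfolding S_def by measurable
  define Z where "Z = (\<lambda>x. SUP N. ennreal (S N x powr p))"
  have [measurable]: "Z \<in> borel_measurable M" unfolding Z_def by measurable
  have Smono: "S N x \<le> S N' x" if "N \<le> N'" for N N' x
    unfolding S_def using that \<nu> G0 by (intro sum_mono2) auto
  have SN: "(\<integral>\<^sup>+ x. ennreal (S N x powr p) \<partial>M) \<le> ennreal (R * B)" for N
  proof -
    have "(\<integral>\<^sup>+ x. ennreal (S N x powr p) \<partial>M) \<le> (\<integral>\<^sup>+ x. (\<Sum>m<N. ennreal (c m) * ennreal (G m x powr p)) \<partial>M)"
    proof (rule nn_integral_mono)
      fix x
      have "ennreal (S N x powr p) \<le> ennreal (\<Sum>m<N. c m * G m x powr p)"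
        unfolding S_def using c(3)[of "\<lambda>m. G m x"] G0 by (intro ennreal_leI) auto
      also have "\<dots> = (\<Sum>m<N. ennreal (c m) * ennreal (G m x powr p))"
        using c(1) by (subst sum_ennreal[symmetric]) (auto simp: ennreal_mult)
      finally show "ennreal (S N x powr p) \<le> \<dots>" .
    qed
    also have "\<dots> = (\<Sum>m<N. \<integral>\<^sup>+ x. ennreal (c m) * ennreal (G m x powr p) \<partial>M)"
      by (rule nn_integral_sum) measurable
    also have "\<dots> = (\<Sum>m<N. ennreal (c m) * (\<integral>\<^sup>+ x. ennreal (G m x powr p) \<partial>M))"
      by (intro sum.cong refl nn_integral_cmult) measurable
    also have "\<dots> \<le> (\<Sum>m<N. ennreal (c m) * ennreal B)"
      by (intro sum_mono mult_left_mono B) auto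
    also have "\<dots> = ennreal ((\<Sum>m<N. c m) * B)"
      using c(1) B(2) by (simp add: ennreal_mult[symmetric] sum_distrib_right)
    also have "\<dots> \<le> ennreal (R * B)" using c(2) B(2) by (intro ennreal_leI mult_right_mono)
    finally show ?thesis .
  qed
  have "(\<integral>\<^sup>+ x. Z x \<partial>M) = (SUP N. \<integral>\<^sup>+ x. ennreal (S N x powr p) \<partial>M)"
    unfolding Z_def
  proof (rule nn_integral_monotone_convergence_SUP)
    show "incseq (\<lambda>N x. ennreal (S N x powr p))"
      using Smono S0 p by (intro incseq_SucI le_funI ennreal_leI powr_mono2) auto
  qed measurable
  also have "\<dots> \<le> ennreal (R * B)" by (intro SUP_least SN)
  finally have Zint: "(\<integral>\<^sup>+ x. Z x \<partial>M) \<le> ennreal (R * B)" .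
  then have "(\<integral>\<^sup>+ x. Z x \<partial>M) \<noteq> \<infinity>" by (auto simp: top_unique)
  then have Zfin: "AE x in M. Z x \<noteq> \<infinity>" by (intro nn_integral_PInf_AE) measurable
  have key: "U x < \<infinity> \<and> ennreal (enn2real (U x) powr p) \<le> Z x" if Z: "Z x \<noteq> \<infinity>" for x
  proof -
    obtain z where z: "0 \<le> z" "Z x = ennreal z" using Z by (cases "Z x") auto
    have "U x \<le> ennreal (z powr (1 / p))"
      unfolding U_def
    proof (rule suminf_le_const)
      fix N
      have "ennreal (S N x powr p) \<le> ennreal z" unfolding z(2)[symmetric] Z_def by (rule SUP_upper) simp
      then have "S N x powr p \<le> z" using z(1) by simp
      then have "(S N x powr p) powr (1 / p) \<le> z powr (1 / p)" using p by (intro powr_mono2) auto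
      then have "S N x \<le> z powr (1 / p)" using p S0 by (simp add: powr_powr)
      then have "ennreal (S N x) \<le> ennreal (z powr (1 / p))" by (rule ennreal_leI)
      also have "ennreal (S N x) = (\<Sum>m<N. ennreal (\<nu> m) * ennreal (G m x))"
        unfolding S_def using \<nu> G0 by (subst sum_ennreal[symmetric]) (auto simp: ennreal_mult)
      finally show "(\<Sum>m<N. ennreal (\<nu> m) * ennreal (G m x)) \<le> ennreal (z powr (1 / p))" .
    qed auto
    moreover from this have "enn2real (U x) \<le> z powr (1 / p)" by (intro enn2real_leI) auto
    then have "enn2real (U x) powr p \<le> (z powr (1 / p)) powr p" using p by (intro powr_mono2) auto
    then have "enn2real (U x) powr p \<le> z" using p z(1) by (simp add: powr_powr)
    ultimately show ?thesis unfolding z(2) by (auto intro: ennreal_leI le_less_trans)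
  qed
  show "AE x in M. U x < \<infinity>" using Zfin by eventually_elim (use key in blast)
  have "(\<integral>\<^sup>+ x. ennreal (enn2real (U x) powr p) \<partial>M) \<le> (\<integral>\<^sup>+ x. Z x \<partial>M)"
    by (rule nn_integral_mono_AE) (use Zfin in eventually_elim, use key in blast)
  also note Zint
  finally show "(\<integral>\<^sup>+ x. ennreal (enn2real (U x) powr p) \<partial>M)
      \<le> ennreal (2 powr p * (\<Sum>m. \<nu> m powr min p 1) powr (p / min p 1) * B)" unfolding R_def .
qed

text \<open>Testing on single blocks suffices, because the majorant of \<open>M f\<close> consists of blocks of the same
  kind as those of \<open>f\<close>.\<close>

lemma maximal_bounded_block_LpI:
  fixes w :: "real^'n \<Rightarrow> real"
  assumes s: "1 < s" and q: "0 < q" "q < p" and D: "w \<in> D_class q" and P: "w \<in> P_class"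
    and B: "0 \<le> B" "\<And>G. is_block p s w G \<Longrightarrow>
      (\<integral>\<^sup>+ x. ennreal (w x) * ennreal (\<bar>G x\<bar> powr p) \<partial>lebesgue) \<le> ennreal B"
  shows "maximal_bounded_block_Lp p s w"
proof -
  have p: "0 < p" using q by simp
  have [measurable]: "w \<in> borel_measurable lebesgue"
    using D by (intro weight_measurable) (simp add: D_class_def)
  define r where "r = min p 1"
  have r: "0 < r" using p by (simp add: r_def)
  obtain K where K: "0 \<le> K" "\<And>f lam h. block_decomp p s w f lam h \<Longrightarrow>
      block_majorant p s w (HL_maximal f) (K * (\<Sum>k. \<bar>lam k\<bar> powr r))"
    unfolding r_def using maximal_block_series[OF s q D P] by blast
  define C where "C = (2 powr p * B) powr (1 / p) * K powr (1 / r)"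
  have C: "0 \<le> C" by (simp add: C_def)
  have sets: "sets (weighted w) = sets lebesgue" by (simp add: weighted_def)
  have main: "(AE x in weighted w. HL_maximal f x < \<infinity>) \<and>
      (\<lambda>x. enn2real (HL_maximal f x)) \<in> Lp_space (weighted w) (ennreal p) \<and>
      Lp_norm (weighted w) (ennreal p) (\<lambda>x. enn2real (HL_maximal f x))
        \<le> C * (\<Sum>k. \<bar>lam k\<bar> powr r) powr (1 / r)" if decomp: "block_decomp p s w f lam h" for f lam h
  proof -
    obtain \<nu> G where G: "\<And>m. is_block p s w (G m)" "\<And>m x. 0 \<le> G m x" "\<And>m. 0 \<le> \<nu> m"
      "summable (\<lambda>m. \<nu> m powr r)" "(\<Sum>m. \<nu> m powr r) = K * (\<Sum>k. \<bar>lam k\<bar> powr r)"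
      "AE x in lebesgue. HL_maximal f x \<le> (\<Sum>m. ennreal (\<nu> m) * ennreal (G m x))"
      using K(2)[OF decomp] unfolding block_majorant_def r_def[symmetric] by blast
    define U where "U = (\<lambda>x. \<Sum>m. ennreal (\<nu> m) * ennreal (G m x))"
    define V where "V = (\<Sum>m. \<nu> m powr r)"
    have Gm [measurable]: "G m \<in> borel_measurable lebesgue" for m by (rule is_block_measurable[OF G(1)])
    have Gw: "G m \<in> borel_measurable (weighted w)" for m
      using Gm[of m] unfolding measurable_cong_sets[OF sets refl] .
    have GB: "(\<integral>\<^sup>+ x. ennreal (G m x powr p) \<partial>weighted w) \<le> ennreal B" for m
    proof -
      have "(\<integral>\<^sup>+ x. ennreal (G m x powr p) \<partial>weighted w)
          = (\<integral>\<^sup>+ x. ennreal (w x) * ennreal (G m x powr p) \<partial>lebesgue)"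
        unfolding weighted_def by (rule nn_integral_density) measurable
      also have "\<dots> = (\<integral>\<^sup>+ x. ennreal (w x) * ennreal (\<bar>G m x\<bar> powr p) \<partial>lebesgue)"
        using G(2) by simp
      also have "\<dots> \<le> ennreal B" by (rule B(2)[OF G(1)])
      finally show ?thesis .
    qed
    note ser = series_Lp_bound[of p \<nu> G "weighted w" B, OF p G(3) _ Gw G(2) GB B(1)]
    have Ufin: "AE x in weighted w. U x < \<infinity>"
      unfolding U_def by (rule ser(1)) (use G(4) in \<open>simp add: r_def\<close>)
    have Uint: "(\<integral>\<^sup>+ x. ennreal (enn2real (U x) powr p) \<partial>weighted w) \<le> ennreal (2 powr p * V powr (p / r) * B)"
      unfolding U_def V_def r_def by (rule ser(2)) (use G(4) in \<open>simp add: r_def\<close>)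
    have MU: "AE x in weighted w. HL_maximal f x \<le> U x"
    proof -
      have "AE x in lebesgue. 0 < ennreal (w x) \<longrightarrow> HL_maximal f x \<le> U x"
        using G(6) unfolding U_def by eventually_elim simp
      moreover have "(\<lambda>x. ennreal (w x)) \<in> borel_measurable lebesgue" by measurable
      ultimately show ?thesis unfolding weighted_def by (simp only: AE_density)
    qed
    have Mfin: "AE x in weighted w. HL_maximal f x < \<infinity>"
      using Ufin MU by eventually_elim (rule le_less_trans)
    have Mm: "(\<lambda>x. enn2real (HL_maximal f x)) \<in> borel_measurable (weighted w)"
      using enn2real_HL_measurable[of f] unfolding measurable_cong_sets[OF sets refl] .
    let ?g = "\<lambda>x. \<bar>enn2real (HL_maximal f x)\<bar> powr p"
    have "(\<integral>\<^sup>+ x. ennreal (?g x) \<partial>weighted w) \<le> (\<integral>\<^sup>+ x. ennreal (enn2real (U x) powr p) \<partial>weighted w)"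
    proof (rule nn_integral_mono_AE)
      show "AE x in weighted w. ennreal (?g x) \<le> ennreal (enn2real (U x) powr p)"
        using Ufin MU
      proof eventually_elim
        case (elim x)
        have "enn2real (HL_maximal f x) \<le> enn2real (U x)"
          by (rule enn2real_mono) (use elim in auto)
        then show ?case using p by (intro ennreal_leI powr_mono2) auto
      qed
    qed
    also note Uint
    finally have gint: "(\<integral>\<^sup>+ x. ennreal (?g x) \<partial>weighted w) \<le> ennreal (2 powr p * V powr (p / r) * B)" .
    have gm: "?g \<in> borel_measurable (weighted w)" using Mm by measurable
    have i: "integrable (weighted w) ?g"
    proof (rule integrableI_bounded[OF gm])
      have "(\<integral>\<^sup>+ x. ennreal (norm (?g x)) \<partial>weighted w) = (\<integral>\<^sup>+ x. ennreal (?g x) \<partial>weighted w)"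
        by simp
      also note gint
      also have "ennreal (2 powr p * V powr (p / r) * B) < \<infinity>" by simp
      finally show "(\<integral>\<^sup>+ x. ennreal (norm (?g x)) \<partial>weighted w) < \<infinity>" .
    qed
    have "ennreal (LINT x|weighted w. ?g x) = (\<integral>\<^sup>+ x. ennreal (?g x) \<partial>weighted w)"
      by (rule nn_integral_eq_integral[OF i, symmetric]) simp
    with gint have "ennreal (LINT x|weighted w. ?g x) \<le> ennreal (2 powr p * V powr (p / r) * B)" by simp
    then have le: "(LINT x|weighted w. ?g x) \<le> 2 powr p * V powr (p / r) * B"
      using B(1) by simp
    have "(LINT x|weighted w. ?g x) powr (1 / p) \<le> (2 powr p * V powr (p / r) * B) powr (1 / p)"
      using le p by (intro powr_mono2 Bochner_Integration.integral_nonneg) auto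
    also have "2 powr p * V powr (p / r) * B = 2 powr p * B * V powr (p / r)" by (simp only: mult_ac)
    also have "(2 powr p * B * V powr (p / r)) powr (1 / p) = (2 powr p * B) powr (1 / p) * V powr (1 / r)"
      using p by (simp add: powr_mult powr_powr)
    also have "\<dots> = C * (\<Sum>k. \<bar>lam k\<bar> powr r) powr (1 / r)"
      unfolding V_def G(5) C_def by (simp only: powr_mult mult.assoc)
    finally have norm: "Lp_norm (weighted w) (ennreal p) (\<lambda>x. enn2real (HL_maximal f x))
        \<le> C * (\<Sum>k. \<bar>lam k\<bar> powr r) powr (1 / r)"
      using p by (simp add: Lp_norm_def)
    have "(\<lambda>x. enn2real (HL_maximal f x)) \<in> Lp_space (weighted w) (ennreal p)"
      unfolding Lp_space_def using Mm i p by simp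
    with Mfin norm show ?thesis by blast
  qed
  show ?thesis
    unfolding maximal_bounded_block_Lp_def maximal_bounded_def
  proof (rule exI[of _ C], rule ballI)
    fix f assume f: "f \<in> block_space p s w"
    then obtain lam h where "block_decomp p s w f lam h" by (auto simp: block_space_def)
    note m = main[OF this]
    have "Lp_norm (weighted w) (ennreal p) (\<lambda>x. enn2real (HL_maximal f x)) \<le> C * block_norm p s w f"
      by (rule le_block_normI[OF f C]) (use main in \<open>simp add: r_def\<close>)
    with m show "(AE x in weighted w. HL_maximal f x < \<infinity>) \<and>
      (\<lambda>x. enn2real (HL_maximal f x)) \<in> Lp_space (weighted w) (ennreal p) \<and>
      Lp_norm (weighted w) (ennreal p) (\<lambda>x. enn2real (HL_maximal f x)) \<le> C * block_norm p s w f" by blast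
  qed
qed

lemma block_norm_le:
  assumes "block_decomp p s w f lam h"
  shows "block_norm p s w f \<le> (\<Sum>k. \<bar>lam k\<bar> powr min p 1) powr (1 / min p 1)"
  unfolding block_norm_def
  by (rule cInf_lower) (use assms in \<open>auto intro!: bdd_belowI[of _ 0]\<close>)

text \<open>Blocks form a solid class; this is what allows a majorant to be cut down to \<open>M f\<close>.\<close>

lemma is_block_mono:
  fixes w :: "real^'n \<Rightarrow> real"
  assumes s: "1 < s" and pos: "\<And>c l. 0 < l \<Longrightarrow> 0 < wmeas w (cube c l)"
    and a: "is_block p s w a" and b: "b \<in> borel_measurable lebesgue" and le: "\<And>x. \<bar>b x\<bar> \<le> \<bar>a x\<bar>"
  shows "is_block p s w b"
proof -
  have iff: "is_block p s w a \<longleftrightarrow>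
      (\<exists>c l. 0 < l \<and> Ls_bounded s c l (wmeas w (cube c l) powr (- 1 / p)) a)" for a
    by (rule is_block_iff_Ls_bounded[OF s]) (rule pos)
  obtain c l where cl: "0 < l" "Ls_bounded s c l (wmeas w (cube c l) powr (- 1 / p)) a"
    using a unfolding iff by blast
  have "Ls_bounded s c l (wmeas w (cube c l) powr (- 1 / p)) b"
    by (rule Ls_bounded_mono[OF cl(2) b le]) (use cl(1) in auto)
  with cl(1) show ?thesis unfolding iff by blast
qed

lemma summable_of_summable_powr:
  fixes \<nu> :: "nat \<Rightarrow> real"
  assumes \<nu>: "\<And>m. 0 \<le> \<nu> m" and r: "0 < r" "r \<le> 1" and s: "summable (\<lambda>m. \<nu> m powr r)"
  shows "summable \<nu>"
proof (rule summable_comparison_test_ev[OF _ s])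
  have "eventually (\<lambda>m. \<nu> m powr r < 1) sequentially"
    by (rule order_tendstoD(2)[OF summable_LIMSEQ_zero[OF s]]) simp
  then show "eventually (\<lambda>m. norm (\<nu> m) \<le> \<nu> m powr r) sequentially"
  proof eventually_elim
    case (elim m)
    have "\<nu> m \<le> 1"
    proof (rule ccontr)
      assume "\<not> \<nu> m \<le> 1"
      then have "1 \<le> \<nu> m powr r" using r by (intro ge_one_powr_ge_zero) auto
      then show False using elim by simp
    qed
    then have "\<nu> m powr 1 \<le> \<nu> m powr r" using \<nu> r by (intro powr_mono') auto
    then show ?case using \<nu> by simp
  qed
qed

text \<open>Multiplying every term of the majorant by the ratio \<open>\<theta>\<close> of \<open>M f\<close> to the sum of the majorant
  keeps the terms blocks and makes the series converge to \<open>M f\<close>. Finiteness of the sum is essential: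
  where it is infinite, the terms carry no information on \<open>M f\<close>.\<close>

lemma maximal_bounded_block_blockI:
  fixes w :: "real^'n \<Rightarrow> real"
  assumes s: "1 < s" and q: "0 < q" "q < p" and D: "w \<in> D_class q" and P: "w \<in> P_class"
    and fin: "\<And>\<nu> G. (\<And>m. 0 \<le> \<nu> m) \<Longrightarrow> summable \<nu> \<Longrightarrow> (\<And>m. is_block p s w (G m)) \<Longrightarrow>
      AE x in lebesgue. (\<Sum>m. ennreal (\<nu> m) * ennreal \<bar>G m x\<bar>) < \<infinity>"
  shows "maximal_bounded_block_block p s w"
proof -
  have p: "0 < p" using q by simp
  define r where "r = min p 1"
  have r: "0 < r" "r \<le> 1" using p by (auto simp: r_def)
  obtain K where K: "0 \<le> K" "\<And>f lam h. block_decomp p s w f lam h \<Longrightarrow>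
      block_majorant p s w (HL_maximal f) (K * (\<Sum>k. \<bar>lam k\<bar> powr r))"
    unfolding r_def using maximal_block_series[OF s q D P] by blast
  define C where "C = K powr (1 / r)"
  have C: "0 \<le> C" by (simp add: C_def)
  have main: "(AE x in lebesgue. HL_maximal f x < \<infinity>) \<and>
      (\<lambda>x. enn2real (HL_maximal f x)) \<in> block_space p s w \<and>
      block_norm p s w (\<lambda>x. enn2real (HL_maximal f x)) \<le> C * (\<Sum>k. \<bar>lam k\<bar> powr r) powr (1 / r)"
    if decomp: "block_decomp p s w f lam h" for f lam h
  proof -
    obtain \<nu> G where G: "\<And>m. is_block p s w (G m)" "\<And>m x. 0 \<le> G m x" "\<And>m. 0 \<le> \<nu> m"
      "summable (\<lambda>m. \<nu> m powr r)" "(\<Sum>m. \<nu> m powr r) = K * (\<Sum>k. \<bar>lam k\<bar> powr r)"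
      "AE x in lebesgue. HL_maximal f x \<le> (\<Sum>m. ennreal (\<nu> m) * ennreal (G m x))"
      using K(2)[OF decomp] unfolding block_majorant_def r_def[symmetric] by blast
    have Gm [measurable]: "G m \<in> borel_measurable lebesgue" for m by (rule is_block_measurable[OF G(1)])
    define U where "U = (\<lambda>x. \<Sum>m. ennreal (\<nu> m) * ennreal (G m x))"
    have Um [measurable]: "U \<in> borel_measurable lebesgue" unfolding U_def by measurable
    have "summable \<nu>" by (rule summable_of_summable_powr[OF G(3) r G(4)])
    from fin[OF G(3) this G(1)] have Ufin: "AE x in lebesgue. U x < \<infinity>"
      unfolding U_def using G(2) by simp
    have MU: "AE x in lebesgue. HL_maximal f x \<le> U x" using G(6) unfolding U_def .
    have Mfin: "AE x in lebesgue. HL_maximal f x < \<infinity>"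
      using Ufin MU by eventually_elim (rule le_less_trans)
    let ?m = "\<lambda>x. enn2real (HL_maximal f x)"
    \<comment> \<open>The minimum makes \<open>\<theta> \<le> 1\<close> hold everywhere, also on the null set where the majorant fails; a zero denominator gives \<open>0\<close>.\<close>
    define \<theta> where "\<theta> = (\<lambda>x. min 1 (?m x / enn2real (U x)))"
    have \<theta>: "0 \<le> \<theta> x" "\<theta> x \<le> 1" for x by (auto simp: \<theta>_def)
    have [measurable]: "\<theta> \<in> borel_measurable lebesgue" unfolding \<theta>_def by measurable
    define H where "H = (\<lambda>k x. \<theta> x * G k x)"
    have H: "is_block p s w (H k)" for k
    proof (rule is_block_mono[OF s _ G(1)[of k]])
      show "0 < wmeas w (cube c l)" if "0 < l" for c l by (rule wmeas_cube_pos[OF D P that])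
      show "H k \<in> borel_measurable lebesgue" unfolding H_def by measurable
      show "\<bar>H k x\<bar> \<le> \<bar>G k x\<bar>" for x
        using \<theta>[of x] by (simp add: H_def abs_mult mult_left_le_one_le)
    qed
    have sums: "AE x in lebesgue. (\<lambda>k. \<nu> k * H k x) sums ?m x"
      using Ufin MU
    proof eventually_elim
      case (elim x)
      define u where "u = enn2real (U x)"
      have u: "U x = ennreal u" "0 \<le> u" using elim(1) by (auto simp: u_def)
      have Ueq: "(\<Sum>m. ennreal (\<nu> m * G m x)) = ennreal u"
        using u(1) G(2,3) by (simp add: U_def ennreal_mult)
      have sm: "summable (\<lambda>m. \<nu> m * G m x)"
        using G(2,3) Ueq by (intro summable_suminf_not_top) auto
      have "(\<Sum>m. \<nu> m * G m x) = u"
      proof -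
        have "ennreal (\<Sum>m. \<nu> m * G m x) = ennreal u"
          unfolding Ueq[symmetric] using G(2,3) sm by (intro suminf_ennreal2[symmetric]) auto
        moreover have "0 \<le> (\<Sum>m. \<nu> m * G m x)" using sm G(2,3) by (intro suminf_nonneg) auto
        ultimately show ?thesis using u(2) by simp
      qed
      with sm have "(\<lambda>m. \<nu> m * G m x) sums u" by (simp add: sums_iff)
      then have "(\<lambda>m. \<theta> x * (\<nu> m * G m x)) sums (\<theta> x * u)" by (rule sums_mult)
      moreover have "\<theta> x * u = ?m x"
      proof -
        have "?m x \<le> u" using elim u by (intro enn2real_leI) auto
        moreover from this have "?m x / u \<le> 1" using u(2) by (cases "u = 0") (auto simp: divide_le_eq)
        then have "\<theta> x = ?m x / u" unfolding \<theta>_def u_def[symmetric] by simp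
        ultimately show ?thesis
          using u(2) enn2real_nonneg[of "HL_maximal f x"] by (cases "u = 0") auto
      qed
      ultimately show ?case by (simp add: H_def mult_ac)
    qed
    have dec: "block_decomp p s w ?m \<nu> H"
      unfolding block_decomp_def using H sums G(3,4) by (simp add: r_def)
    have "block_norm p s w ?m \<le> (\<Sum>k. \<bar>\<nu> k\<bar> powr r) powr (1 / r)"
      using block_norm_le[OF dec] by (simp add: r_def)
    also have "(\<lambda>k. \<bar>\<nu> k\<bar>) = \<nu>" using G(3) by auto
    then have "(\<Sum>k. \<bar>\<nu> k\<bar> powr r) = K * (\<Sum>k. \<bar>lam k\<bar> powr r)"
      using G(3,5) by simp
    also have "(K * (\<Sum>k. \<bar>lam k\<bar> powr r)) powr (1 / r) = C * (\<Sum>k. \<bar>lam k\<bar> powr r) powr (1 / r)"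
      unfolding C_def by (rule powr_mult)
    finally have "block_norm p s w ?m \<le> C * (\<Sum>k. \<bar>lam k\<bar> powr r) powr (1 / r)" .
    with dec Mfin show ?thesis by (auto simp: block_space_def)
  qed
  show ?thesis
    unfolding maximal_bounded_block_block_def maximal_bounded_def
  proof (rule exI[of _ C], rule ballI)
    fix f assume f: "f \<in> block_space p s w"
    then obtain lam h where "block_decomp p s w f lam h" by (auto simp: block_space_def)
    note m = main[OF this]
    have "block_norm p s w (\<lambda>x. enn2real (HL_maximal f x)) \<le> C * block_norm p s w f"
      by (rule le_block_normI[OF f C]) (use main in \<open>simp add: r_def\<close>)
    with m show "(AE x in lebesgue. HL_maximal f x < \<infinity>) \<and>
      (\<lambda>x. enn2real (HL_maximal f x)) \<in> block_space p s w \<and>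
      block_norm p s w (\<lambda>x. enn2real (HL_maximal f x)) \<le> C * block_norm p s w f" by blast
  qed
qed


section \<open>Weighted and local bounds for single blocks\<close>

lemma powr_root_reciprocal:
  fixes W p :: real
  assumes W: "0 < W" and p: "0 < p"
  shows "(W powr (- 1 / p)) powr p = 1 / W"
proof -
  have "- 1 / p * p = - 1" using p by simp
  then show ?thesis unfolding powr_powr using W powr_minus_divide[of W 1] by (simp only:) simp
qed

lemma bounded_block_Lp_bound:
  fixes w :: "real^'n \<Rightarrow> real"
  assumes p: "0 < p" and w: "weight w" and pos: "\<And>c l. 0 < l \<Longrightarrow> 0 < wmeas w (cube c l)"
    and G: "is_block p \<infinity> w G"
  shows "(\<integral>\<^sup>+ x. ennreal (w x) * ennreal (\<bar>G x\<bar> powr p) \<partial>lebesgue) \<le> ennreal 1"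
proof -
  have iff: "is_block p \<infinity> w G \<longleftrightarrow>
      (\<exists>c l. 0 < l \<and> Ls_bounded \<infinity> c l (wmeas w (cube c l) powr (- 1 / p)) G)"
    by (rule is_block_iff_Ls_bounded) (auto intro: pos)
  obtain c l where l: "0 < l" and G': "Ls_bounded \<infinity> c l (wmeas w (cube c l) powr (- 1 / p)) G"
    using G unfolding iff by blast
  have [measurable]: "w \<in> borel_measurable lebesgue" by (rule weight_measurable[OF w])
  define W where "W = wmeas w (cube c l)"
  have W: "0 < W" unfolding W_def by (rule pos[OF l])
  have Wp: "(W powr (- 1 / p)) powr p = 1 / W"
    using W p by (rule powr_root_reciprocal)
  have "AE x in lebesgue. \<bar>G x\<bar> \<le> W powr (- 1 / p)" using G' by (simp add: Ls_bounded_def W_def)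
  then have "AE x in lebesgue. ennreal (w x) * ennreal (\<bar>G x\<bar> powr p)
      \<le> ennreal (1 / W) * (ennreal (w x) * indicator (cube c l) x)"
  proof eventually_elim
    case (elim x)
    show ?case
    proof (cases "x \<in> cube c l")
      case True
      have "\<bar>G x\<bar> powr p \<le> (W powr (- 1 / p)) powr p" using elim p by (intro powr_mono2) auto
      then have "ennreal (w x) * ennreal (\<bar>G x\<bar> powr p) \<le> ennreal (w x) * ennreal (1 / W)"
        unfolding Wp by (intro mult_left_mono ennreal_leI) auto
      then show ?thesis using True by (simp add: mult.commute)
    qed (simp add: Ls_bounded_outside[OF G'])
  qed
  then have "(\<integral>\<^sup>+ x. ennreal (w x) * ennreal (\<bar>G x\<bar> powr p) \<partial>lebesgue)
      \<le> (\<integral>\<^sup>+ x. ennreal (1 / W) * (ennreal (w x) * indicator (cube c l) x) \<partial>lebesgue)"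
    by (rule nn_integral_mono_AE)
  also have "\<dots> = ennreal (1 / W) * (\<integral>\<^sup>+ x \<in> cube c l. ennreal (w x) \<partial>lebesgue)"
    by (rule nn_integral_cmult) measurable
  also have "\<dots> = ennreal (1 / W) * ennreal W"
    unfolding nn_integral_weight_cube[OF w] W_def ..
  also have "\<dots> = ennreal 1" using W by (subst ennreal_mult[symmetric]) auto
  finally show ?thesis .
qed

lemma RH_class_bound:
  fixes w :: "real^'n \<Rightarrow> real"
  assumes w: "w \<in> RH_class r" and r: "0 < r"
  obtains C where "1 \<le> C" "\<And>c l. 0 < l \<Longrightarrow> (\<integral>\<^sup>+ x \<in> cube c l. ennreal (w x powr r) \<partial>lebesgue)
      \<le> ennreal (l ^ CARD('n) * (C * (wmeas w (cube c l) / l ^ CARD('n))) powr r)"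
proof -
  have wt: "weight w" using w by (simp add: RH_class_def)
  obtain C where C: "\<And>c l. 0 < l \<Longrightarrow> (\<lambda>x. w x powr r) absolutely_integrable_on cube c l \<and>
     ((LINT x:cube c l|lebesgue. w x powr r) / measure lebesgue (cube c l)) powr (1 / r)
       \<le> C / measure lebesgue (cube c l) * (LINT x:cube c l|lebesgue. w x)"
    using w by (auto simp: RH_class_def)
  show ?thesis
  proof (rule that[of "max 1 C"])
    fix c :: "real^'n" and l :: real assume l: "0 < l"
    define N where "N = l ^ CARD('n)"
    define W where "W = wmeas w (cube c l)"
    define I where "I = (LINT x:cube c l|lebesgue. w x powr r)"
    have N: "0 < N" using l by (simp add: N_def)
    have meas: "measure lebesgue (cube c l) = N" unfolding N_def using l by (intro measure_cube) auto
    have W0: "0 \<le> W" unfolding W_def by (rule wmeas_nonneg[OF wt])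
    have i: "integrable lebesgue (\<lambda>x. indicator (cube c l) x *\<^sub>R (w x powr r))"
      using C[OF l, of c] unfolding set_integrable_def by blast
    have I0: "0 \<le> I" unfolding I_def set_lebesgue_integral_def
      by (rule Bochner_Integration.integral_nonneg) simp
    have "(I / N) powr (1 / r) \<le> C / N * W"
      using C[OF l, of c] unfolding meas I_def W_def wmeas_def by blast
    also have "\<dots> \<le> max 1 C * (W / N)"
      using N W0 by (simp add: divide_right_mono mult_right_mono)
    finally have "(I / N) powr (1 / r) \<le> max 1 C * (W / N)" .
    then have "I / N \<le> (max 1 C * (W / N)) powr r"
      using I0 N W0 r by (subst (asm) powr_inverse_le_iff) auto
    then have "I \<le> N * (max 1 C * (W / N)) powr r" using N by (simp add: pos_divide_le_eq mult.commute)
    moreover have "(\<integral>\<^sup>+ x. ennreal (indicator (cube c l) x *\<^sub>R (w x powr r)) \<partial>lebesgue) = ennreal I"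
      unfolding I_def set_lebesgue_integral_def by (rule nn_integral_eq_integral[OF i]) simp
    moreover have "(\<lambda>x. ennreal (indicator (cube c l) x *\<^sub>R (w x powr r)))
        = (\<lambda>x. ennreal (w x powr r) * indicator (cube c l) x)"
      by (auto simp: indicator_def)
    ultimately show "(\<integral>\<^sup>+ x \<in> cube c l. ennreal (w x powr r) \<partial>lebesgue)
      \<le> ennreal (l ^ CARD('n) * (max 1 C * (wmeas w (cube c l) / l ^ CARD('n))) powr r)"
      unfolding N_def[symmetric] W_def[symmetric] by (simp add: ennreal_leI)
  qed simp
qed

text \<open>Young's inequality with constants 1: whichever of \<open>x\<^sup>r\<^sup>'\<close> and \<open>y\<^sup>r\<close> is larger, with \<open>r'\<close> the
  conjugate exponent, dominates the product.\<close>

lemma mult_le_powr_add_powr: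
  fixes x y r :: real
  assumes x: "0 \<le> x" and y: "0 \<le> y" and r: "1 < r"
  shows "x * y \<le> x powr (r / (r - 1)) + y powr r"
proof (cases "y \<le> x powr (1 / (r - 1))")
  case True
  have "x * y \<le> x * x powr (1 / (r - 1))" using True x by (intro mult_left_mono)
  also have "\<dots> = x powr (1 + 1 / (r - 1))" using x by (rule powr_mult_base)
  also have "1 + 1 / (r - 1) = r / (r - 1)" using r by (simp add: field_simps)
  finally show ?thesis by (simp add: add_increasing2)
next
  case False
  then have "x \<le> y powr (r - 1)"
    using powr_inverse_le_iff[of x y "r - 1"] x y r by simp
  then have "y * x \<le> y * y powr (r - 1)" using y by (rule mult_left_mono)
  also have "\<dots> = y powr r" using powr_mult_base[of y "r - 1"] y by simp
  finally show ?thesis by (simp add: add_increasing mult.commute)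
qed

lemma powr_le_one_add_powr:
  fixes t a b :: real
  assumes "0 \<le> t" "0 \<le> a" "a \<le> b"
  shows "t powr a \<le> 1 + t powr b"
proof (cases "t \<le> 1")
  case True
  then have "t powr a \<le> 1" using assms by (intro powr_le1) auto
  then show ?thesis by (simp add: add_increasing2)
next
  case False
  then have "t powr a \<le> t powr b" using assms by (intro powr_mono) auto
  then show ?thesis by simp
qed

text \<open>Normalise \<open>t = \<bar>G\<bar> / \<alpha>\<close> and \<open>v = w / u\<close>, where \<open>u\<close> is the mean of \<open>w\<close> over the cube. Young's
  inequality bounds \<open>t\<^sup>p v\<close> by a power of \<open>t\<close> of order \<open>r p / (r - 1)\<close>, hence by \<open>1 + t\<^sup>\<sigma>\<close>, plus \<open>v\<^sup>r\<close>. The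
  means of \<open>t\<^sup>\<sigma>\<close> and \<open>v\<^sup>r\<close> are bounded by the block condition and by the reverse Hoelder condition.\<close>

lemma block_Lp_bound:
  fixes w :: "real^'n \<Rightarrow> real"
  assumes p: "0 < p" and r: "1 < r" and w: "w \<in> RH_class r"
    and pos: "\<And>c l. 0 < l \<Longrightarrow> 0 < wmeas w (cube c l)"
    and \<sigma>: "1 < \<sigma>" "r * p / (r - 1) \<le> \<sigma>"
  obtains B where "0 \<le> B" "\<And>G. is_block p (ennreal \<sigma>) w G \<Longrightarrow>
    (\<integral>\<^sup>+ x. ennreal (w x) * ennreal (\<bar>G x\<bar> powr p) \<partial>lebesgue) \<le> ennreal B"
proof -
  have wt: "weight w" using w by (simp add: RH_class_def)
  have [measurable]: "w \<in> borel_measurable lebesgue" by (rule weight_measurable[OF wt])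
  have w0: "0 \<le> w x" for x using wt by (simp add: weight_def)
  have r0: "0 < r" using r by simp
  obtain C where C: "1 \<le> C" "\<And>c l. 0 < l \<Longrightarrow> (\<integral>\<^sup>+ x \<in> cube c l. ennreal (w x powr r) \<partial>lebesgue)
      \<le> ennreal (l ^ CARD('n) * (C * (wmeas w (cube c l) / l ^ CARD('n))) powr r)"
    using RH_class_bound[OF w r0] by blast
  show ?thesis
  proof (rule that[of "2 + C powr r"])
    fix G assume G: "is_block p (ennreal \<sigma>) w G"
    have iff: "is_block p (ennreal \<sigma>) w G \<longleftrightarrow>
      (\<exists>c l. 0 < l \<and> Ls_bounded (ennreal \<sigma>) c l (wmeas w (cube c l) powr (- 1 / p)) G)"
      by (rule is_block_iff_Ls_bounded) (use \<sigma> in \<open>auto intro: pos\<close>)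
    obtain c l where l: "0 < l" and G': "Ls_bounded (ennreal \<sigma>) c l (wmeas w (cube c l) powr (- 1 / p)) G"
      using G unfolding iff by blast
    note [measurable] = Ls_bounded_measurable[OF G']
    define N where "N = l ^ CARD('n)"
    define W where "W = wmeas w (cube c l)"
    define \<alpha> where "\<alpha> = W powr (- 1 / p)"
    define u where "u = W / N"
    have N: "0 < N" using l by (simp add: N_def)
    have W: "0 < W" unfolding W_def by (rule pos[OF l])
    have \<alpha>: "0 < \<alpha>" using W by (simp add: \<alpha>_def)
    have u: "0 < u" using W N by (simp add: u_def)
    have \<alpha>p: "\<alpha> powr p = 1 / W"
      unfolding \<alpha>_def using W p by (rule powr_root_reciprocal)
    have Gint: "(\<integral>\<^sup>+ x. ennreal (\<bar>G x\<bar> powr \<sigma>) \<partial>lebesgue) \<le> ennreal (N * \<alpha> powr \<sigma>)"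
      using G' \<sigma> unfolding N_def \<alpha>_def W_def by (simp add: Ls_bounded_def)
    have wint: "(\<integral>\<^sup>+ x \<in> cube c l. ennreal (w x powr r) \<partial>lebesgue) \<le> ennreal (N * (C * u) powr r)"
      using C(2)[OF l, of c] unfolding N_def u_def W_def .
    define k1 k2 where "k1 = 1 / (N * \<alpha> powr \<sigma>)" and "k2 = 1 / (N * u powr r)"
    have k: "0 \<le> k1" "0 \<le> k2" using N by (auto simp: k1_def k2_def)
    have pt: "w x * \<bar>G x\<bar> powr p \<le> 1 / N + k1 * \<bar>G x\<bar> powr \<sigma> + k2 * w x powr r" for x
    proof -
      define t v where "t = \<bar>G x\<bar> / \<alpha>" and "v = w x / u"
      have t: "0 \<le> t" and v: "0 \<le> v" using \<alpha> u w0 by (auto simp: t_def v_def)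
      have "t powr p * v \<le> (t powr p) powr (r / (r - 1)) + v powr r"
        using t v r by (intro mult_le_powr_add_powr) auto
      also have "(t powr p) powr (r / (r - 1)) = t powr (r * p / (r - 1))"
        by (simp add: powr_powr mult.commute)
      also have "\<dots> \<le> 1 + t powr \<sigma>"
        using t p r \<sigma> by (intro powr_le_one_add_powr) auto
      finally have le: "t powr p * v \<le> 1 + t powr \<sigma> + v powr r" by simp
      have "w x * \<bar>G x\<bar> powr p = \<alpha> powr p * u * (t powr p * v)"
        using \<alpha> u by (simp add: t_def v_def powr_divide)
      also have "\<alpha> powr p * u = 1 / N" unfolding \<alpha>p u_def using W by simp
      also have "1 / N * (t powr p * v) \<le> 1 / N * (1 + t powr \<sigma> + v powr r)"
        using N by (intro mult_left_mono le) auto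
      also have "\<dots> = 1 / N + k1 * \<bar>G x\<bar> powr \<sigma> + k2 * w x powr r"
        by (simp add: t_def v_def k1_def k2_def powr_divide add_divide_distrib mult.commute)
      finally show ?thesis .
    qed
    have "(\<integral>\<^sup>+ x. ennreal (w x) * ennreal (\<bar>G x\<bar> powr p) \<partial>lebesgue)
      \<le> (\<integral>\<^sup>+ x. ennreal (1 / N) * indicator (cube c l) x + (ennreal k1 * ennreal (\<bar>G x\<bar> powr \<sigma>)
          + ennreal k2 * (ennreal (w x powr r) * indicator (cube c l) x)) \<partial>lebesgue)"
    proof (rule nn_integral_mono)
      fix x
      show "ennreal (w x) * ennreal (\<bar>G x\<bar> powr p) \<le> ennreal (1 / N) * indicator (cube c l) x
          + (ennreal k1 * ennreal (\<bar>G x\<bar> powr \<sigma>) + ennreal k2 * (ennreal (w x powr r) * indicator (cube c l) x))"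
      proof (cases "x \<in> cube c l")
        case True
        have "ennreal (w x) * ennreal (\<bar>G x\<bar> powr p) = ennreal (w x * \<bar>G x\<bar> powr p)"
          using w0 by (simp add: ennreal_mult)
        also have "\<dots> \<le> ennreal (1 / N + k1 * \<bar>G x\<bar> powr \<sigma> + k2 * w x powr r)"
          by (rule ennreal_leI[OF pt])
        also have "\<dots> = ennreal (1 / N) + (ennreal (k1 * \<bar>G x\<bar> powr \<sigma>) + ennreal (k2 * w x powr r))"
          using N k by (simp add: ennreal_plus add.assoc)
        finally show ?thesis using True k by (simp add: ennreal_mult)
      qed (simp add: Ls_bounded_outside[OF G'])
    qed
    also have "\<dots> = (\<integral>\<^sup>+ x. ennreal (1 / N) * indicator (cube c l) x \<partial>lebesgue)
        + ((\<integral>\<^sup>+ x. ennreal k1 * ennreal (\<bar>G x\<bar> powr \<sigma>) \<partial>lebesgue)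
          + (\<integral>\<^sup>+ x. ennreal k2 * (ennreal (w x powr r) * indicator (cube c l) x) \<partial>lebesgue))"
    proof -
      have "(\<integral>\<^sup>+ x. ennreal (1 / N) * indicator (cube c l) x + (ennreal k1 * ennreal (\<bar>G x\<bar> powr \<sigma>)
          + ennreal k2 * (ennreal (w x powr r) * indicator (cube c l) x)) \<partial>lebesgue)
        = (\<integral>\<^sup>+ x. ennreal (1 / N) * indicator (cube c l) x \<partial>lebesgue)
          + (\<integral>\<^sup>+ x. ennreal k1 * ennreal (\<bar>G x\<bar> powr \<sigma>)
          + ennreal k2 * (ennreal (w x powr r) * indicator (cube c l) x) \<partial>lebesgue)"
        by (rule nn_integral_add) measurable
      also have "(\<integral>\<^sup>+ x. ennreal k1 * ennreal (\<bar>G x\<bar> powr \<sigma>)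
          + ennreal k2 * (ennreal (w x powr r) * indicator (cube c l) x) \<partial>lebesgue)
        = (\<integral>\<^sup>+ x. ennreal k1 * ennreal (\<bar>G x\<bar> powr \<sigma>) \<partial>lebesgue)
          + (\<integral>\<^sup>+ x. ennreal k2 * (ennreal (w x powr r) * indicator (cube c l) x) \<partial>lebesgue)"
        by (rule nn_integral_add) measurable
      finally show ?thesis .
    qed
    also have "(\<integral>\<^sup>+ x. ennreal (1 / N) * indicator (cube c l) x \<partial>lebesgue) = ennreal 1"
    proof -
      have "(\<integral>\<^sup>+ x. ennreal (1 / N) * indicator (cube c l) x \<partial>lebesgue) = ennreal (l ^ CARD('n) * (1 / N))"
        using l N by (intro nn_integral_const_on_cube) auto
      also have "l ^ CARD('n) * (1 / N) = 1" using l by (simp add: N_def)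
      finally show ?thesis .
    qed
    also have "(\<integral>\<^sup>+ x. ennreal k1 * ennreal (\<bar>G x\<bar> powr \<sigma>) \<partial>lebesgue)
        = ennreal k1 * (\<integral>\<^sup>+ x. ennreal (\<bar>G x\<bar> powr \<sigma>) \<partial>lebesgue)"
      by (rule nn_integral_cmult) measurable
    also have "(\<integral>\<^sup>+ x. ennreal k2 * (ennreal (w x powr r) * indicator (cube c l) x) \<partial>lebesgue)
        = ennreal k2 * (\<integral>\<^sup>+ x \<in> cube c l. ennreal (w x powr r) \<partial>lebesgue)"
      by (rule nn_integral_cmult) measurable
    also have "ennreal 1 + (ennreal k1 * (\<integral>\<^sup>+ x. ennreal (\<bar>G x\<bar> powr \<sigma>) \<partial>lebesgue)
          + ennreal k2 * (\<integral>\<^sup>+ x \<in> cube c l. ennreal (w x powr r) \<partial>lebesgue))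
        \<le> ennreal 1 + (ennreal k1 * ennreal (N * \<alpha> powr \<sigma>) + ennreal k2 * ennreal (N * (C * u) powr r))"
      by (intro add_mono order_refl mult_left_mono Gint wint) auto
    also have "ennreal k1 * ennreal (N * \<alpha> powr \<sigma>) = ennreal 1"
    proof -
      have "k1 * (N * \<alpha> powr \<sigma>) = 1" using N \<alpha> by (simp add: k1_def)
      then show ?thesis using ennreal_mult'[OF k(1), of "N * \<alpha> powr \<sigma>"] by simp
    qed
    also have "ennreal k2 * ennreal (N * (C * u) powr r) = ennreal (C powr r)"
    proof -
      have "k2 * (N * (C * u) powr r) = C powr r" using N u by (simp add: k2_def powr_mult)
      then show ?thesis using ennreal_mult'[OF k(2), of "N * (C * u) powr r"] by simp
    qed
    also have "ennreal 1 + (ennreal 1 + ennreal (C powr r)) = ennreal (1 + (1 + C powr r))"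
    proof -
      have "ennreal (1 + (1 + C powr r)) = ennreal 1 + ennreal (1 + C powr r)" by (rule ennreal_plus) auto
      also have "ennreal (1 + C powr r) = ennreal 1 + ennreal (C powr r)" by (rule ennreal_plus) auto
      finally show ?thesis by (rule sym)
    qed
    also have "1 + (1 + C powr r) = 2 + C powr r" by simp
    finally show "(\<integral>\<^sup>+ x. ennreal (w x) * ennreal (\<bar>G x\<bar> powr p) \<partial>lebesgue) \<le> ennreal (2 + C powr r)" .
  qed simp
qed

text \<open>The reverse doubling that the reverse Hoelder condition entails: the mass of a fixed cube can
  fill only a small part of the mass of a large cube \<open>Q\<close> that contains it, so \<open>w(Q)\<close> grows at least
  like \<open>\<bar>Q\<bar>\<close> to the power \<open>(r - 1) / r\<close>. Since \<open>Q\<close> only meets the fixed cube, the argument runs on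
  \<open>3Q\<close> and returns to \<open>Q\<close> by doubling.\<close>

lemma RH_class_wmeas_lower:
  fixes w :: "real^'n \<Rightarrow> real"
  assumes D: "w \<in> D_class q" and P: "w \<in> P_class" and w: "w \<in> RH_class r" and r: "1 < r" and R: "0 < R"
  obtains k where "0 < k" "\<And>c l. R < l \<Longrightarrow> cube 0 R \<inter> cube c l \<noteq> {} \<Longrightarrow>
    k * (l ^ CARD('n)) powr ((r - 1) / r) \<le> wmeas w (cube c l)"
proof -
  have wt: "weight w" using w by (simp add: RH_class_def)
  have [measurable]: "w \<in> borel_measurable lebesgue" by (rule weight_measurable[OF wt])
  have w0: "0 \<le> w x" for x using wt by (simp add: weight_def)
  have r0: "0 < r" using r by simp
  note pos = wmeas_cube_pos[OF D P]
  obtain C where C: "1 \<le> C" "\<And>c l. 0 < l \<Longrightarrow> (\<integral>\<^sup>+ x \<in> cube c l. ennreal (w x powr r) \<partial>lebesgue)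
      \<le> ennreal (l ^ CARD('n) * (C * (wmeas w (cube c l) / l ^ CARD('n))) powr r)"
    using RH_class_bound[OF w r0] by blast
  obtain E where E: "1 \<le> E" "\<And>c l t. 0 < l \<Longrightarrow> 1 < t \<Longrightarrow>
     wmeas w (cube c (t * l)) \<le> E * t powr (real CARD('n) * q) * wmeas w (cube c l)"
    using D_class_bound[OF D] by blast
  define W where "W = wmeas w (cube (0 :: real^'n) R)"
  have W: "0 < W" unfolding W_def by (rule pos[OF R])
  \<comment> \<open>Half the mean of \<open>w\<close> over the fixed cube: the part of \<open>w\<close> below \<open>\<tau>\<close> carries at most half of \<open>W\<close>.\<close>
  define \<tau> where "\<tau> = W / (2 * R ^ CARD('n))"
  have \<tau>: "0 < \<tau>" using W R by (simp add: \<tau>_def)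
  define e where "e = E * 3 powr (real CARD('n) * q)"
  have e: "0 < e" using E(1) by (simp add: e_def)
  define k where "k = (W / 2 * \<tau> powr (r - 1)) powr (1 / r) / (C * e)"
  show ?thesis
  proof (rule that[of k])
    show "0 < k" using W \<tau> C(1) e by (simp add: k_def)
    fix c :: "real^'n" and l :: real assume l: "R < l" and meet: "cube 0 R \<inter> cube c l \<noteq> {}"
    have l0: "0 < l" using l R by simp
    define N where "N = (3 * l) ^ CARD('n)"
    define X where "X = wmeas w (cube c (3 * l))"
    have N: "0 < N" using l0 by (simp add: N_def)
    have X: "0 < X" unfolding X_def using l0 by (intro pos) simp
    have sub: "cube 0 R \<subseteq> cube c (3 * l)" by (rule cube_meet_subset[OF meet]) (use l in simp)
    have "ennreal W = (\<integral>\<^sup>+ x \<in> cube 0 R. ennreal (w x) \<partial>lebesgue)"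
      unfolding W_def by (rule nn_integral_weight_cube[OF wt, symmetric])
    also have "\<dots> \<le> (\<integral>\<^sup>+ x. ennreal \<tau> * indicator (cube 0 R) x
        + ennreal (\<tau> powr (1 - r)) * (ennreal (w x powr r) * indicator (cube c (3 * l)) x) \<partial>lebesgue)"
    proof (rule nn_integral_mono)
      fix x
      show "ennreal (w x) * indicator (cube 0 R) x \<le> ennreal \<tau> * indicator (cube 0 R) x
        + ennreal (\<tau> powr (1 - r)) * (ennreal (w x powr r) * indicator (cube c (3 * l)) x)"
      proof (cases "x \<in> cube 0 R")
        case True
        have "ennreal (w x) \<le> ennreal (\<tau> + \<tau> powr (1 - r) * w x powr r)"
          using w0 \<tau> r by (intro ennreal_leI le_add_powr_mult_powr) auto
        then show ?thesis using True sub \<tau> by (auto simp: ennreal_mult)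
      qed simp
    qed
    also have "\<dots> = (\<integral>\<^sup>+ x. ennreal \<tau> * indicator (cube (0 :: real^'n) R) x \<partial>lebesgue)
        + (\<integral>\<^sup>+ x. ennreal (\<tau> powr (1 - r)) * (ennreal (w x powr r) * indicator (cube c (3 * l)) x) \<partial>lebesgue)"
      by (rule nn_integral_add) measurable
    also have "(\<integral>\<^sup>+ x. ennreal \<tau> * indicator (cube (0 :: real^'n) R) x \<partial>lebesgue) = ennreal (R ^ CARD('n) * \<tau>)"
      using R \<tau> by (intro nn_integral_const_on_cube) auto
    also have "(\<integral>\<^sup>+ x. ennreal (\<tau> powr (1 - r)) * (ennreal (w x powr r) * indicator (cube c (3 * l)) x) \<partial>lebesgue)
        = ennreal (\<tau> powr (1 - r)) * (\<integral>\<^sup>+ x \<in> cube c (3 * l). ennreal (w x powr r) \<partial>lebesgue)"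
      by (rule nn_integral_cmult) measurable
    also have "ennreal (R ^ CARD('n) * \<tau>) + ennreal (\<tau> powr (1 - r)) * (\<integral>\<^sup>+ x \<in> cube c (3 * l). ennreal (w x powr r) \<partial>lebesgue)
        \<le> ennreal (R ^ CARD('n) * \<tau>) + ennreal (\<tau> powr (1 - r)) * ennreal (N * (C * (X / N)) powr r)"
      unfolding N_def X_def using l0 by (intro add_left_mono mult_left_mono C(2)) auto
    also have "\<dots> = ennreal (R ^ CARD('n) * \<tau> + \<tau> powr (1 - r) * (N * (C * (X / N)) powr r))"
      using R \<tau> N by (simp add: ennreal_mult)
    also have "R ^ CARD('n) * \<tau> = W / 2" using R by (simp add: \<tau>_def)
    finally have "W \<le> W / 2 + \<tau> powr (1 - r) * (N * (C * (X / N)) powr r)"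
      using W N by (subst (asm) ennreal_le_iff) auto
    then have "W / 2 \<le> \<tau> powr (1 - r) * (N * (C * (X / N)) powr r)" by simp
    then have "\<tau> powr (r - 1) * (W / 2) \<le> \<tau> powr (r - 1) * (\<tau> powr (1 - r) * (N * (C * (X / N)) powr r))"
      by (rule mult_left_mono) simp
    also have "\<dots> = N * (C * (X / N)) powr r"
      using \<tau> by (simp add: mult.assoc[symmetric] powr_add[symmetric])
    also have "\<dots> = (C * X * N powr (- ((r - 1) / r))) powr r"
    proof -
      have "(N powr (- ((r - 1) / r))) powr r = N powr (1 - r)"
        using r by (simp add: powr_powr)
      moreover have "N * (1 / N) powr r = N powr (1 - r)"
        using N by (simp add: powr_divide powr_diff)
      moreover have "(C * (X / N)) powr r = (C * X) powr r * (1 / N) powr r"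
        by (simp add: powr_mult[symmetric])
      ultimately show ?thesis by (simp only: powr_mult[of "C * X"]) (simp add: mult_ac)
    qed
    finally have "W / 2 * \<tau> powr (r - 1) \<le> (C * X * N powr (- ((r - 1) / r))) powr r"
      by (simp only: mult.commute)
    then have "(W / 2 * \<tau> powr (r - 1)) powr (1 / r) \<le> C * X * N powr (- ((r - 1) / r))"
      using W X C(1) r by (subst powr_inverse_le_iff) auto
    also have "\<dots> = C * X / N powr ((r - 1) / r)"
      by (simp only: powr_minus_divide times_divide_eq_right mult_1_right)
    finally have "(W / 2 * \<tau> powr (r - 1)) powr (1 / r) * N powr ((r - 1) / r) \<le> C * X"
      using N by (simp add: pos_le_divide_eq)
    moreover have "(l ^ CARD('n)) powr ((r - 1) / r) \<le> N powr ((r - 1) / r)"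
      unfolding N_def using l0 r by (intro powr_mono2 power_mono) auto
    then have "(W / 2 * \<tau> powr (r - 1)) powr (1 / r) * (l ^ CARD('n)) powr ((r - 1) / r)
        \<le> (W / 2 * \<tau> powr (r - 1)) powr (1 / r) * N powr ((r - 1) / r)"
      by (rule mult_left_mono) simp
    moreover have "C * X \<le> C * (e * wmeas w (cube c l))"
      unfolding X_def e_def using E(2)[OF l0, of 3 c] C(1) by (intro mult_left_mono) auto
    ultimately have "(W / 2 * \<tau> powr (r - 1)) powr (1 / r) * (l ^ CARD('n)) powr ((r - 1) / r)
        \<le> C * (e * wmeas w (cube c l))" by linarith
    then show "k * (l ^ CARD('n)) powr ((r - 1) / r) \<le> wmeas w (cube c l)"
      unfolding k_def using C(1) e by (simp add: pos_divide_le_eq mult_ac)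
  qed
qed


text \<open>A block on a small cube has integral at most a multiple of \<open>l\<^sup>n \<alpha>\<close>, and doubling bounds \<open>\<alpha>\<close> by a
  power of \<open>1 / l\<close> of order \<open>n q / p < n\<close>. For a block on a large cube this would be useless; there the
  integral over the fixed cube is at most \<open>R\<^sup>n + l\<^sup>n \<alpha>\<^sup>\<sigma>\<close>, which stays bounded because the growth of \<open>w(Q)\<close>
  makes \<open>l\<^sup>n \<alpha>\<^sup>\<sigma>\<close> a power of \<open>l\<^sup>n\<close> with exponent \<open>1 - \<sigma> (r - 1) / (r p) \<le> 0\<close>.\<close>

lemma block_local_L1_bound:
  fixes w :: "real^'n \<Rightarrow> real"
  assumes q: "0 < q" "q < p" and D: "w \<in> D_class q" and P: "w \<in> P_class" and w: "w \<in> RH_class r"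
    and r: "1 < r" and \<sigma>: "1 < \<sigma>" "r * p / (r - 1) \<le> \<sigma>" and R: "0 < R"
  obtains B where "0 \<le> B" "\<And>G. is_block p (ennreal \<sigma>) w G \<Longrightarrow>
    (\<integral>\<^sup>+ x \<in> cube 0 R. ennreal \<bar>G x\<bar> \<partial>lebesgue) \<le> ennreal B"
proof -
  have p: "0 < p" using q by simp
  note pos = wmeas_cube_pos[OF D P]
  have iff: "is_block p (ennreal \<sigma>) w G \<longleftrightarrow>
      (\<exists>c l. 0 < l \<and> Ls_bounded (ennreal \<sigma>) c l (wmeas w (cube c l) powr (- 1 / p)) G)" for G
    by (rule is_block_iff_Ls_bounded) (use \<sigma> in \<open>auto intro: pos\<close>)
  have wt: "weight w" using w by (simp add: RH_class_def)
  obtain E where E: "1 \<le> E" "\<And>c l t. 0 < l \<Longrightarrow> 1 < t \<Longrightarrow>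
     wmeas w (cube c (t * l)) \<le> E * t powr (real CARD('n) * q) * wmeas w (cube c l)"
    using D_class_bound[OF D] by blast
  obtain k where k: "0 < k" "\<And>c l. R < l \<Longrightarrow> cube 0 R \<inter> cube c l \<noteq> {} \<Longrightarrow>
    k * (l ^ CARD('n)) powr ((r - 1) / r) \<le> wmeas w (cube c l)"
    using RH_class_wmeas_lower[OF D P w r R] by blast
  define V where "V = wmeas w (cube (0 :: real^'n) R)"
  have V: "0 < V" unfolding V_def by (rule pos[OF R])
  define e where "e = 1 - \<sigma> * ((r - 1) / (r * p))"
  have e: "e \<le> 0"
  proof -
    have "r * p \<le> \<sigma> * (r - 1)" using \<sigma>(2) r by (simp add: pos_divide_le_eq)
    then show ?thesis unfolding e_def using r p by (simp add: pos_le_divide_eq)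
  qed
  define B1 where "B1 = 2 * (V powr (- 1 / p) * E powr (1 / p)) * (3 * R) ^ CARD('n)"
  define B2 where "B2 = R ^ CARD('n) + k powr (- \<sigma> / p) * (R ^ CARD('n)) powr e"
  have B1: "0 \<le> B1" using R by (simp add: B1_def)
  show ?thesis
  proof (rule that[of "max B1 B2"])
    show "0 \<le> max B1 B2" using B1 by simp
    fix G assume "is_block p (ennreal \<sigma>) w G"
    then obtain c l where l: "0 < l"
      and G: "Ls_bounded (ennreal \<sigma>) c l (wmeas w (cube c l) powr (- 1 / p)) G"
      unfolding iff by blast
    note [measurable] = Ls_bounded_measurable[OF G]
    define W where "W = wmeas w (cube c l)"
    define \<alpha> where "\<alpha> = W powr (- 1 / p)"
    note G = G[folded W_def, folded \<alpha>_def]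
    have W: "0 < W" unfolding W_def by (rule pos[OF l])
    have \<alpha>: "0 < \<alpha>" using W by (simp add: \<alpha>_def)
    show "(\<integral>\<^sup>+ x \<in> cube 0 R. ennreal \<bar>G x\<bar> \<partial>lebesgue) \<le> ennreal (max B1 B2)"
    proof (cases "cube 0 R \<inter> cube c l = {}")
      case True
      then have "(\<integral>\<^sup>+ x \<in> cube 0 R. ennreal \<bar>G x\<bar> \<partial>lebesgue) = (\<integral>\<^sup>+ x. 0 \<partial>(lebesgue :: (real^'n) measure))"
        using Ls_bounded_outside[OF G] by (intro nn_integral_cong) (auto simp: indicator_def)
      then show ?thesis by simp
    next
      case meet: False
      show ?thesis
      proof (cases "l \<le> R")
        case True
        define t where "t = 3 * R / l"
        have t: "1 < t" using True l R by (simp add: t_def)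
        have "cube 0 R \<subseteq> cube c (3 * R)" by (rule cube_meet_subset[OF meet]) (use True in simp)
        then have "V \<le> wmeas w (cube c (t * l))"
          unfolding V_def t_def using l by (intro wmeas_mono[OF wt]) simp
        also have "\<dots> \<le> E * t powr (real CARD('n) * q) * W"
          unfolding W_def using l t by (intro E(2))
        finally have "V / (E * t powr (real CARD('n) * q)) \<le> W"
          using E(1) t by (simp add: pos_divide_le_eq mult.commute)
        then have "\<alpha> \<le> (V / (E * t powr (real CARD('n) * q))) powr (- 1 / p)"
          unfolding \<alpha>_def using V E(1) t p by (intro powr_mono2') auto
        also have "\<dots> = V powr (- 1 / p) * (E * t powr (real CARD('n) * q)) powr (1 / p)"
          using powr_minus_divide[of "E * t powr (real CARD('n) * q)" "1 / p"] unfolding powr_divide by simp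
        also have "(E * t powr (real CARD('n) * q)) powr (1 / p) = E powr (1 / p) * t powr (real CARD('n) * q / p)"
          by (simp add: powr_mult powr_powr)
        also have "V powr (- 1 / p) * (E powr (1 / p) * t powr (real CARD('n) * q / p))
            \<le> V powr (- 1 / p) * (E powr (1 / p) * t powr real CARD('n))"
          using t q p by (intro mult_left_mono powr_mono) (auto simp: pos_divide_le_eq)
        also have "t powr real CARD('n) = t ^ CARD('n)" using t by (intro powr_realpow) auto
        finally have \<alpha>le: "\<alpha> \<le> V powr (- 1 / p) * (E powr (1 / p) * t ^ CARD('n))" .
        have "(\<integral>\<^sup>+ x \<in> cube 0 R. ennreal \<bar>G x\<bar> \<partial>lebesgue) \<le> (\<integral>\<^sup>+ x. ennreal \<bar>G x\<bar> \<partial>lebesgue)"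
          by (intro nn_integral_mono) (auto simp: indicator_def)
        also have "\<dots> \<le> ennreal (2 * l ^ CARD('n) * \<alpha>)"
          by (rule Ls_bounded_nn_integral_le[OF G]) (use \<sigma> l \<alpha> in auto)
        also have "\<dots> \<le> ennreal (2 * l ^ CARD('n) * (V powr (- 1 / p) * (E powr (1 / p) * t ^ CARD('n))))"
          using l by (intro ennreal_leI mult_left_mono \<alpha>le) auto
        also have "2 * l ^ CARD('n) * (V powr (- 1 / p) * (E powr (1 / p) * t ^ CARD('n))) = B1"
        proof -
          have "l ^ CARD('n) * t ^ CARD('n) = (3 * R) ^ CARD('n)"
            unfolding power_mult_distrib[symmetric] t_def using l by simp
          then show ?thesis unfolding B1_def by (simp add: mult_ac)
        qed
        also have "ennreal B1 \<le> ennreal (max B1 B2)" by (intro ennreal_leI) simp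
        finally show ?thesis .
      next
        case False
        define N where "N = l ^ CARD('n)"
        have N: "0 < N" using l by (simp add: N_def)
        have "k * N powr ((r - 1) / r) \<le> W" unfolding W_def N_def using False meet by (intro k(2)) auto
        then have "\<alpha> \<le> (k * N powr ((r - 1) / r)) powr (- 1 / p)"
          unfolding \<alpha>_def using k(1) N p by (intro powr_mono2') auto
        then have "\<alpha> powr \<sigma> \<le> ((k * N powr ((r - 1) / r)) powr (- 1 / p)) powr \<sigma>"
          using \<alpha> \<sigma> by (intro powr_mono2) auto
        also have "\<dots> = k powr (- \<sigma> / p) * N powr (e - 1)"
        proof -
          have e1: "- 1 / p * \<sigma> = - \<sigma> / p" by simp
          have e2: "(r - 1) / r * (- 1 / p) * \<sigma> = e - 1" by (simp add: e_def)
          show ?thesis by (simp only: powr_powr powr_mult e1 e2)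
        qed
        finally have "N * \<alpha> powr \<sigma> \<le> N * (k powr (- \<sigma> / p) * N powr (e - 1))"
          using N by (intro mult_left_mono) auto
        also have "\<dots> = k powr (- \<sigma> / p) * N powr e"
          using powr_mult_base[of N "e - 1"] N by (simp add: mult_ac)
        also have "\<dots> \<le> k powr (- \<sigma> / p) * (R ^ CARD('n)) powr e"
          unfolding N_def using e R False by (intro mult_left_mono powr_mono2' power_mono) auto
        finally have N\<alpha>: "N * \<alpha> powr \<sigma> \<le> k powr (- \<sigma> / p) * (R ^ CARD('n)) powr e" .
        have "(\<integral>\<^sup>+ x \<in> cube 0 R. ennreal \<bar>G x\<bar> \<partial>lebesgue)
            \<le> (\<integral>\<^sup>+ x. ennreal 1 * indicator (cube 0 R) x + ennreal (\<bar>G x\<bar> powr \<sigma>) \<partial>lebesgue)"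
        proof (rule nn_integral_mono)
          fix x
          show "ennreal \<bar>G x\<bar> * indicator (cube 0 R) x
              \<le> ennreal 1 * indicator (cube 0 R) x + ennreal (\<bar>G x\<bar> powr \<sigma>)"
          proof (cases "x \<in> cube 0 R")
            case True
            \<comment> \<open>Threshold 1: the local integral need only be bounded, not scale correctly.\<close>
            have "ennreal \<bar>G x\<bar> \<le> ennreal (1 + 1 powr (1 - \<sigma>) * \<bar>G x\<bar> powr \<sigma>)"
              using \<sigma> by (intro ennreal_leI le_add_powr_mult_powr) auto
            then show ?thesis using True by simp
          qed simp
        qed
        also have "\<dots> = (\<integral>\<^sup>+ x. ennreal 1 * indicator (cube (0 :: real^'n) R) x \<partial>lebesgue)
            + (\<integral>\<^sup>+ x. ennreal (\<bar>G x\<bar> powr \<sigma>) \<partial>lebesgue)"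
          by (rule nn_integral_add) measurable
        also have "(\<integral>\<^sup>+ x. ennreal 1 * indicator (cube (0 :: real^'n) R) x \<partial>lebesgue) = ennreal (R ^ CARD('n) * 1)"
          using R by (intro nn_integral_const_on_cube) auto
        also have "ennreal (R ^ CARD('n) * 1) + (\<integral>\<^sup>+ x. ennreal (\<bar>G x\<bar> powr \<sigma>) \<partial>lebesgue)
            \<le> ennreal (R ^ CARD('n) * 1) + ennreal (N * \<alpha> powr \<sigma>)"
          using G \<sigma> unfolding N_def by (intro add_left_mono) (simp add: Ls_bounded_def)
        also have "\<dots> \<le> ennreal (R ^ CARD('n) * 1) + ennreal (k powr (- \<sigma> / p) * (R ^ CARD('n)) powr e)"
          by (intro add_left_mono ennreal_leI N\<alpha>)
        also have "\<dots> = ennreal B2"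
          unfolding B2_def using R by (subst ennreal_plus[symmetric]) auto
        also have "\<dots> \<le> ennreal (max B1 B2)" by (intro ennreal_leI) simp
        finally show ?thesis .
      qed
    qed
  qed
qed

lemma block_series_finite_AE:
  fixes w :: "real^'n \<Rightarrow> real"
  assumes q: "0 < q" "q < p" and D: "w \<in> D_class q" and P: "w \<in> P_class" and w: "w \<in> RH_class r"
    and r: "1 < r" and \<sigma>: "1 < \<sigma>" "r * p / (r - 1) \<le> \<sigma>"
    and \<nu>: "\<And>m. 0 \<le> \<nu> m" "summable \<nu>" and G: "\<And>m. is_block p (ennreal \<sigma>) w (G m)"
  shows "AE x in lebesgue. (\<Sum>m. ennreal (\<nu> m) * ennreal \<bar>G m x\<bar>) < \<infinity>"
proof -
  define U where "U = (\<lambda>x. \<Sum>m. ennreal (\<nu> m) * ennreal \<bar>G m x\<bar>)"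
  have [measurable]: "G m \<in> borel_measurable lebesgue" for m by (rule is_block_measurable[OF G])
  have [measurable]: "U \<in> borel_measurable lebesgue" unfolding U_def by measurable
  have "AE x in lebesgue. U x * indicator (cube 0 (real (Suc k))) x \<noteq> \<infinity>" for k
  proof -
    have R: "0 < real (Suc k)" by simp
    obtain B where B: "0 \<le> B" "\<And>G. is_block p (ennreal \<sigma>) w G \<Longrightarrow>
      (\<integral>\<^sup>+ x \<in> cube 0 (real (Suc k)). ennreal \<bar>G x\<bar> \<partial>lebesgue) \<le> ennreal B"
      using block_local_L1_bound[OF q D P w r \<sigma> R] by blast
    have "(\<integral>\<^sup>+ x. U x * indicator (cube 0 (real (Suc k))) x \<partial>lebesgue)
      = (\<integral>\<^sup>+ x. (\<Sum>m. ennreal (\<nu> m) * (ennreal \<bar>G m x\<bar> * indicator (cube 0 (real (Suc k))) x)) \<partial>lebesgue)"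
      unfolding U_def by (intro nn_integral_cong) (simp only: ennreal_suminf_multc[symmetric] mult.assoc)
    also have "\<dots> = (\<Sum>m. \<integral>\<^sup>+ x. ennreal (\<nu> m) * (ennreal \<bar>G m x\<bar> * indicator (cube 0 (real (Suc k))) x) \<partial>lebesgue)"
      by (rule nn_integral_suminf) measurable
    also have "\<dots> = (\<Sum>m. ennreal (\<nu> m) * (\<integral>\<^sup>+ x \<in> cube 0 (real (Suc k)). ennreal \<bar>G m x\<bar> \<partial>lebesgue))"
      by (intro suminf_cong nn_integral_cmult) measurable
    also have "\<dots> \<le> (\<Sum>m. ennreal (\<nu> m) * ennreal B)"
      by (intro suminf_le mult_left_mono B(2) G) auto
    also have "\<dots> = ennreal (\<Sum>m. \<nu> m) * ennreal B"
      using \<nu> by (simp only: ennreal_suminf_multc) (simp add: suminf_ennreal2)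
    also have "\<dots> < \<infinity>" by (simp add: ennreal_mult_less_top)
    finally show ?thesis by (intro nn_integral_PInf_AE) auto
  qed
  then have "AE x in lebesgue. \<forall>k. U x * indicator (cube 0 (real (Suc k))) x \<noteq> \<infinity>"
    unfolding AE_all_countable by blast
  then show ?thesis
  proof eventually_elim
    case (elim x)
    obtain k where "2 * norm x \<le> real k" using real_arch_simple by blast
    then have "x \<in> cube 0 (real (Suc k))" by (intro mem_cube_of_norm_le) simp
    with elim[rule_format, of k] show ?case unfolding U_def by (simp add: less_top)
  qed
qed

section \<open>Boundedness on block spaces\<close>

theorem maximal_bounded_bounded_blocks:
  fixes w :: "real^'n \<Rightarrow> real"
  assumes q: "0 < q" "q < p" and D: "w \<in> D_class q" and P: "w \<in> P_class"
  shows "maximal_bounded_block_Lp p \<infinity> w"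
proof (rule maximal_bounded_block_LpI[OF _ q D P])
  show "(\<integral>\<^sup>+ x. ennreal (w x) * ennreal (\<bar>G x\<bar> powr p) \<partial>lebesgue) \<le> ennreal 1" if "is_block p \<infinity> w G" for G
    by (rule bounded_block_Lp_bound[OF _ _ _ that])
      (use q D in \<open>auto simp: D_class_def intro: wmeas_cube_pos[OF D P]\<close>)
qed auto

theorem maximal_bounded_into_weighted_Lp:
  fixes w :: "real^'n \<Rightarrow> real"
  assumes q: "0 < q" "q < p" and r: "1 < r" and w: "w \<in> A_class q r" and P: "w \<in> P_class"
    and s: "1 < s" "ennreal (r * p / (r - 1)) \<le> s"
  shows "maximal_bounded_block_Lp p s w"
proof -
  have D: "w \<in> D_class q" and RH: "w \<in> RH_class r" using w by (auto simp: A_class_def)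
  show ?thesis
  proof (cases s)
    case top
    then show ?thesis using maximal_bounded_bounded_blocks[OF q D P] by simp
  next
    case (real \<sigma>)
    have \<sigma>: "1 < \<sigma>" "r * p / (r - 1) \<le> \<sigma>" using s real by auto
    have p: "0 < p" using q by simp
    have pos: "0 < wmeas w (cube c l)" if "0 < l" for c l by (rule wmeas_cube_pos[OF D P that])
    obtain B where B: "0 \<le> B" "\<And>G. is_block p (ennreal \<sigma>) w G \<Longrightarrow>
      (\<integral>\<^sup>+ x. ennreal (w x) * ennreal (\<bar>G x\<bar> powr p) \<partial>lebesgue) \<le> ennreal B"
      using block_Lp_bound[OF p r RH pos \<sigma>] by blast
    show ?thesis
      unfolding real(2) by (rule maximal_bounded_block_LpI[OF _ q D P B]) (use \<sigma> in auto)
  qed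
qed

text \<open>Bounded blocks are blocks for every finite exponent, so the almost everywhere convergence of
  their series follows from the case \<open>s < \<infinity>\<close>, with an exponent as large as \<open>r p / (r - 1)\<close>.\<close>

theorem maximal_bounded_into_block_space:
  fixes w :: "real^'n \<Rightarrow> real"
  assumes q: "0 < q" "q < p" and r: "1 < r" and w: "w \<in> A_class q r" and P: "w \<in> P_class"
    and s: "1 < s" "ennreal (r * p / (r - 1)) \<le> s"
  shows "maximal_bounded_block_block p s w"
proof -
  have D: "w \<in> D_class q" and RH: "w \<in> RH_class r" using w by (auto simp: A_class_def)
  note pos = wmeas_cube_pos[OF D P]
  have iff: "is_block p s w G \<longleftrightarrow>
      (\<exists>c l. 0 < l \<and> Ls_bounded s c l (wmeas w (cube c l) powr (- 1 / p)) G)" if "1 < s" for s G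
    by (rule is_block_iff_Ls_bounded[OF that]) (rule pos)
  obtain \<sigma> where \<sigma>: "1 < \<sigma>" "r * p / (r - 1) \<le> \<sigma>"
    and block: "\<And>G. is_block p s w G \<Longrightarrow> is_block p (ennreal \<sigma>) w G"
  proof (cases s)
    case (real \<sigma>)
    show ?thesis by (rule that[of \<sigma>]) (use s real in auto)
  next
    case top
    define \<sigma> where "\<sigma> = max 2 (r * p / (r - 1))"
    have \<sigma>: "1 < ennreal \<sigma>" by (simp add: \<sigma>_def less_max_iff_disj)
    show ?thesis
    proof (rule that[of \<sigma>])
      fix G assume "is_block p s w G"
      then obtain c l where cl: "0 < l" "Ls_bounded \<infinity> c l (wmeas w (cube c l) powr (- 1 / p)) G"
        unfolding iff[OF s(1)] using top by auto
      have "Ls_bounded (ennreal \<sigma>) c l (wmeas w (cube c l) powr (- 1 / p)) G"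
        by (rule Ls_bounded_top_imp[OF cl(2)]) (use cl(1) in auto)
      with cl(1) show "is_block p (ennreal \<sigma>) w G" unfolding iff[OF \<sigma>] by blast
    qed (auto simp: \<sigma>_def)
  qed
  show ?thesis
    by (rule maximal_bounded_block_blockI[OF s(1) q D P])
      (rule block_series_finite_AE[OF q D P RH r \<sigma>], auto intro: block)
qed

theorem theorem2p9:
  fixes p :: real
  assumes "0 < p"
  shows
    "(\<forall>(w :: real^'n \<Rightarrow> real) q. 0 < q \<and> q < p \<and> w \<in> D_class q \<inter> P_class \<longrightarrow>
        maximal_bounded_block_Lp p \<infinity> w) \<and>
     (\<forall>(w :: real^'n \<Rightarrow> real) q r. 0 < q \<and> q < p \<and> 1 < r \<and> w \<in> A_class q r \<inter> P_class \<longrightarrow>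
        (\<forall>s :: ennreal. 1 < s \<and> ennreal (r * p / (r - 1)) \<le> s \<longrightarrow>
           maximal_bounded_block_Lp p s w) \<and>
        (\<forall>s :: ennreal. ennreal (max (r * p / (r - 1)) (p / q)) < s \<longrightarrow>
           maximal_bounded_block_block p s w))"
proof (intro conjI allI impI; (elim conjE IntE)?)
  fix w :: "real^'n \<Rightarrow> real" and q :: real
  assume "0 < q" "q < p" "w \<in> D_class q" "w \<in> P_class"
  then show "maximal_bounded_block_Lp p \<infinity> w" by (rule maximal_bounded_bounded_blocks)
next
  fix w :: "real^'n \<Rightarrow> real" and q r :: real and s :: ennreal
  assume "0 < q" "q < p" "1 < r" "w \<in> A_class q r" "w \<in> P_class"
    and "1 < s" "ennreal (r * p / (r - 1)) \<le> s"
  then show "maximal_bounded_block_Lp p s w" by (rule maximal_bounded_into_weighted_Lp)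
next
  fix w :: "real^'n \<Rightarrow> real" and q r :: real and s :: ennreal
  assume q: "0 < q" "q < p" and r: "1 < r" and w: "w \<in> A_class q r" "w \<in> P_class"
    and s: "ennreal (max (r * p / (r - 1)) (p / q)) < s"
  \<comment> \<open>Since \<open>q < p\<close>, the bound \<open>p / q\<close> forces \<open>s > 1\<close>, the range of the strong type estimate.\<close>
  have "ennreal 1 \<le> ennreal (max (r * p / (r - 1)) (p / q))"
    using q by (intro ennreal_leI) (simp add: le_max_iff_disj)
  from le_less_trans[OF this s] have "1 < s" by simp
  moreover have "ennreal (r * p / (r - 1)) \<le> ennreal (max (r * p / (r - 1)) (p / q))"
    by (intro ennreal_leI) simp
  from le_less_trans[OF this s] have "ennreal (r * p / (r - 1)) \<le> s" by (rule less_imp_le)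
  ultimately show "maximal_bounded_block_block p s w"
    by (rule maximal_bounded_into_block_space[OF q r w])
qed

end
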